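(* Let $0<\zeta<\pi$ and let $N$ be an arbitrary non-negative integer. Let $\mu$ and $\nu$ be complex numbers satisfying $- N - \frac{1}{2} < \Re \mu < \frac{1}{2}$ and $\Re \nu> -\Re \mu-1$. Put $\beta_{\mu,\nu,n}= \left( \nu + n + \tfrac{1}{2} \right)\zeta + \left( \mu + n - \tfrac{1}{2}\right)\tfrac{\pi }{2}$. Define $\widehat{R}_N^{(\mathsf{P})}(\zeta,\mu,\nu)$ and $\widehat{R}_N^{(\mathsf{Q})}(\zeta,\mu,\nu)$ by $$\mathsf{P}_\nu ^\mu (\cos\zeta) = \sqrt{\frac{2}{\pi\sin\zeta}}\,\Gamma(\nu+\mu+1)\left(\sum_{n=0}^{N-1} \frac{a_n(\mu)\cos(\beta_{\mu,\nu,n})}{\Gamma\left(\nu+\frac32+n\right) \sin^n\zeta} +\widehat{R}_N^{(\mathsf{P})}(\zeta,\mu,\nu)\right),$$ $$\mathsf{Q}_\nu ^\mu (\cos\zeta) = -\sqrt{\frac{\pi}{2\sin\zeta}}\,\Gamma(\nu+\mu+1)\left(\sum_{n=0}^{N-1} \frac{a_n(\mu)\sin(\beta_{\mu,\nu,n})}{\Gamma\left(\nu+\frac32+n\right) \sin^n\zeta} +\widehat{R}_N^{(\mathsf{Q})}(\zeta,\mu,\nu)\right).$$ Put $$G=\left| \frac{\cos (\pi \mu )}{\cos (\pi \Re \mu )} \right|\left| \frac{\Gamma \left( \frac{1}{2} - \Re \mu \right)\Gamma (\Re \nu + \Re \mu + 1)}{\Gamma \left( \frac{1}{2} - \mu \right)\Gamma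 (\nu + \mu + 1)}\right|,\qquad s(\zeta)=\begin{cases} | \sec \zeta | & \text{if } 0 < \zeta \le \frac{\pi}{4} \text{ or } \frac{3\pi}{4} \le \zeta < \pi, \\ 2\sin \zeta & \text{if } \frac{\pi}{4} < \zeta < \frac{3\pi}{4}.\end{cases}$$ Then $$\left|\widehat{R}_N^{(\mathsf{P})}(\zeta,\mu,\nu)\right|,\ \left|\widehat{R}_N^{(\mathsf{Q})}(\zeta,\mu,\nu)\right|\le G\, \frac{\left| a_N (\Re \mu ) \right|\cosh (\Im (\beta _{\mu ,\nu ,N} ))}{\Gamma \left( \Re \nu + \frac{3}{2} + N \right)\sin ^N \zeta }\, s(\zeta),$$ $$\left|\widehat{R}_N^{(\mathsf{P})}(\zeta,\mu,\nu)\right| \le G\left(\frac{\left| a_N (\Re \mu ) \cos ( \beta _{\mu ,\nu ,N} )\right|}{\Gamma \left( \Re \nu + \frac{3}{2} + N \right)\sin ^N \zeta } + \frac{\left| a_{N+1} (\Re \mu ) \sin ( \beta _{\mu ,\nu ,N} )\right|}{\Gamma \left( \Re \nu + \frac{5}{2} + N \right)\sin ^{N+1} \zeta }\right) s(\zeta),$$ $$\left|\widehat{R}_N^{(\mathsf{Q})}(\zeta,\mu,\nu)\right| \le G\left(\frac{\left| a_N (\Re \mu ) \sin ( \beta _{\mu ,\nu ,N} )\right|}{\Gamma \left( \Re \nu + \frac{3}{2} + N \right)\sin ^N \zeta } + \frac{\left| a_{N+1} (\Re \mu ) \cos ( \beta _{\mu ,\nu ,N} )\right|}{\Gamma \left(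 \Re \nu + \frac{5}{2} + N \right)\sin ^{N+1} \zeta }\right) s(\zeta).$$ If $2\Re\mu $ is an odd integer, then the limiting values have to be taken in these bounds.
   Context: The Ferrers functions are defined for $-1<x<1$ by $$\mathsf{P}_\nu ^\mu (x) = \left( \frac{1 + x}{1 - x} \right)^{\mu /2} \mathbf{F}\left(\nu+1,-\nu;1-\mu;\tfrac{1-x}{2}\right)$$ and, for $\nu+\mu\notin\mathbb{Z}_{<0}$, $$\mathsf{Q}_\nu ^\mu (x) = \frac{\pi }{2\sin (\pi \mu )}\left( \cos (\pi \mu )\left( \frac{1 + x}{1 - x}\right)^{\mu /2} \mathbf{F}\left(\nu+1,-\nu;1-\mu;\tfrac{1-x}{2}\right)- \frac{\Gamma (\nu + \mu + 1)}{\Gamma (\nu - \mu + 1)}\left( \frac{1 - x}{1 + x} \right)^{\mu /2} \mathbf{F}\left(\nu+1,-\nu;1+\mu;\tfrac{1-x}{2}\right)\right)$$ (limiting value when $\mu$ is an integer), where $\mathbf{F}(a,b;c;w)=\sum_{n\ge 0}\frac{(a)_n(b)_n}{\Gamma(c+n)\,n!}w^n$ ($|w|<1$) is the regularised hypergeometric function. $a_n (\mu ) = \frac{(4\mu ^2 - 1^2 )(4\mu ^2 - 3^2 ) \cdots (4\mu ^2 - (2n - 1)^2 )}{8^n n!}=\frac{(\frac12-\mu)_n(\frac12+\mu)_n}{(-2)^n n!}$, with $(\cdot)_n$ the Pochhammer symbol; $1/\Gamma$ is taken to be $0$ at the poles of $\Gamma$. "Limiting value" in the bounds means that $|a_k(\Re\mu)|/|\cos(\pi\Re\mu)|$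 is replaced by $\lim_{x\to\Re\mu}|a_k(x)|/|\cos(\pi x)|$. *)

theory Defs
  imports "HOL-Analysis.Analysis"
begin

definition hyp2F1_reg :: "complex \<Rightarrow> complex \<Rightarrow> complex \<Rightarrow> complex \<Rightarrow> complex" where
  "hyp2F1_reg a b c w =
     (\<Sum>n. pochhammer a n * pochhammer b n * rGamma (c + of_nat n) / fact n * w ^ n)"

definition ferrers_P :: "complex \<Rightarrow> complex \<Rightarrow> real \<Rightarrow> complex" where
  "ferrers_P \<nu> \<mu> x =
     complex_of_real ((1 + x) / (1 - x)) powr (\<mu> / 2)
       * hyp2F1_reg (\<nu> + 1) (- \<nu>) (1 - \<mu>) (of_real ((1 - x) / 2))"

definition ferrers_Q_nonint :: "complex \<Rightarrow> complex \<Rightarrow> real \<Rightarrow> complex" where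
  "ferrers_Q_nonint \<nu> \<mu> x =
     of_real pi / (2 * sin (of_real pi * \<mu>)) *
       (cos (of_real pi * \<mu>) * complex_of_real ((1 + x) / (1 - x)) powr (\<mu> / 2)
            * hyp2F1_reg (\<nu> + 1) (- \<nu>) (1 - \<mu>) (of_real ((1 - x) / 2))
        - Gamma (\<nu> + \<mu> + 1) * rGamma (\<nu> - \<mu> + 1)
            * complex_of_real ((1 - x) / (1 + x)) powr (\<mu> / 2)
            * hyp2F1_reg (\<nu> + 1) (- \<nu>) (1 + \<mu>) (of_real ((1 - x) / 2)))"

text \<open>Only meaningful when \<open>\<nu> + \<mu>\<close> is not a negative integer.\<close>

definition ferrers_Q :: "complex \<Rightarrow> complex \<Rightarrow> real \<Rightarrow> complex" where
  "ferrers_Q \<nu> \<mu> x =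
     (if \<mu> \<in> \<int> then Lim (at \<mu>) (\<lambda>m. ferrers_Q_nonint \<nu> m x) else ferrers_Q_nonint \<nu> \<mu> x)"

definition a_coeff :: "nat \<Rightarrow> 'a :: field_char_0 \<Rightarrow> 'a" where
  "a_coeff n \<mu> = (\<Prod>k=1..n. 4 * \<mu>\<^sup>2 - (2 * of_nat k - 1)\<^sup>2) / (8 ^ n * fact n)"

definition ferrers_beta :: "real \<Rightarrow> complex \<Rightarrow> complex \<Rightarrow> nat \<Rightarrow> complex" where
  "ferrers_beta \<zeta> \<mu> \<nu> n =
     (\<nu> + of_nat n + 1 / 2) * of_real \<zeta> + (\<mu> + of_nat n - 1 / 2) * of_real (pi / 2)"

text \<open>The bounds contain \<open>|cos (\<pi> \<mu>) / cos (\<pi> Re \<mu>)|\<close> as part of a factor multiplying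
  \<open>|a\<^sub>k (Re \<mu>)|\<close>, with a limiting value when \<open>2 Re \<mu>\<close> is an odd integer.  The limit
  concerns the real quotient \<open>|a\<^sub>k| / |cos (\<pi> \<cdot>)|\<close> only, so that quotient is
  \<open>abs_a_over_cos\<close>, and \<open>bound_factor\<close> is the remaining part of the factor.\<close>

definition abs_a_over_cos :: "nat \<Rightarrow> real \<Rightarrow> real" where
  "abs_a_over_cos k x =
     (if \<exists>m::int. odd m \<and> 2 * x = of_int m
      then Lim (at x) (\<lambda>t. \<bar>a_coeff k t\<bar> / \<bar>cos (pi * t)\<bar>)
      else \<bar>a_coeff k x\<bar> / \<bar>cos (pi * x)\<bar>)"

definition bound_factor :: "complex \<Rightarrow> complex \<Rightarrow> real" where
  "bound_factor \<mu> \<nu> =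
     cmod (cos (of_real pi * \<mu>))
       * cmod (of_real (Gamma (1 / 2 - Re \<mu>) * Gamma (Re \<nu> + Re \<mu> + 1))
                / (Gamma (1 / 2 - \<mu>) * Gamma (\<nu> + \<mu> + 1)))"

definition s_factor :: "real \<Rightarrow> real" where
  "s_factor \<zeta> = (if \<zeta> \<le> pi / 4 \<or> 3 * pi / 4 \<le> \<zeta> then \<bar>1 / cos \<zeta>\<bar> else 2 * sin \<zeta>)"

end

theory Submission
  imports Defs "HOL-Complex_Analysis.Complex_Analysis" "HOL-Real_Asymp.Real_Asymp"
begin

text \<open>
  Put \<open>w = 1 / (1 - e\<^sup>-\<^sup>2\<^sup>i\<^sup>\<zeta>)\<close>, so that \<open>Re w = 1/2\<close>, and let \<open>E(w)\<close> be the Euler integral of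
  \<open>t\<^bsup>-\<mu>-1/2\<^esup> (1 - t)\<^bsup>\<nu>+\<mu>\<^esup> (1 - w t)\<^bsup>-\<mu>-1/2\<^esup>\<close> over \<open>(0, 1)\<close>.  For \<open>Re \<mu> < -1/2\<close>, integrating the series
  of \<open>cos ((\<nu> + 1/2) t)\<close> in powers of \<open>sin\<^sup>2 (t/2)\<close> termwise gives the Mehler-Dirichlet integral for the
  function P; moving its path of integration to the two vertical half-lines through \<open>\<plusminus>\<zeta>\<close> turns it into
  \<open>e\<^sup>i\<^sup>\<beta> E(w) + e\<^sup>-\<^sup>i\<^sup>\<beta> E(cnj w)\<close> with \<open>\<beta> = \<beta>\<^sub>0\<close>.  Analytic continuation in \<open>\<mu>\<close> and then in \<open>\<nu>\<close> yields
  this for all admissible parameters.  Up to Gamma factors, \<open>E(w)\<close> is a hypergeometric function that is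
  even in \<open>\<mu>\<close>; hence the same formula for \<open>-\<mu>\<close> gives Q as \<open>e\<^sup>i\<^sup>\<beta> E(w) - e\<^sup>-\<^sup>i\<^sup>\<beta> E(cnj w)\<close>.

  The remainder of the binomial series of \<open>(1 - w t)\<^bsup>-\<mu>-1/2\<^esup>\<close> is a Beta-type integral with the kernel
  \<open>1 / (1 - w t s)\<close>.  Taking absolute values under both integrals leaves products of real Beta functions,
  and the bounds follow from elementary estimates of \<open>e\<^sup>i\<^sup>\<beta> / (1 - w \<tau>) \<plusminus> e\<^sup>-\<^sup>i\<^sup>\<beta> / (1 - cnj w \<tau>)\<close>
  for \<open>0 < \<tau> < 1\<close>.
\<close>

section \<open>Euler integrals\<close>

text \<open>The modulus of w is 1 / (2 sin \<zeta>), which exceeds 1 when sin \<zeta> < 1/2. Power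
  series identities in w are therefore proved in the unit disc and continued to the half-plane Re w
  < 1, where 1 - w t stays off the branch cut for 0 \<le> t \<le> 1. The start at Re \<mu> < -1/2
  makes the Mehler-Dirichlet integrand continuous up to the end points, so Cauchy's theorem applies
  to closed rectangles. Together with Re \<nu> + Re \<mu> > -1 it forces Re \<nu> > -1/2; this is
  why a continuation in \<nu> has to follow the one in \<mu>. The definition of Q divides by sin (pi
  \<mu>), so its numerator is continued and the division comes last. The factor s(\<zeta>) bounds 1
  / |1 - w \<tau>| on 0 < \<tau> < 1. The cosh bounds come from the triangle inequality. The
  two-term bounds keep the real and imaginary parts of 1 - w \<tau> apart; the imaginary part is
  proportional to \<tau>, and this extra \<tau> moves both Beta functions from N to N + 1. By the
  reflection formula the zeros of cos (pi Re \<mu>) are also zeros of a_N (Re \<mu>); the quotient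
  is a product of Gamma values, and this yields the limiting values.\<close>

text \<open>Dominated convergence for difference quotients: by Cauchy's inequality a locally uniform
  integrable bound for \<open>f\<close> also bounds its derivative in the parameter.\<close>

lemma holomorphic_parametric_integral:
  fixes f :: "complex \<Rightarrow> 'a::euclidean_space \<Rightarrow> complex"
  assumes "open S"
    and hol: "\<And>t. t \<in> A \<Longrightarrow> (\<lambda>z. f z t) holomorphic_on S"
    and int: "\<And>z. z \<in> S \<Longrightarrow> f z integrable_on A"
    and dom: "\<And>z0. z0 \<in> S \<Longrightarrow> \<exists>r>0. \<exists>g. cball z0 r \<subseteq> S \<and> g integrable_on A \<and>
                 (\<forall>z\<in>cball z0 r. \<forall>t\<in>A. norm (f z t) \<le> g t)"
  shows "(\<lambda>z. integral A (f z)) holomorphic_on S"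
  unfolding holomorphic_on_def
proof
  fix z0 assume z0: "z0 \<in> S"
  obtain r g where r: "r > 0" "cball z0 r \<subseteq> S" and g: "g integrable_on A"
    and bound: "\<And>z t. z \<in> cball z0 r \<Longrightarrow> t \<in> A \<Longrightarrow> norm (f z t) \<le> g t"
    using dom[OF z0] by blast
  define D where "D = integral A (\<lambda>t. deriv (\<lambda>z. f z t) z0)"
  \<comment> \<open>For \<open>y\<close> in the ball of half the radius, the circle of radius
    \<open>r/2\<close> about \<open>y\<close> stays inside \<open>cball z0 r\<close>, where
    \<open>g\<close> dominates. This is the origin of the constant \<open>2 / r\<close>.\<close>
  have lip: "norm ((f z t - f z0 t) / (z - z0)) \<le> 2 / r * g t"
    if z: "z \<in> ball z0 (r/2)" "z \<noteq> z0" and t: "t \<in> A" for z t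
  proof -
    have der: "norm (deriv (\<lambda>z. f z t) y) \<le> 2 / r * g t" if y: "y \<in> ball z0 (r/2)" for y
    proof -
      have sub: "cball y (r/2) \<subseteq> cball z0 r"
      proof
        fix u assume "u \<in> cball y (r/2)"
        then show "u \<in> cball z0 r" using y dist_triangle[of z0 u y] by (simp)
      qed
      have "norm ((deriv ^^ 1) (\<lambda>z. f z t) y) \<le> fact 1 * g t / (r/2)^1"
      proof (rule Cauchy_inequality)
        show "(\<lambda>z. f z t) holomorphic_on ball y (r/2)"
          by (rule holomorphic_on_subset[OF hol[OF t]]) (use sub r in \<open>auto simp: subset_iff\<close>)
        show "continuous_on (cball y (r/2)) (\<lambda>z. f z t)"
          by (rule holomorphic_on_imp_continuous_on, rule holomorphic_on_subset[OF hol[OF t]])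
             (use sub r in auto)
        show "norm (f x t) \<le> g t" if "norm (y - x) = r/2" for x
          using that sub t by (intro bound) (auto simp: dist_norm)
      qed (use r in auto)
      then show ?thesis by (simp add: mult.commute)
    qed
    have "norm (f z t - f z0 t) \<le> 2 / r * g t * norm (z - z0)"
    proof (rule field_differentiable_bound[of "ball z0 (r/2)" "\<lambda>z. f z t" "deriv (\<lambda>z. f z t)"])
      fix y assume y: "y \<in> ball z0 (r/2)"
      then have "y \<in> S" using r by (auto simp: subset_iff)
      then show "((\<lambda>z. f z t) has_field_derivative deriv (\<lambda>z. f z t) y) (at y within ball z0 (r/2))"
        using holomorphic_derivI[OF hol[OF t] \<open>open S\<close>] by blast
    qed (use z der r in auto)
    then show ?thesis using z by (simp add: norm_divide divide_le_eq)
  qed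
  have "((\<lambda>z. (integral A (f z) - integral A (f z0)) / (z - z0)) \<longlongrightarrow> D) (at z0)"
    unfolding tendsto_at_iff_sequentially comp_def
  proof (intro allI impI)
    fix X assume X: "\<forall>i. X i \<in> UNIV - {z0}" "X \<longlonglongrightarrow> z0"
    then obtain m where m: "\<And>n. n \<ge> m \<Longrightarrow> X n \<in> ball z0 (r/2)"
      using r unfolding lim_sequentially
      by (metis dist_commute half_gt_zero mem_ball)
    define Y where "Y n = X (n + m)" for n
    have Y: "Y n \<in> ball z0 (r/2)" "Y n \<noteq> z0" "Y n \<in> S" for n
    proof -
      show "Y n \<in> ball z0 (r/2)" using m by (simp add: Y_def)
      then show "Y n \<in> S" using r by (auto simp: subset_iff)
      show "Y n \<noteq> z0" using X by (auto simp: Y_def)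
    qed
    have Ylim: "Y \<longlonglongrightarrow> z0" unfolding Y_def using X by (simp add: LIMSEQ_ignore_initial_segment)
    have "(\<lambda>n. integral A (\<lambda>t. (f (Y n) t - f z0 t) / (Y n - z0))) \<longlonglongrightarrow> D"
      unfolding D_def
    proof (rule dominated_convergence(2)[where h="\<lambda>t. 2 / r * g t"])
      show "(\<lambda>t. (f (Y n) t - f z0 t) / (Y n - z0)) integrable_on A" for n
        using int[OF Y(3)[of n]] int[OF z0]
        by (intro integrable_on_divide integrable_diff) auto
      show "(\<lambda>t. 2 / r * g t) integrable_on A" using g by (rule integrable_on_mult_right)
      show "norm ((f (Y n) t - f z0 t) / (Y n - z0)) \<le> 2 / r * g t" if "t \<in> A" for n t
        using lip Y that by blast
      show "(\<lambda>n. (f (Y n) t - f z0 t) / (Y n - z0)) \<longlonglongrightarrow> deriv (\<lambda>z. f z t) z0" if t: "t \<in> A" for t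
      proof -
        have "((\<lambda>z. f z t) has_field_derivative deriv (\<lambda>z. f z t) z0) (at z0)"
          using holomorphic_derivI[OF hol[OF t] \<open>open S\<close> z0] by blast
        then have "((\<lambda>z. (f z t - f z0 t) / (z - z0)) \<longlongrightarrow> deriv (\<lambda>z. f z t) z0) (at z0)"
          by (simp add: has_field_derivative_iff)
        then show ?thesis using Y Ylim unfolding tendsto_at_iff_sequentially comp_def by auto
      qed
    qed
    moreover have "integral A (\<lambda>t. (f (Y n) t - f z0 t) / (Y n - z0)) =
        (integral A (f (Y n)) - integral A (f z0)) / (Y n - z0)" for n
      using int Y z0 by (simp add: integral_diff)
    ultimately have "(\<lambda>n. (integral A (f (X (n+m))) - integral A (f z0)) / (X (n+m) - z0)) \<longlonglongrightarrow> D"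
      by (simp only: Y_def)
    then show "(\<lambda>n. (integral A (f (X n)) - integral A (f z0)) / (X n - z0)) \<longlonglongrightarrow> D"
      by (rule LIMSEQ_offset)
  qed
  then have "((\<lambda>z. integral A (f z)) has_field_derivative D) (at z0)"
    by (simp add: has_field_derivative_iff)
  then show "(\<lambda>z. integral A (f z)) field_differentiable at z0 within S"
    using field_differentiable_at_within field_differentiable_def by blast
qed

section \<open>The Euler kernel: integrability, holomorphy in the parameters, Beta values\<close>

text \<open>Principal powers throughout. The free exponent \<open>k\<close> serves three purposes:
  \<open>k = - 1/2 - \<mu>\<close> for the waves, \<open>k = - 1\<close> for the kernel in the
  binomial remainder, and \<open>k = 0\<close>, \<open>w = 0\<close> for a pure Beta weight.\<close>

definition euler_kernel :: "complex \<Rightarrow> complex \<Rightarrow> complex \<Rightarrow> complex \<Rightarrow> real \<Rightarrow> complex" where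
  "euler_kernel p q k w t =
     of_real t powr p * of_real (1 - t) powr q * (1 - w * of_real t) powr k"

definition euler_integral :: "complex \<Rightarrow> complex \<Rightarrow> complex \<Rightarrow> complex \<Rightarrow> complex" where
  "euler_integral p q k w = integral {0<..<1} (euler_kernel p q k w)"

lemma beta_has_integral:
  assumes "a > -1" "b > -1"
  shows "((\<lambda>t::real. t powr a * (1 - t) powr b) has_integral Beta (a + 1) (b + 1)) {0<..<1}"
  using has_integral_Beta_real[of "a+1" "b+1"] assms by (simp add: has_integral_Icc_iff_Ioo)

lemma absolutely_integrable_dominated_by_beta:
  fixes f :: "real \<Rightarrow> complex"
  assumes "continuous_on {0<..<1} f" "a > -1" "b > -1"
    and "\<And>t. 0 < t \<Longrightarrow> t < 1 \<Longrightarrow> norm (f t) \<le> M * (t powr a * (1 - t) powr b)"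
  shows "f absolutely_integrable_on {0<..<1}"
proof (rule measurable_bounded_by_integrable_imp_absolutely_integrable)
  show "f \<in> borel_measurable (lebesgue_on {0<..<1})"
    using assms(1) by (intro continuous_imp_measurable_on_sets_lebesgue) auto
  show "(\<lambda>t. M * (t powr a * (1 - t) powr b)) integrable_on {0<..<1}"
    using beta_has_integral[OF assms(2,3)] by (intro integrable_on_mult_right) blast
qed (use assms in auto)

text \<open>However large the modulus of \<open>w\<close> is, the condition \<open>Re w < 1\<close>
  keeps the segment from 1 to \<open>1 - w\<close> in the open right half-plane. Hence this
  half-plane is the natural domain of the Euler integral as a function of \<open>w\<close>.\<close>

lemma one_minus_mult_not_nonpos:
  fixes w :: complex and t :: real
  assumes "Re w < 1" "0 \<le> t" "t \<le> 1"
  shows "Re (1 - w * of_real t) > 0" "1 - w * of_real t \<notin> \<real>\<^sub>\<le>\<^sub>0"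
proof -
  have "Re w * t < 1"
  proof (cases "Re w \<le> 0")
    case True then show ?thesis using assms mult_nonpos_nonneg[of "Re w" t] by linarith
  next
    case False
    then have "Re w * t \<le> Re w * 1" using assms by (intro mult_left_mono) auto
    then show ?thesis using assms by simp
  qed
  then show *: "Re (1 - w * of_real t) > 0" by simp
  then show "1 - w * of_real t \<notin> \<real>\<^sub>\<le>\<^sub>0" using complex_nonpos_Reals_iff by force
qed

lemma norm_euler_kernel:
  assumes "0 < t" "t < 1"
  shows "norm (euler_kernel p q k w t) =
    t powr Re p * (1 - t) powr Re q * norm ((1 - w * of_real t) powr k)"
  using assms by (simp add: euler_kernel_def norm_mult norm_powr_real_powr)

lemma continuous_on_euler_kernel:
  assumes "Re w < 1"
  shows "continuous_on {0<..<1} (euler_kernel p q k w)"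
  unfolding euler_kernel_def
proof (intro continuous_intros)
  show "{0<..<1} \<subseteq> {z::real. 0 \<le> Re (1 - w * of_real z) \<or> Im (1 - w * of_real z) \<noteq> 0}"
    using one_minus_mult_not_nonpos(1)[OF assms] by (auto simp: less_imp_le)
  show "1 - w * of_real z = 0 \<Longrightarrow> 0 < Re k" if "z \<in> {0<..<1}" for z
    using one_minus_mult_not_nonpos(1)[OF assms, of z] that by auto
qed (auto simp: complex_eq_iff)

text \<open>The factor with \<open>w\<close> is continuous on the compact product of
  \<open>K\<close> and the closed unit interval. A bound uniform in the parameters leaves a real
  Beta integrand as dominating function.\<close>

lemma euler_last_factor_bound:
  fixes k w :: "complex \<Rightarrow> complex"
  assumes "compact K" "continuous_on K k" "continuous_on K w" "\<And>z. z \<in> K \<Longrightarrow> Re (w z) < 1"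
  obtains M where "M > 0"
    "\<And>z t. z \<in> K \<Longrightarrow> 0 \<le> t \<Longrightarrow> t \<le> 1 \<Longrightarrow> norm ((1 - w z * of_real t) powr k z) \<le> M"
proof -
  let ?h = "\<lambda>x. (1 - w (fst x) * of_real (snd x)) powr k (fst x)"
  have "compact (K \<times> {0..1::real})" using assms by (intro compact_Times) auto
  moreover have "continuous_on (K \<times> {0..1::real}) ?h"
  proof (intro continuous_intros)
    show "continuous_on (K \<times> {0..1::real}) (\<lambda>x. w (fst x))"
      by (rule continuous_on_compose2[OF assms(3) continuous_on_fst[OF continuous_on_id]]) auto
    show "continuous_on (K \<times> {0..1::real}) (\<lambda>x. k (fst x))"
      by (rule continuous_on_compose2[OF assms(2) continuous_on_fst[OF continuous_on_id]]) auto
    show "K \<times> {0..1::real} \<subseteq> {x. 0 \<le> Re (1 - w (fst x) * of_real (snd x)) \<or>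
             Im (1 - w (fst x) * of_real (snd x)) \<noteq> 0}"
      using one_minus_mult_not_nonpos(1)[OF assms(4)] by (fastforce simp: less_imp_le)
    show "1 - w (fst z) * of_real (snd z) = 0 \<Longrightarrow> 0 < Re (k (fst z))"
      if "z \<in> K \<times> {0..1::real}" for z
      using one_minus_mult_not_nonpos(1)[OF assms(4), of "fst z" "snd z"] that by auto
  qed
  ultimately have "bounded (?h ` (K \<times> {0..1}))"
    by (intro compact_imp_bounded compact_continuous_image)
  then obtain M where "M > 0" "\<And>x. x \<in> K \<times> {0..1} \<Longrightarrow> norm (?h x) \<le> M"
    unfolding bounded_pos by auto
  then show ?thesis by (intro that[of M]) auto
qed

lemma euler_kernel_absolutely_integrable:
  assumes "Re p > -1" "Re q > -1" "Re w < 1"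
  shows "euler_kernel p q k w absolutely_integrable_on {0<..<1}"
proof -
  obtain M where M: "M > 0"
    "\<And>z t. z \<in> {0} \<Longrightarrow> 0 \<le> t \<Longrightarrow> t \<le> 1 \<Longrightarrow> norm ((1 - w * of_real t) powr k) \<le> M"
    by (rule euler_last_factor_bound[of "{0}" "\<lambda>_. k" "\<lambda>_. w"]) (use assms in auto)
  show ?thesis
  proof (rule absolutely_integrable_dominated_by_beta[where a="Re p" and b="Re q" and M=M])
    fix t :: real assume t: "0 < t" "t < 1"
    have "t powr Re p * (1 - t) powr Re q * norm ((1 - w * of_real t) powr k)
        \<le> t powr Re p * (1 - t) powr Re q * M"
      using M t by (intro mult_left_mono) auto
    then show "norm (euler_kernel p q k w t) \<le> M * (t powr Re p * (1 - t) powr Re q)"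
      using t by (simp add: norm_euler_kernel mult_ac)
  qed (use assms continuous_on_euler_kernel in auto)
qed

lemma euler_kernel_integrable:
  assumes "Re p > -1" "Re q > -1" "Re w < 1"
  shows "euler_kernel p q k w integrable_on {0<..<1}"
  using euler_kernel_absolutely_integrable[OF assms] set_lebesgue_integral_eq_integral(1) by blast

lemma euler_integral_holomorphic:
  assumes "open S" and hol: "p holomorphic_on S" "q holomorphic_on S" "k holomorphic_on S" "w holomorphic_on S"
    and dom: "\<And>z. z \<in> S \<Longrightarrow> Re (p z) > -1" "\<And>z. z \<in> S \<Longrightarrow> Re (q z) > -1"
             "\<And>z. z \<in> S \<Longrightarrow> Re (w z) < 1"
  shows "(\<lambda>z. euler_integral (p z) (q z) (k z) (w z)) holomorphic_on S"
  unfolding euler_integral_def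
proof (rule holomorphic_parametric_integral[OF \<open>open S\<close>])
  fix t :: real assume "t \<in> {0<..<1}"
  then show "(\<lambda>z. euler_kernel (p z) (q z) (k z) (w z) t) holomorphic_on S"
    unfolding euler_kernel_def
    by (intro holomorphic_intros hol) (use one_minus_mult_not_nonpos(2)[OF dom(3)] in auto)
next
  fix z assume "z \<in> S"
  then show "euler_kernel (p z) (q z) (k z) (w z) integrable_on {0<..<1}"
    by (intro euler_kernel_integrable dom)
next
  fix z0 assume "z0 \<in> S"
  then obtain r where r: "r > 0" "cball z0 r \<subseteq> S"
    using \<open>open S\<close> open_contains_cball by blast
  note cont = holomorphic_on_imp_continuous_on[OF holomorphic_on_subset[OF _ r(2)]]
  obtain M where M: "M > 0" "\<And>z t. z \<in> cball z0 r \<Longrightarrow> 0 \<le> t \<Longrightarrow> t \<le> 1 \<Longrightarrow>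
      norm ((1 - w z * of_real t) powr k z) \<le> M"
    by (rule euler_last_factor_bound[of "cball z0 r" k w]) (use r dom cont hol in auto)
  \<comment> \<open>The minimum of \<open>Re (h z)\<close> over the closed disc is attained, so it
    is still above \<open>- 1\<close>. On (0, 1) the smallest exponent gives the largest power,
    which dominates for all \<open>z\<close> at once.\<close>
  have min: "\<exists>b>-1. \<forall>z\<in>cball z0 r. b \<le> Re (h z)"
    if "h holomorphic_on S" "\<And>z. z \<in> S \<Longrightarrow> Re (h z) > -1" for h
  proof -
    have "continuous_on (cball z0 r) (\<lambda>z. Re (h z))"
      using cont[OF that(1)] by (intro continuous_intros)
    then obtain y where "y \<in> cball z0 r" "\<And>z. z \<in> cball z0 r \<Longrightarrow> Re (h y) \<le> Re (h z)"
      using continuous_attains_inf[of "cball z0 r" "\<lambda>z. Re (h z)"] r by fastforce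
    then show ?thesis using that(2) r(2) by blast
  qed
  obtain a where a: "a > -1" "\<And>z. z \<in> cball z0 r \<Longrightarrow> a \<le> Re (p z)"
    using min[OF hol(1) dom(1)] by blast
  obtain b where b: "b > -1" "\<And>z. z \<in> cball z0 r \<Longrightarrow> b \<le> Re (q z)"
    using min[OF hol(2) dom(2)] by blast
  have "norm (euler_kernel (p z) (q z) (k z) (w z) t) \<le> M * (t powr a * (1 - t) powr b)"
    if "z \<in> cball z0 r" "t \<in> {0<..<1}" for z t
  proof -
    have "t powr Re (p z) * (1 - t) powr Re (q z) * norm ((1 - w z * of_real t) powr k z)
        \<le> t powr a * (1 - t) powr b * M"
      using that a b M by (intro mult_mono powr_mono') auto
    then show ?thesis using that by (simp add: norm_euler_kernel mult_ac)
  qed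
  moreover have "(\<lambda>t. M * (t powr a * (1 - t) powr b)) integrable_on {0<..<1}"
    using beta_has_integral[OF a(1) b(1)] by (intro integrable_on_mult_right) blast
  ultimately show "\<exists>r>0. \<exists>g. cball z0 r \<subseteq> S \<and> g integrable_on {0<..<1} \<and>
      (\<forall>z\<in>cball z0 r. \<forall>t\<in>{0<..<1}. norm (euler_kernel (p z) (q z) (k z) (w z) t) \<le> g t)"
    using r by (intro exI[of _ r] conjI exI[of _ "\<lambda>t. M * (t powr a * (1 - t) powr b)"]) auto
qed

lemma not_nonpos_Ints_if_Re_pos: "Re z > 0 \<Longrightarrow> z \<notin> \<int>\<^sub>\<le>\<^sub>0"
  by (auto elim!: nonpos_Ints_cases)

text \<open>Real exponents reduce to the real Beta integral. Both sides are holomorphic for real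
  parts above \<open>- 1\<close>, so agreement on real arguments in (0, 1), which accumulate at 0,
  extends first to complex \<open>p\<close> with real \<open>q\<close> and then to complex
  \<open>q\<close>.\<close>

lemma euler_integral_beta:
  assumes "Re p > -1" "Re q > -1"
  shows "euler_integral p q k 0 = Gamma (p + 1) * Gamma (q + 1) * rGamma (p + q + 2)"
proof -
  let ?B = "\<lambda>p q. Gamma (p + 1) * Gamma (q + 1) * rGamma (p + q + 2) :: complex"
  let ?H = "{z. Re z > -1}"
  have opn: "open ?H" "connected ?H"
    using open_halfspace_Re_gt[of "-1"] convex_halfspace_Re_gt[of "-1"] convex_connected by auto
  have lim: "0 islimpt (of_real ` {0<..<1::real} :: complex set)"
  proof -
    have "(0::real) islimpt {0<..<1}" by (simp add: islimpt_greaterThanLessThan1)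
    then show ?thesis unfolding islimpt_sequential
    proof (elim exE conjE)
      fix f :: "nat \<Rightarrow> real"
      assume f: "\<forall>n. f n \<in> {0<..<1} - {0}" "f \<longlonglongrightarrow> 0"
      have "(\<lambda>n. of_real (f n) :: complex) \<longlonglongrightarrow> 0"
        using tendsto_of_real[OF f(2), where 'a=complex] by simp
      with f(1) show "\<exists>f. (\<forall>n. f n \<in> of_real ` {0<..<1::real} - {0::complex}) \<and> f \<longlonglongrightarrow> 0"
        by (intro exI[of _ "\<lambda>n. of_real (f n)"]) (auto simp: image_iff)
    qed
  qed
  have real: "euler_integral (of_real a) (of_real b) k 0 = ?B (of_real a) (of_real b)"
    if "a > -1" "b > -1" for a b
  proof -
    have "((\<lambda>t. complex_of_real (t powr a * (1 - t) powr b)) has_integral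
        of_real (Beta (a + 1) (b + 1))) {0<..<1}"
      using beta_has_integral[OF that] by (rule has_integral_of_real)
    then have "(euler_kernel a b k 0 has_integral of_real (Beta (a + 1) (b + 1))) {0<..<1}"
      by (rule has_integral_eq[rotated])
         (use powr_of_real[of "1 - _" b] in \<open>simp add: euler_kernel_def powr_of_real\<close>)
    then have "euler_integral a b k 0 = of_real (Beta (a + 1) (b + 1))"
      unfolding euler_integral_def by (rule integral_unique)
    also have "\<dots> = Beta (of_real (a+1)) (of_real (b+1))" by (rule Beta_complex_of_real[symmetric])
    finally show ?thesis
      by (simp add: Beta_def rGamma_inverse_Gamma divide_inverse add_ac)
  qed
  have holB: "(\<lambda>p. ?B p q) holomorphic_on ?H" "(\<lambda>p. ?B q p) holomorphic_on ?H" for q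
    by (intro holomorphic_intros; use not_nonpos_Ints_if_Re_pos in force)+
  have holE: "(\<lambda>p. euler_integral p q k 0) holomorphic_on ?H"
             "(\<lambda>p. euler_integral q p k 0) holomorphic_on ?H" if "Re q > -1" for q
    using that by (intro euler_integral_holomorphic opn holomorphic_intros; force)+
  have step1: "euler_integral p (of_real b) k 0 = ?B p (of_real b)" if "Re p > -1" "b > -1" for p b
  proof -
    have "euler_integral p (of_real b) k 0 - ?B p (of_real b) = 0"
    proof (rule analytic_continuation[where f="\<lambda>p. euler_integral p (of_real b) k 0 - ?B p (of_real b)"])
      show "(\<lambda>p. euler_integral p b k 0 - ?B p b) holomorphic_on ?H"
        using that by (intro holomorphic_on_diff holE holB) auto
    qed (use that opn lim real in auto)
    then show ?thesis by simp
  qed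
  have "euler_integral p q k 0 - ?B p q = 0"
  proof (rule analytic_continuation[where f="\<lambda>q. euler_integral p q k 0 - ?B p q"])
    show "(\<lambda>q. euler_integral p q k 0 - ?B p q) holomorphic_on ?H"
      using assms by (intro holomorphic_on_diff holE holB) auto
  qed (use assms opn lim step1 in auto)
  then show ?thesis by simp
qed

text \<open>Termwise integration against a Beta weight; absolute summability at \<open>t = 1\<close>
  supplies the dominating constant. It is used for the binomial series and for the hypergeometric
  series of the cosine.\<close>

lemma power_series_beta_sums:
  fixes c :: "nat \<Rightarrow> complex"
  assumes p: "Re p > -1" and q: "Re q > -1" and c: "summable (\<lambda>n. norm (c n))"
  shows "(\<lambda>n. c n * (Gamma (p + 1 + of_nat n) * Gamma (q + 1) * rGamma (p + q + 2 + of_nat n))) sums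
    integral {0<..<1} (\<lambda>t. of_real t powr p * of_real (1 - t) powr q * (\<Sum>n. c n * of_real t ^ n))"
proof -
  let ?f = "\<lambda>m t. \<Sum>n<m. c n * euler_kernel (p + of_nat n) q 0 0 t"
  have ker: "euler_kernel (p + of_nat n) q 0 0 t = of_real t powr p * of_real (1 - t) powr q * of_real t ^ n"
    if "t \<in> {0<..<1}" for t n
    using that by (simp add: euler_kernel_def powr_add powr_nat')
  have intk: "euler_kernel (p + of_nat n) q 0 0 integrable_on {0<..<1}" for n
    using p q by (intro euler_kernel_integrable) auto
  have "(\<lambda>m. integral {0<..<1} (?f m)) \<longlonglongrightarrow>
     integral {0<..<1} (\<lambda>t. of_real t powr p * of_real (1 - t) powr q * (\<Sum>n. c n * of_real t ^ n))"
  proof (rule dominated_convergence(2)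
      [where h="\<lambda>t. (\<Sum>n. norm (c n)) * (t powr Re p * (1 - t) powr Re q)"])
    show "?f m integrable_on {0<..<1}" for m
      by (intro integrable_sum integrable_on_mult_right intk) auto
    show "(\<lambda>t. (\<Sum>n. norm (c n)) * (t powr Re p * (1 - t) powr Re q)) integrable_on {0<..<1}"
      using beta_has_integral[OF p q] by (intro integrable_on_mult_right) blast
    have small: "norm (c n * of_real t ^ n) \<le> norm (c n)" if "t \<in> {0<..<1}" for t n
      using that by (simp add: norm_mult norm_power mult_left_le power_le_one)
    have eq: "?f m t = of_real t powr p * of_real (1 - t) powr q * (\<Sum>n<m. c n * of_real t ^ n)"
      if "t \<in> {0<..<1}" for m t
      using ker[OF that] by (simp add: sum_distrib_left mult_ac)
    show "norm (?f m t) \<le> (\<Sum>n. norm (c n)) * (t powr Re p * (1 - t) powr Re q)"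
      if t: "t \<in> {0<..<1}" for m t
    proof -
      have "norm (\<Sum>n<m. c n * of_real t ^ n) \<le> (\<Sum>n<m. norm (c n))"
        using small[OF t] by (intro order_trans[OF norm_sum] sum_mono)
      also have "\<dots> \<le> (\<Sum>n. norm (c n))" using c by (intro sum_le_suminf) auto
      finally have "t powr Re p * (1 - t) powr Re q * norm (\<Sum>n<m. c n * of_real t ^ n)
          \<le> t powr Re p * (1 - t) powr Re q * (\<Sum>n. norm (c n))"
        by (intro mult_left_mono) auto
      then show ?thesis unfolding eq[OF t] using t
        by (simp add: norm_mult norm_powr_real_powr mult_ac)
    qed
    show "(\<lambda>m. ?f m t) \<longlonglongrightarrow> of_real t powr p * of_real (1 - t) powr q * (\<Sum>n. c n * of_real t ^ n)"
      if t: "t \<in> {0<..<1}" for t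
    proof -
      have "summable (\<lambda>n. c n * of_real t ^ n)"
        by (rule summable_comparison_test'[OF c]) (use small[OF t] in auto)
      then show ?thesis unfolding eq[OF t]
        by (intro tendsto_mult tendsto_const summable_LIMSEQ)
    qed
  qed
  moreover have "integral {0<..<1} (?f m) =
    (\<Sum>n<m. c n * (Gamma (p + 1 + of_nat n) * Gamma (q + 1) * rGamma (p + q + 2 + of_nat n)))" for m
  proof -
    have "integral {0<..<1} (?f m) = (\<Sum>n<m. c n * euler_integral (p + of_nat n) q 0 0)"
      unfolding euler_integral_def
      by (subst integral_sum) (auto intro!: integrable_on_mult_right intk)
    also have "\<dots> = (\<Sum>n<m. c n * (Gamma (p + 1 + of_nat n) * Gamma (q + 1) * rGamma (p + q + 2 + of_nat n)))"
    proof (intro sum.cong refl)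
      fix n
      show "c n * euler_integral (p + of_nat n) q 0 0 = 
        c n * (Gamma (p + 1 + of_nat n) * Gamma (q + 1) * rGamma (p + q + 2 + of_nat n))"
        using p q by (subst euler_integral_beta) (auto simp: add_ac)
    qed
    finally show ?thesis .
  qed
  ultimately show ?thesis unfolding sums_def by simp
qed

section \<open>The binomial series, its remainder, and the symmetry of the Euler integral\<close>

lemma binomial_series_pochhammer:
  fixes z k :: complex
  assumes "norm z < 1"
  shows "(\<lambda>n. pochhammer (- k) n / fact n * z ^ n) sums (1 - z) powr k"
proof -
  have "(k gchoose n) * (- z) ^ n = pochhammer (- k) n / fact n * z ^ n" for n
    by (subst power_minus) (simp add: gbinomial_pochhammer mult_ac flip: power_mult_distrib)
  then show ?thesis using gen_binomial_complex[of "- z" k] assms by simp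
qed

lemma summable_norm_binomial_series:
  fixes z k :: complex
  assumes "norm z < 1"
  shows "summable (\<lambda>n. norm (pochhammer k n / fact n * z ^ n))"
proof -
  obtain r where r: "norm z < r" "r < 1" using dense assms by blast
  have "norm (of_real r :: complex) < 1" using r norm_ge_zero[of z] by (simp del: norm_ge_zero)
  from sums_summable[OF binomial_series_pochhammer[OF this, of "- k"]]
  show ?thesis
    by (intro powser_insidea[where x="of_real r"]) (use r norm_ge_zero[of z] in \<open>auto simp del: norm_ge_zero\<close>)
qed

lemma euler_integral_sums:
  assumes p: "Re p > -1" and q: "Re q > -1" and w: "norm w < 1"
  shows "(\<lambda>n. pochhammer (- k) n / fact n * w ^ n *
      (Gamma (p + 1 + of_nat n) * Gamma (q + 1) * rGamma (p + q + 2 + of_nat n))) sums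
      euler_integral p q k w"
proof -
  have "(\<Sum>n. pochhammer (- k) n / fact n * w ^ n * of_real t ^ n) = (1 - w * of_real t) powr k"
    if "t \<in> {0<..<1}" for t :: real
  proof -
    have "norm (w * of_real t) \<le> norm w" using that by (simp add: norm_mult mult_left_le)
    then have "norm (w * of_real t) < 1" using w by linarith
    from sums_unique[OF binomial_series_pochhammer[OF this, of k]]
    show ?thesis by (simp add: power_mult_distrib mult_ac)
  qed
  then have "integral {0<..<1} (\<lambda>t. of_real t powr p * of_real (1 - t) powr q *
       (\<Sum>n. pochhammer (- k) n / fact n * w ^ n * of_real t ^ n)) = euler_integral p q k w"
    unfolding euler_integral_def by (intro integral_cong) (simp add: euler_kernel_def)
  with power_series_beta_sums[OF p q summable_norm_binomial_series[OF w, of "- k"]]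
  show ?thesis by simp
qed

lemma halfplane_Re_lt_1: "open {z. Re z < 1}" "connected {z. Re z < 1}" "ball 0 1 \<subseteq> {z. Re z < 1}"
  using open_halfspace_Re_lt[of 1] convex_halfspace_Re_lt[of 1] convex_connected
  by (auto intro: le_less_trans[OF complex_Re_le_cmod])

lemma Gamma_times_rGamma: "Re z > 0 \<Longrightarrow> Gamma z * rGamma z = (1::complex)"
  using not_nonpos_Ints_if_Re_pos[of z] by (simp add: rGamma_inverse_Gamma Gamma_eq_zero_iff)

lemma Gamma_shift_times_rGamma:
  fixes a :: complex
  assumes "Re a + real n > 0"
  shows "rGamma a * Gamma (a + of_nat n) = pochhammer a n"
  using pochhammer_rGamma[of a n] Gamma_times_rGamma[of "a + of_nat n"] assms
  by (simp add: mult_ac)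

text \<open>By the reflection formula, (a)_n / n! is sin (pi a) / pi times the Beta function at (a +
  n, 1 - a). So the tail n \<ge> N of the series is the expansion of \<open>z ^ N\<close> times an
  Euler integral whose kernel is the geometric series 1 / (1 - z s). Because the tail starts at
  \<open>N\<close>, \<open>Re a > - N\<close> suffices for convergence at s = 0. The comparison is
  made in the unit disc and continued to \<open>Re z < 1\<close>.\<close>

lemma binomial_remainder:
  fixes a z :: complex
  assumes a: "- real N < Re a" "Re a < 1" and z: "Re z < 1"
  shows "(1 - z) powr (- a) = (\<Sum>n<N. pochhammer a n / fact n * z ^ n) +
    z ^ N * (sin (of_real pi * a) / of_real pi) * euler_integral (of_nat N + a - 1) (- a) (- 1) z"
proof -
  let ?R = "\<lambda>z. (\<Sum>n<N. pochhammer a n / fact n * z ^ n) +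
    z ^ N * (sin (of_real pi * a) / of_real pi) * euler_integral (of_nat N + a - 1) (- a) (- 1) z"
  have refl: "sin (of_real pi * a) / of_real pi * Gamma (1 - a) = rGamma a"
    unfolding rGamma_reflection_complex[symmetric]
    using Gamma_times_rGamma[of "1 - a"] a by (simp add: mult_ac)
  have small: "(1 - z) powr (- a) = ?R z" if z: "z \<in> ball 0 1" for z
  proof -
    have z': "norm z < 1" using z by simp
    let ?c = "\<lambda>n. pochhammer a n / fact n * z ^ n"
    let ?s = "sin (of_real pi * a) / of_real pi"
    \<comment> \<open>Here \<open>pochhammer 1 n / fact n\<close> equals 1: for
      \<open>k = - 1\<close> the binomial series is geometric. The constant \<open>?s\<close> and
      \<open>Gamma (1 - a)\<close> combine to \<open>rGamma a\<close> by
      \<open>refl\<close>.\<close>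
    have "?s * (pochhammer 1 n / fact n * z ^ n * (Gamma (of_nat N + a + of_nat n) * Gamma (1 - a) *
        rGamma (of_nat N + 1 + of_nat n))) = pochhammer a (n + N) / fact (n + N) * z ^ n" for n
    proof -
      have "rGamma (of_nat N + 1 + of_nat n :: complex) = 1 / fact (n + N)"
        using Gamma_fact[of "n + N", where 'a=complex]
        by (simp add: rGamma_inverse_Gamma add_ac divide_inverse)
      moreover have "rGamma a * Gamma (of_nat N + a + of_nat n) = pochhammer a (n + N)"
        using Gamma_shift_times_rGamma[of a "n + N"] a by (simp add: add_ac)
      ultimately show ?thesis
        by (simp add: pochhammer_fact[symmetric] refl[symmetric] mult_ac)
    qed
    moreover have "(\<lambda>n. ?s * (pochhammer 1 n / fact n * z ^ n * (Gamma (of_nat N + a + of_nat n) *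
        Gamma (1 - a) * rGamma (of_nat N + 1 + of_nat n)))) sums
        (?s * euler_integral (of_nat N + a - 1) (- a) (- 1) z)"
      using sums_mult[OF euler_integral_sums[of "of_nat N + a - 1" "-a" z "-1"], of ?s] a z'
      by (simp add: add_ac)
    ultimately have "(\<lambda>n. pochhammer a (n + N) / fact (n + N) * z ^ n) sums
        (?s * euler_integral (of_nat N + a - 1) (- a) (- 1) z)"
      by simp
    from sums_mult[OF this, of "z ^ N"]
    have 1: "(\<lambda>n. ?c (n + N)) sums (z ^ N * (?s * euler_integral (of_nat N + a - 1) (- a) (- 1) z))"
      by (simp add: power_add mult_ac)
    have "?c sums ((1 - z) powr (- a))" using binomial_series_pochhammer[OF z', of "- a"] by simp
    then have "(\<lambda>n. ?c (n + N)) sums ((1 - z) powr (- a) - (\<Sum>n<N. ?c n))"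
      by (rule sums_split_initial_segment)
    from sums_unique2[OF this 1] show ?thesis by (simp add: algebra_simps)
  qed
  show ?thesis
  proof (rule analytic_continuation_open[where f="\<lambda>z. (1 - z) powr (- a)" and g="?R", OF _ halfplane_Re_lt_1(1) _ halfplane_Re_lt_1(2,3)])
    show "(\<lambda>z. (1 - z) powr (- a)) holomorphic_on {z. Re z < 1}"
      by (intro holomorphic_intros) (auto simp: complex_nonpos_Reals_iff)
    show "?R holomorphic_on {z. Re z < 1}"
      using a by (intro holomorphic_intros euler_integral_holomorphic halfplane_Re_lt_1) auto
  qed (use z small in auto)
qed

text \<open>In the unit disc each side is the regularised hypergeometric series with parameters 1/2
  + \<mu>, 1/2 - \<mu>; \<nu> + 3/2, which does not change under \<mu> -> -\<mu>. Continuation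
  carries this to \<open>Re w < 1\<close>, where \<open>ferrers_w\<close> lies.\<close>

lemma euler_integral_symmetric:
  fixes \<mu> \<nu> w :: complex
  assumes \<mu>: "\<bar>Re \<mu>\<bar> < 1/2" and \<nu>: "Re \<nu> > \<bar>Re \<mu>\<bar> - 1" and w: "Re w < 1"
  shows "rGamma (1/2 - \<mu>) * rGamma (\<nu> + \<mu> + 1) * euler_integral (- 1/2 - \<mu>) (\<nu> + \<mu>) (- 1/2 - \<mu>) w =
         rGamma (1/2 + \<mu>) * rGamma (\<nu> - \<mu> + 1) * euler_integral (- 1/2 + \<mu>) (\<nu> - \<mu>) (- 1/2 + \<mu>) w"
proof (rule analytic_continuation_open[where s="ball 0 1"
    and f="\<lambda>w. rGamma (1/2 - \<mu>) * rGamma (\<nu> + \<mu> + 1) * euler_integral (- 1/2 - \<mu>) (\<nu> + \<mu>) (- 1/2 - \<mu>) w"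
    and g="\<lambda>w. rGamma (1/2 + \<mu>) * rGamma (\<nu> - \<mu> + 1) * euler_integral (- 1/2 + \<mu>) (\<nu> - \<mu>) (- 1/2 + \<mu>) w", OF _ halfplane_Re_lt_1(1) _ halfplane_Re_lt_1(2,3)])
  show "(\<lambda>w. rGamma (1/2 - \<mu>) * rGamma (\<nu> + \<mu> + 1) * euler_integral (- 1/2 - \<mu>) (\<nu> + \<mu>) (- 1/2 - \<mu>) w)
         holomorphic_on {z. Re z < 1}"
    using \<mu> \<nu> by (intro holomorphic_intros euler_integral_holomorphic halfplane_Re_lt_1) auto
  show "(\<lambda>w. rGamma (1/2 + \<mu>) * rGamma (\<nu> - \<mu> + 1) * euler_integral (- 1/2 + \<mu>) (\<nu> - \<mu>) (- 1/2 + \<mu>) w)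
         holomorphic_on {z. Re z < 1}"
    using \<mu> \<nu> by (intro holomorphic_intros euler_integral_holomorphic halfplane_Re_lt_1) auto
next
  fix w :: complex assume w: "w \<in> ball 0 1"
  have *: "(\<lambda>n. pochhammer (1/2 + m) n * pochhammer (1/2 - m) n * rGamma (\<nu> + 3/2 + of_nat n) / fact n * w ^ n) sums
      (rGamma (1/2 - m) * rGamma (\<nu> + m + 1) * euler_integral (- 1/2 - m) (\<nu> + m) (- 1/2 - m) w)"
    if m: "\<bar>Re m\<bar> < 1/2" "Re \<nu> > \<bar>Re m\<bar> - 1" for m
  proof -
    have "(\<lambda>n. rGamma (1/2 - m) * rGamma (\<nu> + m + 1) *
       (pochhammer (- (- 1/2 - m)) n / fact n * w ^ n *
      (Gamma (- 1/2 - m + 1 + of_nat n) * Gamma (\<nu> + m + 1) *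
        rGamma (- 1/2 - m + (\<nu> + m) + 2 + of_nat n)))) sums
      (rGamma (1/2 - m) * rGamma (\<nu> + m + 1) * euler_integral (- 1/2 - m) (\<nu> + m) (- 1/2 - m) w)"
      using m w by (intro sums_mult euler_integral_sums) auto
    moreover have "rGamma (1/2 - m) * rGamma (\<nu> + m + 1) *
       (pochhammer (- (- 1/2 - m)) n / fact n * w ^ n *
      (Gamma (- 1/2 - m + 1 + of_nat n) * Gamma (\<nu> + m + 1) *
        rGamma (- 1/2 - m + (\<nu> + m) + 2 + of_nat n))) =
       pochhammer (1/2 + m) n * pochhammer (1/2 - m) n * rGamma (\<nu> + 3/2 + of_nat n) / fact n * w ^ n" for n
    proof -
      have "rGamma (1/2 - m) * Gamma (- 1/2 - m + 1 + of_nat n) = pochhammer (1/2 - m) n"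
        using Gamma_shift_times_rGamma[of "1/2 - m" n] m by (simp add: algebra_simps)
      moreover have "Gamma (\<nu> + m + 1) * rGamma (\<nu> + m + 1) = 1"
        using m by (intro Gamma_times_rGamma) auto
      moreover have "- 1/2 - m + (\<nu> + m) + 2 + of_nat n = \<nu> + 3/2 + of_nat n" "- (- 1/2 - m) = 1/2 + m"
        by (simp_all add: field_simps)
      moreover have "a * b * (P / f * z * (A * B * C)) = P * (a * A) * C / f * z * (B * b)"
        for a b P f z A B C :: complex by simp
      ultimately show ?thesis by (simp only: mult_1_right)
    qed
    ultimately show ?thesis by (simp only:)
  qed
  from sums_unique2[OF *[of \<mu>], of "rGamma (1/2 + \<mu>) * rGamma (\<nu> - \<mu> + 1) * euler_integral (- 1/2 + \<mu>) (\<nu> - \<mu>) (- 1/2 + \<mu>) w"] *[of "- \<mu>"] \<mu> \<nu>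
  show "rGamma (1/2 - \<mu>) * rGamma (\<nu> + \<mu> + 1) * euler_integral (- 1/2 - \<mu>) (\<nu> + \<mu>) (- 1/2 - \<mu>) w =
         rGamma (1/2 + \<mu>) * rGamma (\<nu> - \<mu> + 1) * euler_integral (- 1/2 + \<mu>) (\<nu> - \<mu>) (- 1/2 + \<mu>) w"
    by (simp add: mult_ac)
qed (use w in auto)

section \<open>The regularised hypergeometric series\<close>

definition hyp2F1_term :: "complex \<Rightarrow> complex \<Rightarrow> complex \<Rightarrow> complex \<Rightarrow> nat \<Rightarrow> complex" where
  "hyp2F1_term a b c w n = pochhammer a n * pochhammer b n * rGamma (c + of_nat n) / fact n * w ^ n"

lemma hyp2F1_term_Suc:
  assumes "c + of_nat n \<noteq> 0"
  shows "hyp2F1_term a b c w (Suc n) =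
    hyp2F1_term a b c w n * ((a + of_nat n) * (b + of_nat n) * w / ((c + of_nat n) * of_nat (Suc n)))"
proof -
  have "rGamma (c + of_nat (Suc n)) = rGamma (c + of_nat n) / (c + of_nat n)"
    using rGamma_plus1[of "c + of_nat n"] assms by (simp add: field_simps)
  then show ?thesis
    by (simp add: hyp2F1_term_def pochhammer_Suc mult_ac del: of_nat_Suc)
qed

text \<open>A ratio test uniform in the parameters. With \<open>M\<close> bounding all three of them
  on \<open>K\<close>, the index \<open>m\<close> is taken so large that \<open>n > M\<close>
  excludes \<open>c + n = 0\<close>, where the ratio recursion would break down, and that the ratio,
  which is at most a quantity tending to \<open>norm w\<close>, lies below
  \<open>\<rho>\<close>.\<close>

lemma hyp2F1_term_bound:
  fixes a b c :: "complex \<Rightarrow> complex"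
  assumes K: "compact K" and cont: "continuous_on K a" "continuous_on K b" "continuous_on K c"
    and w: "norm w < 1"
  obtains B \<rho> m where "0 \<le> \<rho>" "\<rho> < 1"
    "\<And>z n. z \<in> K \<Longrightarrow> n \<ge> m \<Longrightarrow> norm (hyp2F1_term (a z) (b z) (c z) w n) \<le> B * \<rho> ^ n"
proof -
  have bnd: "\<exists>M>0. \<forall>z\<in>K. norm (h z) \<le> M" if "continuous_on K h" for h :: "complex \<Rightarrow> complex"
    using compact_imp_bounded[OF compact_continuous_image[OF that K]] unfolding bounded_pos by auto
  obtain Ma Mb Mc where M0: "Ma > 0" "Mb > 0" "Mc > 0" "\<forall>z\<in>K. norm (a z) \<le> Ma"
    "\<forall>z\<in>K. norm (b z) \<le> Mb" "\<forall>z\<in>K. norm (c z) \<le> Mc"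
    using bnd[OF cont(1)] bnd[OF cont(2)] bnd[OF cont(3)] by blast
  define M where "M = Ma + Mb + Mc"
  have M: "norm (a z) \<le> M" "norm (b z) \<le> M" "norm (c z) \<le> M" if "z \<in> K" for z
    using M0 that unfolding M_def by fastforce+
  obtain \<rho> where \<rho>: "norm w < \<rho>" "\<rho> < 1" using dense w by blast
  have \<rho>0: "\<rho> > 0" using \<rho>(1) norm_ge_zero[of w] by linarith
  have "((\<lambda>n::nat. (real n + M) * (real n + M) * norm w / ((real n - M) * (real n + 1))) \<longlongrightarrow> norm w) sequentially"
    by real_asymp
  then have "\<forall>\<^sub>F n in sequentially. (real n + M) * (real n + M) * norm w / ((real n - M) * (real n + 1)) < \<rho>"
    using \<rho> by (intro order_tendstoD)
  moreover have "\<forall>\<^sub>F n in sequentially. real n > M" by real_asymp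
  ultimately have "\<forall>\<^sub>F n in sequentially. (real n + M) * (real n + M) * norm w / ((real n - M) * (real n + 1)) < \<rho> \<and> real n > M"
    by eventually_elim auto
  then obtain m where m: "\<And>n. n \<ge> m \<Longrightarrow> (real n + M) * (real n + M) * norm w / ((real n - M) * (real n + 1)) < \<rho>"
      "\<And>n. n \<ge> m \<Longrightarrow> real n > M"
    unfolding eventually_sequentially by blast
  let ?T = "\<lambda>z. hyp2F1_term (a z) (b z) (c z) w"
  have "continuous_on K (\<lambda>z. ?T z m)"
    unfolding hyp2F1_term_def pochhammer_prod using cont
    by (intro continuous_intros continuous_on_compose2[OF continuous_on_rGamma[of UNIV]]) auto
  from bnd[OF this] obtain B where B: "B > 0" "\<And>z. z \<in> K \<Longrightarrow> norm (?T z m) \<le> B" by blast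
  have ratio: "norm (?T z (Suc n)) \<le> norm (?T z n) * \<rho>" if z: "z \<in> K" and n: "n \<ge> m" for z n
  proof -
    have low: "real n - M \<le> norm (c z + of_nat n)"
      using norm_triangle_ineq2[of "of_nat n" "- c z"] M(3)[OF z] by (simp add: add.commute)
    have nM: "real n - M > 0" using m(2)[OF n] by simp
    then have nz: "c z + of_nat n \<noteq> 0" using low by auto
    have "norm ((a z + of_nat n) * (b z + of_nat n) * w / ((c z + of_nat n) * of_nat (Suc n)))
      = norm (a z + of_nat n) * norm (b z + of_nat n) * norm w / (norm (c z + of_nat n) * (real n + 1))"
      by (simp add: norm_mult norm_divide del: of_nat_Suc)
    also have "\<dots> \<le> (real n + M) * (real n + M) * norm w / ((real n - M) * (real n + 1))"
    proof (intro frac_le mult_mono mult_right_mono low)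
      show "norm (a z + of_nat n) \<le> real n + M" "norm (b z + of_nat n) \<le> real n + M"
        using norm_triangle_ineq[of "a z" "of_nat n"] norm_triangle_ineq[of "b z" "of_nat n"] M[OF z] by auto
    qed (use nM M0 in \<open>auto intro!: mult_nonneg_nonneg simp: M_def\<close>)
    also have "\<dots> \<le> \<rho>" using m(1)[OF n] by simp
    finally show ?thesis unfolding hyp2F1_term_Suc[OF nz] norm_mult[of "?T z n"]
      by (rule mult_left_mono) simp
  qed
  show ?thesis
  proof (rule that[of \<rho> m "B / \<rho> ^ m"])
    fix z n assume z: "z \<in> K" and n: "n \<ge> m"
    have "norm (?T z n) \<le> B * \<rho> ^ (n - m)"
      using n
    proof (induction n rule: dec_induct)
      case base then show ?case using B(2)[OF z] by simp
    next
      case (step n)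
      have "norm (?T z (Suc n)) \<le> norm (?T z n) * \<rho>" using step.hyps by (intro ratio z)
      also have "\<dots> \<le> B * \<rho> ^ (n - m) * \<rho>" using step.IH \<rho>0 by (intro mult_right_mono) auto
      finally show ?case using step.hyps by (simp add: Suc_diff_le mult_ac)
    qed
    then show "norm (?T z n) \<le> B / \<rho> ^ m * \<rho> ^ n" using n \<rho>0 by (simp add: power_diff)
  qed (use \<rho>0 \<rho> in auto)
qed

lemma hyp2F1_term_summable:
  assumes "norm w < 1"
  shows "summable (\<lambda>n. norm (hyp2F1_term a b c w n))"
proof (rule hyp2F1_term_bound[of "{0}" "\<lambda>_. a" "\<lambda>_. b" "\<lambda>_. c" w])
  fix B \<rho> m
  assume *: "0 \<le> \<rho>" "\<rho> < (1::real)"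
    "\<And>z n. z \<in> {0} \<Longrightarrow> n \<ge> m \<Longrightarrow> norm (hyp2F1_term a b c w n) \<le> B * \<rho> ^ n"
  then have "summable (\<lambda>n. B * \<rho> ^ n)" by (intro summable_mult summable_geometric) auto
  then show ?thesis by (rule summable_comparison_test'[where N=m]) (use *(3) in simp)
qed (use assms in auto)

lemma hyp2F1_reg_eq_suminf: "hyp2F1_reg a b c w = (\<Sum>n. hyp2F1_term a b c w n)"
  by (simp add: hyp2F1_reg_def hyp2F1_term_def)

lemma hyp2F1_reg_holomorphic:
  assumes "open S" "a holomorphic_on S" "b holomorphic_on S" "c holomorphic_on S" "norm w < 1"
  shows "(\<lambda>z. hyp2F1_reg (a z) (b z) (c z) w) holomorphic_on S"
proof (rule holomorphic_uniform_sequence[OF \<open>open S\<close>])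
  show "(\<lambda>z. \<Sum>i<n. hyp2F1_term (a z) (b z) (c z) w i) holomorphic_on S" for n
    unfolding hyp2F1_term_def pochhammer_prod using assms by (intro holomorphic_intros) auto
  fix x assume "x \<in> S"
  then obtain d where d: "d > 0" "cball x d \<subseteq> S" using \<open>open S\<close> open_contains_cball by blast
  note cont = holomorphic_on_imp_continuous_on[OF holomorphic_on_subset[OF _ d(2)]]
  obtain B \<rho> m where "0 \<le> \<rho>" "\<rho> < 1" and *:
    "\<And>z n. z \<in> cball x d \<Longrightarrow> n \<ge> m \<Longrightarrow> norm (hyp2F1_term (a z) (b z) (c z) w n) \<le> B * \<rho> ^ n"
    by (rule hyp2F1_term_bound[of "cball x d" a b c w]) (use assms(5) cont[OF assms(2)] cont[OF assms(3)] cont[OF assms(4)] in auto)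
  then have "summable (\<lambda>n. B * \<rho> ^ n)" by (intro summable_mult summable_geometric) auto
  moreover have "\<forall>\<^sub>F n in sequentially. \<forall>z\<in>cball x d. norm (hyp2F1_term (a z) (b z) (c z) w n) \<le> B * \<rho> ^ n"
    using * unfolding eventually_sequentially by blast
  ultimately have "uniform_limit (cball x d) (\<lambda>n z. \<Sum>i<n. hyp2F1_term (a z) (b z) (c z) w i)
      (\<lambda>z. hyp2F1_reg (a z) (b z) (c z) w) sequentially"
    unfolding hyp2F1_reg_eq_suminf
    by (intro Weierstrass_m_test_ev)
  then show "\<exists>d>0. cball x d \<subseteq> S \<and> uniform_limit (cball x d)
      (\<lambda>n z. \<Sum>i<n. hyp2F1_term (a z) (b z) (c z) w i) (\<lambda>z. hyp2F1_reg (a z) (b z) (c z) w) sequentially"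
    using d by blast
qed

section \<open>The hypergeometric series of the cosine\<close>

text \<open>The operator f'' + k^2 f splits into two first-order factors, each removed by an
  exponential integrating factor; this also covers k = 0. Derivatives are taken within
  \<open>S\<close> so that \<open>S\<close> may be a segment.\<close>

lemma harmonic_ode_unique:
  fixes f f' :: "complex \<Rightarrow> complex"
  assumes S: "convex S" "0 \<in> S"
    and f: "\<And>x. x \<in> S \<Longrightarrow> (f has_field_derivative f' x) (at x within S)"
    and f': "\<And>x. x \<in> S \<Longrightarrow> (f' has_field_derivative - k\<^sup>2 * f x) (at x within S)"
    and init: "f 0 = 0" "f' 0 = 0" and x: "x \<in> S"
  shows "f x = 0"
proof -
  have "\<exists>c. \<forall>y\<in>S. (f' y + \<i> * k * f y) * exp (- \<i> * k * y) = c"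
    by (rule has_field_derivative_zero_constant[OF S(1)])
       (auto intro!: derivative_eq_intros f f' simp: algebra_simps power2_eq_square)
  then have "f' y + \<i> * k * f y = 0" if "y \<in> S" for y
    using S(2) init that by (metis (no_types) add_0 exp_not_eq_zero mult_eq_0_iff mult_zero_right)
  then have E: "f' y = - \<i> * k * f y" if "y \<in> S" for y
    using that by (simp add: eq_neg_iff_add_eq_0)
  have "\<exists>c. \<forall>y\<in>S. f y * exp (\<i> * k * y) = c"
    by (rule has_field_derivative_zero_constant[OF S(1)])
       (auto intro!: derivative_eq_intros f simp: E algebra_simps)
  then show ?thesis using S(2) init x by (metis exp_not_eq_zero mult_eq_0_iff)
qed

text \<open>Both sides solve H'' = -(2 \<nu> + 1)^2 H with H(0) = 1 and H'(0) = 0: multiplying by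
  cos x and putting y = sin^2 x turns the hypergeometric equation with parameters \<nu> + 1, -\<nu>;
  1/2 into the harmonic one. The bound on \<open>\<theta>\<close> keeps sin^2 x below 1 along the
  whole segment from 0 to \<open>\<theta>\<close>.\<close>

lemma cos_eq_hyp2F1:
  fixes \<nu> :: complex and \<theta> :: real
  assumes \<theta>: "\<bar>\<theta>\<bar> < pi / 2"
  shows "cos ((2 * \<nu> + 1) * of_real \<theta>) =
    of_real (sqrt pi) * cos (of_real \<theta>) * hyp2F1_reg (\<nu> + 1) (- \<nu>) (1/2) (of_real (sin \<theta> ^ 2))"
proof -
  define A where "A n = of_real (sqrt pi) * hyp2F1_term (\<nu> + 1) (- \<nu>) (1/2) 1 n" for n
  have term_eq: "A n * y ^ n = of_real (sqrt pi) * hyp2F1_term (\<nu> + 1) (- \<nu>) (1/2) y n" for n y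
    by (simp add: A_def hyp2F1_term_def)
  have A0: "A 0 = 1"
    by (simp add: A_def hyp2F1_term_def rGamma_inverse_Gamma Gamma_one_half_complex)
  have Asum: "summable (\<lambda>n. A n * y ^ n)" if "norm y < 1" for y
    unfolding term_eq by (intro summable_mult summable_norm_cancel[OF hyp2F1_term_summable] that)
  have rec: "of_nat (Suc n) * (of_nat n + 1/2) * A (Suc n) = (of_nat n + \<nu> + 1) * (of_nat n - \<nu>) * A n" for n
  proof -
    have nz: "(1/2::complex) + of_nat n \<noteq> 0" 
      using of_nat_0_le_iff[of n, where 'a=real] by (auto simp: complex_eq_iff)
    have "N * h * (s * (X * (p * q * 1 / (h * N)))) = p * q * (s * X)"
      if "N \<noteq> 0" "h \<noteq> 0" for N h s X p q :: complex
      using that by simp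
    from this[OF _ nz, of "of_nat (Suc n)"] show ?thesis
      unfolding A_def hyp2F1_term_Suc[OF nz] by (simp add: add_ac del: of_nat_Suc)
  qed
  \<comment> \<open>\<open>diffs\<close> differentiates a power series coefficientwise, so
    \<open>g j\<close> is the j-th derivative of \<open>g 0\<close>. The factor
    \<open>sqrt pi\<close> in \<open>A\<close> cancels \<open>rGamma (1/2)\<close> and normalises
    \<open>g 0\<close> to 1 at the origin.\<close>
  define g where "g j y = (\<Sum>n. (diffs ^^ j) A n * y ^ n)" for j y
  have gsum: "summable (\<lambda>n. (diffs ^^ j) A n * y ^ n)" if "norm y < 1" for j y
    using that
  proof (induction j arbitrary: y)
    case 0 then show ?case using Asum by simp
  next
    case (Suc j) then show ?case using termdiff_converges[of y 1 "(diffs ^^ j) A"] by simp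
  qed
  have gder: "(g j has_field_derivative g (Suc j) y) (at y)" if y: "norm y < 1" for j y
  proof -
    obtain r where r: "norm y < r" "r < 1" using dense y by blast
    have "summable (\<lambda>n. (diffs ^^ j) A n * of_real r ^ n)"
      using r norm_ge_zero[of y] by (intro gsum) (auto simp del: norm_ge_zero)
    from termdiffs_strong[OF this, of y] show ?thesis
      using r norm_ge_zero[of y] by (simp add: g_def[abs_def] del: norm_ge_zero)
  qed
  have d1: "diffs A n = of_nat (Suc n) * A (Suc n)" for n by (simp add: diffs_def)
  have d2: "diffs (diffs A) n = of_nat (Suc n) * of_nat (Suc (Suc n)) * A (Suc (Suc n))" for n
    by (simp add: diffs_def)
  have ode: "y * (1 - y) * g 2 y + (1/2 - 2 * y) * g 1 y + \<nu> * (\<nu> + 1) * g 0 y = 0"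
    if y: "norm y < 1" for y
  proof -
    have s0: "(\<lambda>n. A n * y ^ n) sums g 0 y"
      using summable_sums[OF gsum[OF y, of 0]] by (simp add: g_def)
    have s1: "(\<lambda>n. of_nat (Suc n) * A (Suc n) * y ^ n) sums g 1 y"
      using summable_sums[OF gsum[OF y, of 1]] by (simp add: g_def d1)
    have s2: "(\<lambda>n. of_nat (Suc n) * of_nat (Suc (Suc n)) * A (Suc (Suc n)) * y ^ n) sums g 2 y"
      using summable_sums[OF gsum[OF y, of 2]] by (simp add: g_def d2 numeral_2_eq_2)
    \<comment> \<open>Multiplication by \<open>y\<close> shifts the index; \<open>t1\<close>,
      \<open>t2\<close>, \<open>t3\<close> rewrite the products so that all series run over the same
      power \<open>y ^ n\<close>. The coefficient of the equation is then the recursion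
      \<open>rec\<close>.\<close>
    have t1: "(\<lambda>n. of_nat n * A n * y ^ n) sums (y * g 1 y)"
      using sums_Suc[of "\<lambda>n. of_nat n * A n * y ^ n"] sums_mult[OF s1, of y] by (simp add: mult_ac)
    have t2: "(\<lambda>n. of_nat n * of_nat (Suc n) * A (Suc n) * y ^ n) sums (y * g 2 y)"
      using sums_Suc[of "\<lambda>n. of_nat n * of_nat (Suc n) * A (Suc n) * y ^ n"] sums_mult[OF s2, of y]
      by (simp add: mult_ac)
    have t3: "(\<lambda>n. of_nat n * (of_nat n - 1) * A n * y ^ n) sums (y * (y * g 2 y))"
      using sums_Suc[of "\<lambda>n. of_nat n * (of_nat n - 1) * A n * y ^ n"] sums_mult[OF t2, of y]
      by (simp add: mult_ac)
    have "(\<lambda>n. of_nat n * of_nat (Suc n) * A (Suc n) * y ^ n - of_nat n * (of_nat n - 1) * A n * y ^ n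
       + (1/2) * (of_nat (Suc n) * A (Suc n) * y ^ n) - 2 * (of_nat n * A n * y ^ n) + \<nu> * (\<nu> + 1) * (A n * y ^ n)) sums
       (y * g 2 y - y * (y * g 2 y) + (1/2) * g 1 y - 2 * (y * g 1 y) + \<nu> * (\<nu> + 1) * g 0 y)"
      by (intro sums_add sums_diff sums_mult s0 s1 t1 t2 t3)
    moreover have "of_nat n * of_nat (Suc n) * A (Suc n) * y ^ n - of_nat n * (of_nat n - 1) * A n * y ^ n
       + (1/2) * (of_nat (Suc n) * A (Suc n) * y ^ n) - 2 * (of_nat n * A n * y ^ n) + \<nu> * (\<nu> + 1) * (A n * y ^ n)
       = (of_nat (Suc n) * (of_nat n + 1/2) * A (Suc n) - (of_nat n + \<nu> + 1) * (of_nat n - \<nu>) * A n) * y ^ n" for n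
      by (simp add: algebra_simps add_divide_distrib)
    ultimately have "(\<lambda>n. 0) sums (y * g 2 y - y * (y * g 2 y) + (1/2) * g 1 y - 2 * (y * g 1 y) + \<nu> * (\<nu> + 1) * g 0 y)"
      by (simp only: rec diff_self mult_zero_left)
    from sums_unique2[OF this sums_zero] show ?thesis by (simp add: algebra_simps)
  qed
  define S where "S = closed_segment 0 (complex_of_real \<theta>)"
  have S: "convex S" "0 \<in> S" "of_real \<theta> \<in> S" by (auto simp: S_def)
  have inS: "norm ((sin x)\<^sup>2) < 1" if "x \<in> S" for x :: complex
  proof -
    obtain u where u: "0 \<le> u" "u \<le> 1" "x = of_real (u * \<theta>)"
      using \<open>x \<in> S\<close> by (auto simp: S_def in_segment scaleR_conv_of_real)
    have "\<bar>u * \<theta>\<bar> \<le> \<bar>\<theta>\<bar>" using u by (simp add: abs_mult mult_left_le_one_le)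
    then have "\<bar>u * \<theta>\<bar> < pi / 2" using \<theta> by linarith
    then have "cos (u * \<theta>) > 0" using cos_gt_zero_pi[of "u * \<theta>"] by linarith
    then have "(sin (u * \<theta>))\<^sup>2 < 1" using sin_cos_squared_add[of "u * \<theta>"] 
      by (smt (verit) zero_less_power)
    moreover have "sin x = of_real (sin (u * \<theta>))" unfolding u(3) by (rule sin_of_real)
    ultimately show ?thesis by (simp add: norm_power)
  qed
  define H where "H x = cos x * g 0 ((sin x)\<^sup>2)" for x
  define H1 where "H1 x = - sin x * g 0 ((sin x)\<^sup>2) + 2 * sin x * (cos x)\<^sup>2 * g 1 ((sin x)\<^sup>2)" for x
  let ?k = "2 * \<nu> + 1"
  have "H (of_real \<theta>) - cos (?k * of_real \<theta>) = 0"
  proof (rule harmonic_ode_unique[where f="\<lambda>x. H x - cos (?k * x)" and f'="\<lambda>x. H1 x + ?k * sin (?k * x)" 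
        and S=S and k="?k"])
    fix x assume x: "x \<in> S"
    have gd: "((\<lambda>x. g j ((sin x)\<^sup>2)) has_field_derivative g (Suc j) ((sin x)\<^sup>2) * (2 * sin x * cos x)) (at x within S)" for j
      by (rule DERIV_chain2[where f="g j" and g="\<lambda>x. (sin x)\<^sup>2"])
         (auto intro!: derivative_eq_intros gder inS[OF x])
    have c2: "(cos x)\<^sup>2 = 1 - (sin x)\<^sup>2" by (simp add: cos_squared_eq)
    let ?y = "(sin x)\<^sup>2"
    \<comment> \<open>Collects the second derivative of cos x * g 0 (sin^2 x) so that
      \<open>g2\<close> appears only in the combination y (1 - y) g'', which \<open>ode\<close>
      eliminates.\<close>
    have poly: "- C * g0 + (- s) * (g1 * (2 * s * C)) + ((2 * C) * C\<^sup>2 + 2 * s * (2 * C * (- s))) * g1 +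
        2 * s * C\<^sup>2 * (g2 * (2 * s * C)) = C * (- g0 + (2 - 8 * s\<^sup>2) * g1 + 4 * (s\<^sup>2 * (1 - s\<^sup>2) * g2))"
      if "C\<^sup>2 = 1 - s\<^sup>2" for C s g0 g1 g2 :: complex
      unfolding that by (simp add: algebra_simps power2_eq_square)
    have g0: "((\<lambda>x. g 0 ((sin x)\<^sup>2)) has_field_derivative g 1 ?y * (2 * sin x * cos x)) (at x within S)"
      and g1: "((\<lambda>x. g 1 ((sin x)\<^sup>2)) has_field_derivative g 2 ?y * (2 * sin x * cos x)) (at x within S)"
      using gd[of 0] gd[of 1] by (simp_all add: numeral_2_eq_2)
    have "(H has_field_derivative - sin x * g 0 ?y + cos x * (g 1 ?y * (2 * sin x * cos x))) (at x within S)"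
      unfolding H_def by (rule derivative_eq_intros g0 refl)+ (simp add: algebra_simps)
    also have "- sin x * g 0 ?y + cos x * (g 1 ?y * (2 * sin x * cos x)) = H1 x"
      by (simp add: H1_def power2_eq_square)
    finally show "((\<lambda>x. H x - cos (?k * x)) has_field_derivative H1 x + ?k * sin (?k * x)) (at x within S)"
      by (auto intro!: derivative_eq_intros simp: mult.commute)
    have "(H1 has_field_derivative - cos x * g 0 ?y + (- sin x) * (g 1 ?y * (2 * sin x * cos x)) +
        ((2 * cos x) * (cos x)\<^sup>2 + 2 * sin x * (2 * cos x * (- sin x))) * g 1 ?y +
        2 * sin x * (cos x)\<^sup>2 * (g 2 ?y * (2 * sin x * cos x))) (at x within S)"
      unfolding H1_def
      by (rule derivative_eq_intros g0 g1 refl)+ (simp add: algebra_simps)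
    then have "(H1 has_field_derivative cos x * (- g 0 ?y + (2 - 8 * ?y) * g 1 ?y + 4 * (?y * (1 - ?y) * g 2 ?y))) (at x within S)"
      unfolding poly[OF c2] .
    also have "4 * (?y * (1 - ?y) * g 2 ?y) = - 4 * ((1/2 - 2 * ?y) * g 1 ?y + \<nu> * (\<nu> + 1) * g 0 ?y)"
    proof -
      have "?y * (1 - ?y) * g 2 ?y = - ((1/2 - 2 * ?y) * g 1 ?y + \<nu> * (\<nu> + 1) * g 0 ?y)"
        using ode[OF inS[OF x]] by (simp only: eq_neg_iff_add_eq_0 add.assoc)
      then show ?thesis by simp
    qed
    finally have "(H1 has_field_derivative - ?k\<^sup>2 * H x) (at x within S)"
      by (rule DERIV_cong) (simp add: H_def algebra_simps power2_eq_square)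
    then show "((\<lambda>x. H1 x + ?k * sin (?k * x)) has_field_derivative - ?k\<^sup>2 * (H x - cos (?k * x))) (at x within S)"
      by (auto intro!: derivative_eq_intros simp: algebra_simps power2_eq_square)
  qed (use S in \<open>auto simp: H_def H1_def g_def A0\<close>)
  moreover have "g 0 y = of_real (sqrt pi) * hyp2F1_reg (\<nu> + 1) (- \<nu>) (1/2) y" if "norm y < 1" for y
    unfolding g_def hyp2F1_reg_eq_suminf
    by (simp add: term_eq suminf_mult summable_norm_cancel[OF hyp2F1_term_summable[OF that]])
  ultimately show ?thesis using inS[OF S(3)]
    by (simp add: H_def mult_ac flip: sin_of_real)
qed

section \<open>Integral representations of the Ferrers functions\<close>

lemma powr_pos_real: "x > 0 \<Longrightarrow> complex_of_real x powr z = exp (z * of_real (ln x))"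
  by (simp add: powr_def Ln_of_real)

lemma cos_diff_nonneg:
  assumes "0 < \<zeta>" "\<zeta> < pi" "\<bar>t\<bar> \<le> \<zeta>"
  shows "cos \<zeta> \<le> cos t"
  using cos_monotone_0_pi_le[of "\<bar>t\<bar>" \<zeta>] assms by simp

lemma ferrers_P_argument:
  assumes "0 < \<zeta>" "\<zeta> < pi"
  shows "(1 - cos \<zeta>) / 2 = sin (\<zeta> / 2) ^ 2" "0 < sin (\<zeta> / 2)" "sin (\<zeta> / 2) ^ 2 < 1"
proof -
  show "(1 - cos \<zeta>) / 2 = sin (\<zeta> / 2) ^ 2"
    using cos_double_sin[of "\<zeta> / 2"] by simp
  show s: "0 < sin (\<zeta> / 2)" using assms by (intro sin_gt_zero) auto
  have "0 < cos (\<zeta> / 2)" using assms by (intro cos_gt_zero) auto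
  then show "sin (\<zeta> / 2) ^ 2 < 1" using sin_cos_squared_add[of "\<zeta> / 2"] by (smt (verit) zero_less_power)
qed

text \<open>With Y = sin^2 (\<zeta>/2), the substitution r = sin^2 (t/2) / Y maps (0, \<zeta>) onto
  (0, 1), gives cos t - cos \<zeta> = 2 Y (1 - r), and makes the cosine a hypergeometric series in Y
  r with third parameter 1/2. Integrating each term against the Beta weight replaces
  \<open>rGamma (1/2 + n)\<close> by \<open>rGamma (1 - \<mu> + n)\<close>, up to the common factor
  \<open>Gamma (1/2 - \<mu>)\<close>; this is the series of P at Y.\<close>

lemma mehler_dirichlet:
  assumes \<zeta>: "0 < \<zeta>" "\<zeta> < pi" and \<mu>: "Re \<mu> < - 1 / 2"
  shows "ferrers_P \<nu> \<mu> (cos \<zeta>) = of_real (sqrt (2 / pi)) * of_real (sin \<zeta>) powr \<mu> * rGamma (1/2 - \<mu>) / 2 *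
    integral {-\<zeta>..\<zeta>} (\<lambda>t. exp (\<i> * (\<nu> + 1/2) * of_real t) * of_real (cos t - cos \<zeta>) powr (- \<mu> - 1/2))"
proof -
  define k where "k = - \<mu> - 1/2"
  have k: "Re k > 0" using \<mu> by (simp add: k_def)
  define Y where "Y = sin (\<zeta> / 2) ^ 2"
  have Y: "0 < Y" "Y < 1" "(1 - cos \<zeta>) / 2 = Y"
    using ferrers_P_argument[OF \<zeta>] by (auto simp: Y_def)
  define f where "f t = exp (\<i> * (\<nu> + 1/2) * of_real t) * of_real (cos t - cos \<zeta>) powr k" for t :: real
  define h where "h t = cos ((\<nu> + 1/2) * of_real t) * of_real (cos t - cos \<zeta>) powr k" for t :: real
  have contp: "continuous_on {-\<zeta>..\<zeta>} (\<lambda>t. complex_of_real (cos t - cos \<zeta>) powr k)"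
    using cos_diff_nonneg[OF \<zeta>] k
    by (intro continuous_on_powr_complex continuous_intros) auto
  have contf: "continuous_on {-\<zeta>..\<zeta>} f" and conth: "continuous_on {-\<zeta>..\<zeta>} h"
    unfolding f_def h_def by (intro continuous_intros contp)+
  have "integral {-\<zeta>..\<zeta>} f = integral {-\<zeta>..-0} f + integral {0..\<zeta>} f"
    using \<zeta> Henstock_Kurzweil_Integration.integral_combine[of "-\<zeta>" 0 \<zeta> f] integrable_continuous_real[OF contf] by simp
  also have "integral {-\<zeta>..-0} f = integral {0..\<zeta>} (\<lambda>t. f (- t))"
    using Henstock_Kurzweil_Integration.integral_reflect_real[of \<zeta> 0 "\<lambda>t. f (- t)"] by simp
  also have "integral {0..\<zeta>} (\<lambda>t. f (- t)) + integral {0..\<zeta>} f = integral {0..\<zeta>} (\<lambda>t. f (- t) + f t)"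
  proof (rule integral_add[symmetric])
    show "f integrable_on {0..\<zeta>}"
      by (rule integrable_continuous_real, rule continuous_on_subset[OF contf]) (use \<zeta> in auto)
    show "(\<lambda>t. f (- t)) integrable_on {0..\<zeta>}"
      by (rule integrable_continuous_real, rule continuous_on_compose2[OF contf]) (use \<zeta> in \<open>auto intro!: continuous_intros\<close>)
  qed
  also have "\<dots> = integral {0..\<zeta>} (\<lambda>t. 2 * h t)"
    by (intro integral_cong) (simp add: f_def h_def cos_exp_eq algebra_simps)
  also have "\<dots> = 2 * integral {0<..<\<zeta>} h" by (simp flip: integral_open_interval_real)
  finally have I: "integral {-\<zeta>..\<zeta>} f = 2 * integral {0<..<\<zeta>} h" .

  define c where "c = hyp2F1_term (\<nu> + 1) (- \<nu>) (1/2) (of_real Y)"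
  have c_power: "c n * of_real r ^ n = hyp2F1_term (\<nu> + 1) (- \<nu>) (1/2) (of_real (Y * r)) n" for n r
    by (simp add: c_def hyp2F1_term_def power_mult_distrib)
  define F where "F r = of_real r powr (- 1/2) * of_real (1 - r) powr k * (\<Sum>n. c n * of_real r ^ n)" for r :: real
  define g where "g t = sin (t / 2) ^ 2 / Y" for t :: real
  define g' where "g' t = sin (t / 2) * cos (t / 2) / Y" for t :: real
  let ?C = "of_real (sqrt pi) * of_real Y powr (1/2) * of_real (2 * Y) powr k :: complex"
  \<comment> \<open>\<open>?C\<close> collects the factors free of \<open>t\<close>. The Jacobian
    identity \<open>p2\<close> trades cos (t/2) for \<open>g'\<close> and g^(-1/2), which is where
    the exponent \<open>- 1/2\<close> in \<open>F\<close> comes from.\<close>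
  have hF: "h t = ?C * (\<bar>g' t\<bar> *\<^sub>R F (g t))" if t: "t \<in> {0<..<\<zeta>}" for t
  proof -
    have st: "sin (t / 2) > 0" "cos (t / 2) > 0"
      using t \<zeta> by (auto intro!: sin_gt_zero cos_gt_zero)
    have lt: "sin (t / 2) < sin (\<zeta> / 2)" using t \<zeta> by (intro sin_monotone_2pi) auto
    then have gY: "sin (t / 2) ^ 2 < Y" using st unfolding Y_def by (intro power_strict_mono) auto
    have g1: "0 < g t" "g t < 1" using st gY Y by (auto simp: g_def)
    have hyp: "(\<Sum>n. c n * of_real (g t) ^ n) = hyp2F1_reg (\<nu> + 1) (- \<nu>) (1/2) (of_real (sin (t / 2) ^ 2))"
      unfolding hyp2F1_reg_eq_suminf c_power using Y by (simp add: g_def)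
    have cs: "cos ((\<nu> + 1/2) * of_real t) = of_real (sqrt pi) * of_real (cos (t / 2)) * (\<Sum>n. c n * of_real (g t) ^ n)"
    proof -
      have "(\<nu> + 1/2) * of_real t = (2 * \<nu> + 1) * of_real (t / 2)" by (simp add: field_simps)
      moreover have "\<bar>t / 2\<bar> < pi / 2" using t \<zeta> by auto
      ultimately show ?thesis
        unfolding hyp using cos_eq_hyp2F1[of "t / 2" \<nu>] by (simp only: cos_of_real)
    qed
    have "2 * Y * (1 - g t) = 2 * Y - 2 * sin (t / 2) ^ 2"
      using Y(1) by (simp add: g_def field_simps)
    then have "cos t - cos \<zeta> = 2 * Y * (1 - g t)"
      using cos_double_sin[of "t / 2"] Y(3) by simp
    then have e: "complex_of_real (cos t - cos \<zeta>) = of_real (2 * Y) * of_real (1 - g t)"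
      by (simp only: of_real_mult)
    have p1: "of_real (cos t - cos \<zeta>) powr k = of_real (2 * Y) powr k * complex_of_real (1 - g t) powr k"
      unfolding e using Y(1) by (intro powr_times_real_left) auto
    have p2: "of_real Y powr (1/2) * (of_real \<bar>g' t\<bar> * of_real (g t) powr (- 1/2)) = complex_of_real (cos (t / 2))"
    proof -
      have "Y powr (1/2) = sqrt Y" "g t powr (- (1/2)) = 1 / sqrt (g t)"
        unfolding powr_minus_divide using Y g1 by (simp_all add: powr_half_sqrt)
      moreover have "complex_of_real Y powr of_real (1/2) = of_real (Y powr (1/2))"
        "complex_of_real (g t) powr of_real (- (1/2)) = of_real (g t powr (- (1/2)))"
        using Y g1 by (intro powr_of_real; simp)+
      moreover have "complex_of_real (1/2) = 1/2" "complex_of_real (- (1/2)) = - 1/2" by simp_all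
      ultimately have "complex_of_real Y powr (1/2) = of_real (sqrt Y)" "complex_of_real (g t) powr (- 1/2) = of_real (1 / sqrt (g t))"
        by (simp_all only:)
      moreover have "sqrt (g t) = sin (t / 2) / sqrt Y"
        using st by (simp add: g_def real_sqrt_divide)
      moreover have "sqrt Y * (\<bar>g' t\<bar> * (1 / (sin (t / 2) / sqrt Y))) = cos (t / 2)"
        using st Y by (simp add: g'_def abs_mult field_simps)
      ultimately show ?thesis by (metis of_real_mult)
    qed
    have "?C * (\<bar>g' t\<bar> *\<^sub>R F (g t)) = of_real (sqrt pi) *
        (of_real Y powr (1/2) * (of_real \<bar>g' t\<bar> * of_real (g t) powr (- 1/2))) * (\<Sum>n. c n * of_real (g t) ^ n) *
        (of_real (2 * Y) powr k * of_real (1 - g t) powr k)"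
      by (simp only: F_def scaleR_conv_of_real mult_ac)
    also have "\<dots> = h t" unfolding p2 p1[symmetric] h_def cs by (simp only: mult_ac)
    finally show ?thesis by simp
  qed
  have C0: "?C \<noteq> 0" using Y by simp
  have inj: "inj_on g {0<..<\<zeta>}"
  proof (rule inj_onI)
    fix s t assume st: "s \<in> {0<..<\<zeta>}" "t \<in> {0<..<\<zeta>}" "g s = g t"
    have pos: "sin (s / 2) > 0" "sin (t / 2) > 0" using st \<zeta> by (auto intro!: sin_gt_zero)
    have "sin (s / 2) ^ 2 = sin (t / 2) ^ 2" using st Y by (simp add: g_def)
    then have "sin (s / 2) = sin (t / 2)" using pos by (simp add: power2_eq_iff_nonneg)
    then show "s = t" using st \<zeta> sin_inj_pi[of "s / 2" "t / 2"] by auto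
  qed
  have img: "g ` {0<..<\<zeta>} = {0<..<1}"
  proof (intro equalityI subsetI)
    fix r assume "r \<in> g ` {0<..<\<zeta>}"
    then obtain t where t: "t \<in> {0<..<\<zeta>}" "r = g t" by blast
    have "sin (t / 2) > 0" "sin (t / 2) < sin (\<zeta> / 2)"
      using t \<zeta> by (auto intro!: sin_gt_zero sin_monotone_2pi)
    then have "0 < sin (t / 2) ^ 2" "sin (t / 2) ^ 2 < Y"
      unfolding Y_def by (auto intro!: power_strict_mono)
    then show "r \<in> {0<..<1}" using Y t by (simp add: g_def)
  next
    fix r :: real assume r: "r \<in> {0<..<1}"
    define s where "s = sqrt (Y * r)"
    have "Y * r < Y * 1" using r Y by (intro mult_strict_left_mono) auto
    then have "sqrt (Y * r) < sqrt Y" by simp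
    also have "sqrt Y = sin (\<zeta> / 2)" using ferrers_P_argument(2)[OF \<zeta>] by (simp add: Y_def)
    finally have s_less: "s < sin (\<zeta> / 2)" by (simp only: s_def)
    have s: "0 < s" "s < sin (\<zeta> / 2)" "s \<le> 1"
      using r Y s_less sin_le_one[of "\<zeta> / 2"] by (simp add: s_def, simp, linarith)
    have "arcsin s < arcsin (sin (\<zeta> / 2))" "arcsin 0 < arcsin s"
      using s sin_le_one[of "\<zeta> / 2"] arcsin_less_arcsin[of 0 s, OF _ s(1,3)]
        arcsin_less_arcsin[of s "sin (\<zeta> / 2)"] by simp_all
    then have "2 * arcsin s \<in> {0<..<\<zeta>}" using \<zeta> by (simp add: arcsin_sin)
    moreover have "sin (arcsin s) = s" using s by (intro sin_arcsin) auto
    moreover have "s ^ 2 = Y * r" using r Y by (simp add: s_def)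
    ultimately have "2 * arcsin s \<in> {0<..<\<zeta>}" and "g (2 * arcsin s) = r" using Y by (simp_all add: g_def)
    then show "r \<in> g ` {0<..<\<zeta>}" by blast
  qed
  have "h absolutely_integrable_on {0..\<zeta>}"
    by (rule absolutely_integrable_continuous_real, rule continuous_on_subset[OF conth]) (use \<zeta> in auto)
  then have "h absolutely_integrable_on {0<..<\<zeta>}"
    by (rule set_integrable_subset) auto
  then have Ch: "(\<lambda>t. inverse ?C * h t) absolutely_integrable_on {0<..<\<zeta>}"
    by (rule set_integrable_mult_right)
  have hF': "\<bar>g' t\<bar> *\<^sub>R F (g t) = inverse ?C * h t" if "t \<in> {0<..<\<zeta>}" for t
  proof -
    have "inverse D * (D * x) = x" if "D \<noteq> 0" for D x :: complex using that by simp
    from this[OF C0, symmetric] show ?thesis unfolding hF[OF that] .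
  qed
  have "(\<lambda>t. \<bar>g' t\<bar> *\<^sub>R F (g t)) absolutely_integrable_on {0<..<\<zeta>}"
    by (rule absolutely_integrable_spike[OF Ch, where S="{}"]) (simp, rule hF', simp)
  moreover have "(g has_field_derivative g' t) (at t within {0<..<\<zeta>})" for t
    unfolding g_def g'_def using Y by (auto intro!: derivative_eq_intros)
  ultimately have "integral (g ` {0<..<\<zeta>}) F = integral {0<..<\<zeta>} (\<lambda>t. \<bar>g' t\<bar> *\<^sub>R F (g t))"
    using has_absolute_integral_change_of_variables_real[OF _ _ inj, of g' F] by auto
  also have "\<dots> = integral {0<..<\<zeta>} (\<lambda>t. inverse ?C * h t)"
    by (intro integral_cong hF')
  finally have "integral {0<..<1} F = inverse ?C * integral {0<..<\<zeta>} h" by (simp only: img integral_mult_right)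
  have H: "integral {0<..<\<zeta>} h = ?C * integral {0<..<1} F"
  proof -
    have "y = D * x" if "x = inverse D * y" "D \<noteq> 0" for x y D :: complex using that by simp
    from this[OF _ C0] show ?thesis using \<open>integral {0<..<1} F = inverse ?C * integral {0<..<\<zeta>} h\<close> .
  qed
  have F: "integral {0<..<1} F = Gamma (1/2 - \<mu>) * hyp2F1_reg (\<nu> + 1) (- \<nu>) (1 - \<mu>) (of_real Y)"
  proof -
    have "(\<lambda>n. c n * (Gamma (- 1/2 + 1 + of_nat n) * Gamma (k + 1) * rGamma (- 1/2 + k + 2 + of_nat n))) sums
        integral {0<..<1} F"
      unfolding F_def
      by (rule power_series_beta_sums) (use k Y in \<open>auto simp: c_def intro!: hyp2F1_term_summable\<close>)
    moreover have "c n * (Gamma (- 1/2 + 1 + of_nat n) * Gamma (k + 1) * rGamma (- 1/2 + k + 2 + of_nat n)) =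
        Gamma (1/2 - \<mu>) * hyp2F1_term (\<nu> + 1) (- \<nu>) (1 - \<mu>) (of_real Y) n" for n
    proof -
      have e: "- 1/2 + 1 + of_nat n = 1/2 + complex_of_nat n" "k + 1 = 1/2 - \<mu>"
        "- 1/2 + k + 2 + of_nat n = 1 - \<mu> + of_nat n"
        by (simp_all add: k_def)
      have "Gamma (1/2 + of_nat n) * rGamma (1/2 + of_nat n) = (1::complex)"
        by (rule Gamma_times_rGamma) (simp add: add_pos_nonneg)
      moreover have "P * Q * r / f * y * (G * A * R) = A * (P * Q * R / f * y) * (G * r)" for P Q r f y G A R :: complex
        by simp
      ultimately show ?thesis unfolding c_def hyp2F1_term_def e by (simp only: mult_1_right)
    qed
    ultimately have 1: "(\<lambda>n. Gamma (1/2 - \<mu>) * hyp2F1_term (\<nu> + 1) (- \<nu>) (1 - \<mu>) (of_real Y) n) sums integral {0<..<1} F"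
      by (simp only:)
    have "(\<lambda>n. Gamma (1/2 - \<mu>) * hyp2F1_term (\<nu> + 1) (- \<nu>) (1 - \<mu>) (of_real Y) n) sums
      (Gamma (1/2 - \<mu>) * hyp2F1_reg (\<nu> + 1) (- \<nu>) (1 - \<mu>) (of_real Y))"
      unfolding hyp2F1_reg_eq_suminf
      using Y by (intro sums_mult summable_sums summable_norm_cancel[OF hyp2F1_term_summable]) auto
    from sums_unique2[OF 1 this] show ?thesis .
  qed
  have sinpos: "sin \<zeta> > 0" using \<zeta> by (simp add: sin_gt_zero)
  \<comment> \<open>All bases are positive reals, so both sides are exponentials. The relations
    sin^2 = (1 + cos)(1 - cos) and 1 - cos \<zeta> = 2 Y reduce the exponents to ln 2, ln Y and ln
    (sin \<zeta>).\<close>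
  have cot: "complex_of_real ((1 + cos \<zeta>) / (1 - cos \<zeta>)) powr (\<mu> / 2) =
      of_real (sqrt (2 / pi)) * of_real (sin \<zeta>) powr \<mu> * of_real (sqrt pi) * of_real Y powr (1/2) * of_real (2 * Y) powr k"
  proof -
    have x: "cos \<zeta> < 1" "- 1 < cos \<zeta>" using Y by (auto simp: field_simps)
    have "sin \<zeta> ^ 2 = (1 + cos \<zeta>) * (1 - cos \<zeta>)" by (simp add: sin_squared_eq algebra_simps power2_eq_square)
    then have "ln (sin \<zeta> ^ 2) = ln (1 + cos \<zeta>) + ln (1 - cos \<zeta>)" using x by (simp add: ln_mult)
    then have l1: "2 * ln (sin \<zeta>) = ln (1 + cos \<zeta>) + ln (1 - cos \<zeta>)" using sinpos by (simp add: ln_realpow)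
    have "1 - cos \<zeta> = 2 * Y" using Y by simp
    then have l2: "ln (1 - cos \<zeta>) = ln 2 + ln Y" using Y by (simp add: ln_mult)
    have l3: "ln ((1 + cos \<zeta>) / (1 - cos \<zeta>)) = 2 * ln (sin \<zeta>) - 2 * (ln 2 + ln Y)"
      using x l1 l2 by (simp add: ln_div)
    have "sqrt (2 / pi) * sqrt pi = exp (ln 2 / 2)"
      by (simp add: ln_sqrt[symmetric] flip: real_sqrt_mult)
    then have s2: "of_real (sqrt (2 / pi)) * of_real (sqrt pi) = exp (complex_of_real (ln 2 / 2))"
      by (metis exp_of_real of_real_mult)
    have "of_real (sqrt (2 / pi)) * of_real (sin \<zeta>) powr \<mu> * of_real (sqrt pi) * of_real Y powr (1/2) * of_real (2 * Y) powr k
      = (of_real (sqrt (2 / pi)) * of_real (sqrt pi)) * of_real (sin \<zeta>) powr \<mu> * of_real Y powr (1/2) * of_real (2 * Y) powr k"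
      by (simp only: mult_ac)
    also have "\<dots> = exp (of_real (ln 2 / 2) + \<mu> * of_real (ln (sin \<zeta>)) + 1/2 * of_real (ln Y) + k * of_real (ln 2 + ln Y))"
      unfolding s2 using sinpos Y by (simp add: powr_pos_real exp_add ln_mult del: of_real_mult of_real_divide)
    also have "\<dots> = exp (\<mu> / 2 * of_real (ln ((1 + cos \<zeta>) / (1 - cos \<zeta>))))"
      unfolding l3 by (rule arg_cong[where f=exp]) (simp add: k_def algebra_simps)
    also have "\<dots> = of_real ((1 + cos \<zeta>) / (1 - cos \<zeta>)) powr (\<mu> / 2)"
      using x by (subst powr_pos_real) auto
    finally show ?thesis ..
  qed
  have "Gamma (1/2 - \<mu>) * rGamma (1/2 - \<mu>) = 1" using \<mu> by (intro Gamma_times_rGamma) auto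
  moreover have "S * s * r / 2 * (2 * (p * y * q * (G * X))) = S * s * p * y * q * X * (G * r)"
    for S s r p y q G X :: complex by simp
  ultimately have "of_real (sqrt (2 / pi)) * of_real (sin \<zeta>) powr \<mu> * rGamma (1/2 - \<mu>) / 2 * integral {-\<zeta>..\<zeta>} f
     = of_real ((1 + cos \<zeta>) / (1 - cos \<zeta>)) powr (\<mu> / 2) * hyp2F1_reg (\<nu> + 1) (- \<nu>) (1 - \<mu>) (of_real Y)"
    unfolding I H F cot by (simp only: mult_1_right)
  then show ?thesis unfolding ferrers_P_def Y(3) f_def k_def by simp
qed

section \<open>The half-line integrals and the contour shift\<close>

text \<open>For \<open>\<sigma> = 1\<close> this is \<open>e\<^sup>i\<^sup>\<zeta> / (2 i sin \<zeta>)\<close>, for \<open>\<sigma> = -1\<close> its complex conjugate.\<close>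

definition ferrers_w :: "real \<Rightarrow> real \<Rightarrow> complex" where
  "ferrers_w \<sigma> \<zeta> = Complex (1/2) (- \<sigma> * cos \<zeta> / (2 * sin \<zeta>))"

lemma Re_ferrers_w [simp]: "Re (ferrers_w \<sigma> \<zeta>) = 1/2"
  by (simp add: ferrers_w_def)

text \<open>For \<open>Re z > 0\<close> the argument is within pi/2 of 0, so a quarter turn either
  way stays inside (-pi, pi) and the principal logarithm is merely shifted.\<close>

lemma powr_rotate_quarter:
  assumes "Re z > 0" and \<sigma>: "\<sigma> = 1 \<or> \<sigma> = (-1::real)"
  shows "(- \<i> * of_real \<sigma> * z) powr k = exp (- \<i> * of_real \<sigma> * of_real (pi/2) * k) * z powr k"
proof -
  have z0: "z \<noteq> 0" using assms by auto
  have "\<bar>Im (Ln z)\<bar> < pi / 2" using assms z0 Re_Ln_pos_lt by blast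
  then have im: "Im (Ln z) < pi/2" "Im (Ln z) > - pi/2" by auto
  have e: "exp (Ln z + - \<i> * of_real \<sigma> * of_real (pi/2)) = - \<i> * of_real \<sigma> * z"
  proof -
    have "exp (- \<i> * of_real \<sigma> * of_real (pi/2)) = cis (- \<sigma> * (pi/2))"
      by (simp add: cis_conv_exp mult_ac)
    also have "\<dots> = - \<i> * of_real \<sigma>" using \<sigma> by (auto simp: complex_eq_iff)
    finally show ?thesis unfolding exp_add exp_Ln[OF z0] by (simp only: mult.commute)
  qed
  have "Ln (- \<i> * of_real \<sigma> * z) = Ln z + - \<i> * of_real \<sigma> * of_real (pi/2)"
    unfolding e[symmetric] using im \<sigma> by (intro Ln_exp) auto
  moreover have "- \<i> * of_real \<sigma> * z \<noteq> 0" using z0 \<sigma> by auto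
  ultimately show ?thesis using z0 by (simp only: powr_def if_False ring_distribs exp_add mult_ac)
qed

text \<open>On the half-line above \<open>\<sigma> * \<zeta>\<close> the cosine is rational in exp
  (-y). With t = 1 - exp (-y) the difference is a real factor times a quarter turn times 1 - w t;
  this is the origin of \<open>ferrers_w\<close>.\<close>

lemma cos_vertical_line:
  fixes \<zeta> \<sigma> y :: real
  assumes "sin \<zeta> \<noteq> 0" and \<sigma>: "\<sigma> = 1 \<or> \<sigma> = -1"
  shows "cos (Complex (\<sigma> * \<zeta>) y) - of_real (cos \<zeta>) =
    of_real ((1 - exp (- y)) * sin \<zeta> / exp (- y)) *
      (- \<i> * of_real \<sigma> * (1 - ferrers_w \<sigma> \<zeta> * of_real (1 - exp (- y))))"
proof -
  define v where "v = exp (- y)"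
  have v: "v > 0" "exp y = 1 / v" by (auto simp: v_def exp_minus field_simps)
  have "cos (\<sigma> * \<zeta>) = cos \<zeta>" "sin (\<sigma> * \<zeta>) = \<sigma> * sin \<zeta>" using \<sigma> by auto
  then have "Re (cos (Complex (\<sigma> * \<zeta>) y)) = cos \<zeta> * (1 / v + v) / 2"
    "Im (cos (Complex (\<sigma> * \<zeta>) y)) = \<sigma> * sin \<zeta> * (v - 1 / v) / 2"
    by (simp_all add: Re_cos Im_cos v v_def[symmetric])
  then show ?thesis using assms v unfolding v_def[symmetric] ferrers_w_def
    by (intro complex_eqI) (auto simp: field_simps power2_eq_square)
qed

text \<open>The substitution t = 1 - exp (-y) turns the decay exp (-(\<nu> + \<mu> + 1) y) into the
  Jacobian times (1 - t)^(\<nu> + \<mu>). The phase with \<open>\<mu> + 1/2\<close> is the quarter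
  turn of \<open>cos_vertical_line\<close> raised to the power \<open>- 1/2 - \<mu>\<close>.\<close>

lemma vertical_integral:
  fixes \<zeta> \<sigma> :: real and \<mu> \<nu> :: complex
  assumes \<zeta>: "0 < \<zeta>" "\<zeta> < pi" and \<sigma>: "\<sigma> = 1 \<or> \<sigma> = -1"
    and \<mu>: "Re \<mu> < 1/2" and \<nu>: "Re \<nu> + Re \<mu> > -1"
  defines "f \<equiv> \<lambda>t. exp (\<i> * (\<nu> + 1/2) * t) * (cos t - of_real (cos \<zeta>)) powr (- \<mu> - 1/2)"
  shows "(\<lambda>y. f (Complex (\<sigma> * \<zeta>) y)) absolutely_integrable_on {0<..}"
    and "integral {0<..} (\<lambda>y. f (Complex (\<sigma> * \<zeta>) y)) =
      exp (\<i> * of_real \<sigma> * ((\<nu> + 1/2) * of_real \<zeta> + (\<mu> + 1/2) * of_real (pi/2))) *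
      of_real (sin \<zeta>) powr (- \<mu> - 1/2) *
      euler_integral (- 1/2 - \<mu>) (\<nu> + \<mu>) (- 1/2 - \<mu>) (ferrers_w \<sigma> \<zeta>)"
proof -
  define k where "k = - 1/2 - \<mu>"
  have k': "- \<mu> - 1/2 = - 1/2 - \<mu>" by simp
  let ?w = "ferrers_w \<sigma> \<zeta>"
  define C where "C = exp (\<i> * of_real \<sigma> * ((\<nu> + 1/2) * of_real \<zeta> + (\<mu> + 1/2) * of_real (pi/2))) * of_real (sin \<zeta>) powr k"
  have sinpos: "sin \<zeta> > 0" using \<zeta> by (simp add: sin_gt_zero)
  define g where "g y = 1 - exp (- y)" for y :: real
  define g' where "g' y = exp (- y)" for y :: real
  have eq: "f (Complex (\<sigma> * \<zeta>) y) = C * (\<bar>g' y\<bar> *\<^sub>R euler_kernel k (\<nu> + \<mu>) k ?w (g y))" if y: "y \<in> {0<..}" for y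
  proof -
    have g: "0 < g y" "g y < 1" using y by (auto simp: g_def)
    have re: "Re (1 - ?w * of_real (g y)) > 0" using g one_minus_mult_not_nonpos(1)[of ?w "g y"] by simp
    have r: "(1 - exp (- y)) * sin \<zeta> / exp (- y) > 0" using g sinpos by (simp add: g_def)
    have lr: "ln (g y * sin \<zeta> / exp (- y)) = ln (g y) + ln (sin \<zeta>) + y"
      using g sinpos by (simp add: ln_mult ln_div g_def)
    have "(cos (Complex (\<sigma> * \<zeta>) y) - of_real (cos \<zeta>)) powr k =
      exp (k * of_real (ln (g y) + ln (sin \<zeta>) + y)) * (exp (- \<i> * of_real \<sigma> * of_real (pi/2) * k) * (1 - ?w * of_real (g y)) powr k)"
      unfolding cos_vertical_line[OF less_imp_neq[OF sinpos, symmetric] \<sigma>] g_def[symmetric]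
      using r powr_pos_real[OF r, of k]
      by (subst powr_times_real_left, simp, simp add: g_def, subst powr_rotate_quarter[OF re \<sigma>])
         (simp only: lr g_def[symmetric])
    then have "f (Complex (\<sigma> * \<zeta>) y) = exp (\<i> * (\<nu> + 1/2) * Complex (\<sigma> * \<zeta>) y) *
      (exp (k * of_real (ln (g y) + ln (sin \<zeta>) + y)) * (exp (- \<i> * of_real \<sigma> * of_real (pi/2) * k) * (1 - ?w * of_real (g y)) powr k))"
      unfolding f_def k' k_def by simp
    also have "\<dots> = exp (\<i> * (\<nu> + 1/2) * Complex (\<sigma> * \<zeta>) y + k * of_real (ln (g y) + ln (sin \<zeta>) + y) +
       - \<i> * of_real \<sigma> * of_real (pi/2) * k) * (1 - ?w * of_real (g y)) powr k"
      by (simp only: exp_add mult_ac)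
    also have "\<i> * (\<nu> + 1/2) * Complex (\<sigma> * \<zeta>) y + k * of_real (ln (g y) + ln (sin \<zeta>) + y) +
       - \<i> * of_real \<sigma> * of_real (pi/2) * k = 
       (\<i> * of_real \<sigma> * ((\<nu> + 1/2) * of_real \<zeta> + (\<mu> + 1/2) * of_real (pi/2)) + k * of_real (ln (sin \<zeta>))) +
       (of_real (- y) + k * of_real (ln (g y)) + (\<nu> + \<mu>) * of_real (- y))"
      by (simp add: k_def Complex_eq algebra_simps add_divide_distrib diff_divide_distrib)
    also have "exp (\<dots>) = C * (of_real (g' y) * (of_real (g y) powr k * of_real (1 - g y) powr (\<nu> + \<mu>)))"
    proof -
      have "of_real (1 - g y) powr (\<nu> + \<mu>) = exp ((\<nu> + \<mu>) * of_real (- y))"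
        using powr_pos_real[of "exp (- y)" "\<nu> + \<mu>"] by (simp add: g_def)
      moreover have "of_real (g' y) = exp (complex_of_real (- y))"
        unfolding g'_def by (simp only: exp_of_real)
      ultimately show ?thesis
        unfolding C_def powr_pos_real[OF sinpos] powr_pos_real[OF g(1)] by (simp only: exp_add mult_ac)
    qed
    finally show ?thesis by (simp add: euler_kernel_def g'_def scaleR_conv_of_real mult_ac)
  qed
  have img: "g ` {0<..} = {0<..<1}"
  proof (intro equalityI subsetI)
    fix r :: real assume r: "r \<in> {0<..<1}"
    then have "g (- ln (1 - r)) = r" "- ln (1 - r) \<in> {0<..}" by (auto simp: g_def)
    then show "r \<in> g ` {0<..}" by (metis imageI)
  qed (auto simp: g_def)
  have inj: "inj_on g {0<..}" by (auto simp: inj_on_def g_def)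
  have der: "(g has_field_derivative g' y) (at y within {0<..})" for y
    unfolding g_def g'_def by (auto intro!: derivative_eq_intros)
  have "euler_kernel k (\<nu> + \<mu>) k ?w absolutely_integrable_on {0<..<1}"
    using \<mu> \<nu> by (intro euler_kernel_absolutely_integrable) (auto simp: k_def)
  then have I: "(\<lambda>y. \<bar>g' y\<bar> *\<^sub>R euler_kernel k (\<nu> + \<mu>) k ?w (g y)) absolutely_integrable_on {0<..}"
     "integral {0<..} (\<lambda>y. \<bar>g' y\<bar> *\<^sub>R euler_kernel k (\<nu> + \<mu>) k ?w (g y)) = euler_integral k (\<nu> + \<mu>) k ?w"
    using has_absolute_integral_change_of_variables_real[OF _ der inj, of "euler_kernel k (\<nu> + \<mu>) k ?w"
        "euler_integral k (\<nu> + \<mu>) k ?w"]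
    unfolding img euler_integral_def by auto
  show "(\<lambda>y. f (Complex (\<sigma> * \<zeta>) y)) absolutely_integrable_on {0<..}"
    by (rule absolutely_integrable_spike[OF set_integrable_mult_right[OF I(1), of C], where S="{}"]) (use eq in auto)
  have "integral {0<..} (\<lambda>y. f (Complex (\<sigma> * \<zeta>) y)) =
      integral {0<..} (\<lambda>y. C * (\<bar>g' y\<bar> *\<^sub>R euler_kernel k (\<nu> + \<mu>) k ?w (g y)))"
    by (intro integral_cong eq)
  also have "\<dots> = C * euler_integral k (\<nu> + \<mu>) k ?w"
    unfolding integral_mult_right I(2) ..
  finally show "integral {0<..} (\<lambda>y. f (Complex (\<sigma> * \<zeta>) y)) =
      exp (\<i> * of_real \<sigma> * ((\<nu> + 1/2) * of_real \<zeta> + (\<mu> + 1/2) * of_real (pi/2))) *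
      of_real (sin \<zeta>) powr (- \<mu> - 1/2) *
      euler_integral (- 1/2 - \<mu>) (\<nu> + \<mu>) (- 1/2 - \<mu>) (ferrers_w \<sigma> \<zeta>)"
    by (simp only: C_def k_def k')
qed

lemma integral_tendsto_Ioi:
  fixes h :: "real \<Rightarrow> complex"
  assumes "h absolutely_integrable_on {0<..}"
  shows "(\<lambda>n. integral {0..real n} h) \<longlonglongrightarrow> integral {0<..} h"
proof -
  have hi: "h integrable_on {0<..}" "(\<lambda>x. norm (h x)) integrable_on {0<..}"
    using assms unfolding absolutely_integrable_on_def by auto
  have sub: "h integrable_on {0<..real n}" for n
    by (rule set_lebesgue_integral_eq_integral(1), rule set_integrable_subset[OF assms]) auto
  have "(\<lambda>n. integral {0<..} (\<lambda>y. if y \<in> {0<..real n} then h y else 0)) \<longlonglongrightarrow> integral {0<..} h"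
  proof (rule dominated_convergence(2)[where h="\<lambda>x. norm (h x)"])
    show "(\<lambda>y. if y \<in> {0<..real n} then h y else 0) integrable_on {0<..}" for n
    proof -
      have "{0<..real n} \<inter> {0<..} = {0<..real n}" by auto
      with sub[of n] show ?thesis by (subst integrable_restrict_Int) simp
    qed
    show "(\<lambda>n. if y \<in> {0<..real n} then h y else 0) \<longlonglongrightarrow> h y" if "y \<in> {0<..}" for y
    proof (rule tendsto_eventually)
      have "\<forall>\<^sub>F n in sequentially. real n \<ge> y"
        using filterlim_real_sequentially unfolding filterlim_at_top by blast
      then show "\<forall>\<^sub>F n in sequentially. (if y \<in> {0<..real n} then h y else 0) = h y"
        by eventually_elim (use that in auto)
    qed
  qed (use hi in auto)
  moreover have "integral {0<..} (\<lambda>y. if y \<in> {0<..real n} then h y else 0) = integral {0..real n} h" for n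
  proof -
    have "integral {0<..} (\<lambda>y. if y \<in> {0<..real n} then h y else 0) = integral ({0<..real n} \<inter> {0<..}) h"
      by (rule integral_restrict_Int)
    also have "{0<..real n} \<inter> {0<..} = {0<..real n}" by auto
    also have "integral {0<..real n} h = integral {0..real n} h"
      by (rule integral_subset_negligible) (auto intro!: negligible_subset[of "{0::real}"])
    finally show ?thesis .
  qed
  ultimately show ?thesis by simp
qed

text \<open>The imaginary part is -sin (Re z) sinh (Im z), which vanishes in the half-strip only on
  the two coordinate axes, and there the real part is nonnegative. The principal power is thus
  holomorphic inside the half-strip and can meet its cut only at the value 0 on the
  boundary.\<close>

lemma cos_diff_branch:
  fixes z :: complex
  assumes \<zeta>: "0 < \<zeta>" "\<zeta> < pi" and z: "\<bar>Re z\<bar> \<le> \<zeta>" "0 \<le> Im z"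
  shows "Re (cos z - of_real (cos \<zeta>)) \<ge> 0 \<or> Im (cos z - of_real (cos \<zeta>)) \<noteq> 0"
    and "\<bar>Re z\<bar> < \<zeta> \<Longrightarrow> 0 < Im z \<Longrightarrow> cos z - of_real (cos \<zeta>) \<notin> \<real>\<^sub>\<le>\<^sub>0"
proof -
  have ReIm: "Re (cos z - of_real (cos \<zeta>)) = cos (Re z) * cosh (Im z) - cos \<zeta>"
    "Im (cos z - of_real (cos \<zeta>)) = - (sin (Re z) * sinh (Im z))"
    by (simp_all add: Re_cos Im_cos cosh_def sinh_def field_simps)
  have cases: "Im z = 0 \<or> Re z = 0" if "Im (cos z - of_real (cos \<zeta>)) = 0"
  proof -
    have "Re z = 0" if "sin (Re z) = 0"
      using that sin_gt_zero[of "Re z"] sin_gt_zero[of "- Re z"] z \<zeta> by force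
    then show ?thesis using that unfolding ReIm by auto
  qed
  have cosh1: "cosh (Im z) \<ge> 1" by (simp add: cosh_real_ge_1)
  have lt1: "cos \<zeta> < 1" using \<zeta> cos_monotone_0_pi[of 0 \<zeta>] by simp
  show "Re (cos z - of_real (cos \<zeta>)) \<ge> 0 \<or> Im (cos z - of_real (cos \<zeta>)) \<noteq> 0"
    using cases cos_diff_nonneg[OF \<zeta> z(1)] cosh1 lt1 unfolding ReIm by force
  show "cos z - of_real (cos \<zeta>) \<notin> \<real>\<^sub>\<le>\<^sub>0" if "\<bar>Re z\<bar> < \<zeta>" "0 < Im z"
  proof
    assume "cos z - of_real (cos \<zeta>) \<in> \<real>\<^sub>\<le>\<^sub>0"
    then have "Re (cos z - of_real (cos \<zeta>)) \<le> 0" "Im (cos z - of_real (cos \<zeta>)) = 0"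
      unfolding complex_nonpos_Reals_iff by auto
    with cases that cosh1 lt1 show False unfolding ReIm by force
  qed
qed

text \<open>Cauchy's theorem on the rectangle over [-\<zeta>, \<zeta>] of height n. At height y the
  exponential is of order exp (-(Re \<nu> + 1/2) y) and the power at most of order exp (-(Re \<mu> +
  1/2) y), so the hypothesis on Re \<nu> + Re \<mu> makes the top side vanish in the limit.
  \<open>Re \<mu> < - 1/2\<close> makes the power continuous at the lower corners.\<close>

lemma contour_shift:
  fixes \<zeta> :: real and \<mu> \<nu> :: complex
  assumes \<zeta>: "0 < \<zeta>" "\<zeta> < pi" and \<mu>: "Re \<mu> < - 1/2" and \<nu>: "Re \<nu> + Re \<mu> > -1"
  defines "f \<equiv> \<lambda>t. exp (\<i> * (\<nu> + 1/2) * t) * (cos t - of_real (cos \<zeta>)) powr (- \<mu> - 1/2)"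
  shows "integral {-\<zeta>..\<zeta>} (\<lambda>t. f (of_real t)) =
     \<i> * (integral {0<..} (\<lambda>y. f (Complex (- \<zeta>) y)) - integral {0<..} (\<lambda>y. f (Complex \<zeta> y)))"
proof -
  define k where "k = - \<mu> - 1/2"
  have k: "Re k > 0" using \<mu> by (simp add: k_def)
  define R where "R T = cbox (Complex (- \<zeta>) 0) (Complex \<zeta> T)" for T
  have R: "z \<in> R T \<longleftrightarrow> \<bar>Re z\<bar> \<le> \<zeta> \<and> 0 \<le> Im z \<and> Im z \<le> T" for z T
    by (auto simp: R_def in_cbox_complex_iff)
  have contf: "continuous_on (R T) f" for T
    unfolding f_def k_def[symmetric]
  proof (intro continuous_intros)
    show "R T \<subseteq> {z. 0 \<le> Re (cos z - of_real (cos \<zeta>)) \<or> Im (cos z - of_real (cos \<zeta>)) \<noteq> 0}"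
      using cos_diff_branch(1)[OF \<zeta>] R by blast
  qed (use k in auto)
  define top where "top n = contour_integral (linepath (Complex \<zeta> (real n)) (Complex (- \<zeta>) (real n))) f" for n :: nat
  have rect: "integral {-\<zeta>..\<zeta>} (\<lambda>t. f (of_real t)) + \<i> * integral {0..real n} (\<lambda>y. f (Complex \<zeta> y)) + top n
      - \<i> * integral {0..real n} (\<lambda>y. f (Complex (- \<zeta>) y)) = 0" if n: "n > 0" for n :: nat
  proof -
    let ?a = "Complex (- \<zeta>) 0" and ?b = "Complex \<zeta> 0" and ?c = "Complex \<zeta> (real n)" and ?d = "Complex (- \<zeta>) (real n)"
    have conv: "convex (R (real n))" by (simp add: R_def)
    have pts: "?a \<in> R (real n)" "?b \<in> R (real n)" "?c \<in> R (real n)" "?d \<in> R (real n)"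
      using \<zeta> by (auto simp: R)
    have "(f has_contour_integral 0) (linepath ?a ?b +++ linepath ?b ?c +++ linepath ?c ?d +++ linepath ?d ?a)"
    proof (rule Cauchy_theorem_convex[OF contf conv, where K="{}"])
      have "f holomorphic_on box ?a ?c"
        unfolding f_def
        by (intro holomorphic_intros) (use cos_diff_branch(2)[OF \<zeta>] in \<open>auto simp: in_box_complex_iff\<close>)
      then show "f field_differentiable at z" if "z \<in> interior (R (real n)) - {}" for z
        using that holomorphic_on_imp_differentiable_at[OF _ open_box] by (simp add: R_def interior_cbox)
    qed (use pts conv in \<open>auto simp: path_image_join closed_segment_subset\<close>)
    then have "contour_integral (linepath ?a ?b) f + contour_integral (linepath ?b ?c) f +
        contour_integral (linepath ?c ?d) f + contour_integral (linepath ?d ?a) f = 0"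
      by (rule has_chain_integral_chain_integral4)
    moreover have "contour_integral (linepath ?a ?b) f = integral {-\<zeta>..\<zeta>} (\<lambda>t. f (of_real t))"
      using \<zeta> by (subst contour_integral_linepath_Reals_eq) (auto simp: complex_is_Real_iff)
    moreover have "contour_integral (linepath ?b ?c) f = \<i> * integral {0..real n} (\<lambda>y. f (Complex \<zeta> y))"
      using n by (intro contour_integral_linepath_same_Re) auto
    moreover have "contour_integral (linepath ?d ?a) f = - (\<i> * integral {0..real n} (\<lambda>y. f (Complex (- \<zeta>) y)))"
      using n contour_integral_linepath_same_Re[of ?a "- \<zeta>" ?d 0 "real n" f]
        contour_integral_reverse_linepath[of ?d ?a f] continuous_on_subset[OF contf[of "real n"], of "closed_segment ?d ?a"]
        closed_segment_subset[OF pts(4,1) conv] by simp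
    ultimately show ?thesis unfolding top_def by (simp add: algebra_simps)
  qed
  have "top \<longlonglongrightarrow> 0"
  proof (rule tendsto_norm_zero_cancel, rule tendsto_sandwich[of "\<lambda>_. 0"])
    \<comment> \<open>The three factors of \<open>c\<close> account for \<open>Im \<nu>\<close>
      acting on \<open>Re z\<close>, for the bound 2 exp (Im z) of the base, and for
      \<open>Im k\<close> acting on an argument of size at most pi.\<close>
    define c where "c = exp (\<bar>Im \<nu>\<bar> * \<zeta>) * (2 powr Re k * exp (pi * \<bar>Im k\<bar>))"
    have b: "norm (f z) \<le> c * exp (- (Re \<nu> + Re \<mu> + 1) * Im z)" if z: "\<bar>Re z\<bar> \<le> \<zeta>" "Im z \<ge> 0" for z
    proof -
      have "norm (exp (\<i> * (\<nu> + 1/2) * z)) = exp (- Im \<nu> * Re z) * exp (- (Re \<nu> + 1/2) * Im z)"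
        by (simp add: algebra_simps flip: exp_add)
      also have "- Im \<nu> * Re z \<le> \<bar>Im \<nu>\<bar> * \<zeta>"
      proof -
        have "- Im \<nu> * Re z \<le> \<bar>Im \<nu> * Re z\<bar>" by simp
        also have "\<dots> \<le> \<bar>Im \<nu>\<bar> * \<zeta>" unfolding abs_mult using z by (intro mult_left_mono) auto
        finally show ?thesis .
      qed
      finally have 1: "norm (exp (\<i> * (\<nu> + 1/2) * z)) \<le> exp (\<bar>Im \<nu>\<bar> * \<zeta>) * exp (- (Re \<nu> + 1/2) * Im z)"
        by (simp add: mult_right_mono)
      have "norm (cos z - of_real (cos \<zeta>)) \<le> norm (cos z) + 1"
        by (intro order_trans[OF norm_triangle_ineq4] add_left_mono) simp
      also have "norm (cos z) \<le> exp (Im z)"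
      proof -
        have "norm (cos z) \<le> (norm (exp (\<i> * z)) + norm (exp (- (\<i> * z)))) / 2"
          unfolding cos_exp_eq norm_divide using norm_triangle_ineq[of "exp (\<i> * z)" "exp (- (\<i> * z))"] by simp
        also have "\<dots> \<le> exp (Im z)" using z by simp
        finally show ?thesis .
      qed
      finally have "norm (cos z - of_real (cos \<zeta>)) \<le> 2 * exp (Im z)"
        using z one_le_exp_iff[of "Im z"] by linarith
      then have "norm (cos z - of_real (cos \<zeta>)) powr Re k \<le> (2 * exp (Im z)) powr Re k"
        using k by (intro powr_mono2) auto
      also have "\<dots> = 2 powr Re k * exp (Re k * Im z)" by (simp add: powr_mult exp_powr_real mult.commute)
      finally have 2: "norm (cos z - of_real (cos \<zeta>)) powr Re k \<le> 2 powr Re k * exp (Re k * Im z)" .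
      have "- Im k * Arg (cos z - of_real (cos \<zeta>)) \<le> \<bar>Im k\<bar> * pi"
      proof -
        have "- Im k * Arg (cos z - of_real (cos \<zeta>)) \<le> \<bar>Im k * Arg (cos z - of_real (cos \<zeta>))\<bar>" by simp
        also have "\<dots> \<le> \<bar>Im k\<bar> * pi" unfolding abs_mult
          using Arg_bounded[of "cos z - of_real (cos \<zeta>)"] by (intro mult_left_mono) auto
        finally show ?thesis .
      qed
      then have "norm ((cos z - of_real (cos \<zeta>)) powr k) \<le> (2 powr Re k * exp (Re k * Im z)) * exp (pi * \<bar>Im k\<bar>)"
        unfolding norm_powr_complex by (intro mult_mono 2) (auto simp: mult.commute)
      then have "norm (f z) \<le> (exp (\<bar>Im \<nu>\<bar> * \<zeta>) * exp (- (Re \<nu> + 1/2) * Im z)) * ((2 powr Re k * exp (Re k * Im z)) * exp (pi * \<bar>Im k\<bar>))"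
        unfolding f_def k_def[symmetric] norm_mult by (intro mult_mono 1) auto
      also have "\<dots> = c * (exp (- (Re \<nu> + 1/2) * Im z) * exp (Re k * Im z))" by (simp add: c_def mult_ac)
      also have "exp (- (Re \<nu> + 1/2) * Im z) * exp (Re k * Im z) = exp (- (Re \<nu> + Re \<mu> + 1) * Im z)"
        by (simp add: k_def algebra_simps flip: exp_add)
      finally show ?thesis .
    qed
    show "\<forall>\<^sub>F n in sequentially. norm (top n) \<le> c * exp (- (Re \<nu> + Re \<mu> + 1) * real n) * (2 * \<zeta>)"
    proof (intro always_eventually allI)
      fix n :: nat
      let ?c = "Complex \<zeta> (real n)" and ?d = "Complex (- \<zeta>) (real n)"
      have seg: "closed_segment ?c ?d \<subseteq> R (real n)"
        using \<zeta> by (intro closed_segment_subset) (auto simp: R, simp add: R_def)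
      have im: "Im z = real n" if z: "z \<in> closed_segment ?c ?d" for z
      proof -
        obtain u where "z = (1 - u) *\<^sub>R ?c + u *\<^sub>R ?d" using z by (auto simp: in_segment)
        then have "Im z = (1 - u) * real n + u * real n" by simp
        then show ?thesis by (simp add: algebra_simps)
      qed
      have "norm (top n) \<le> (c * exp (- (Re \<nu> + Re \<mu> + 1) * real n)) * norm (?d - ?c)"
        unfolding top_def
      proof (rule contour_integral_bound_linepath)
        show "f contour_integrable_on linepath ?c ?d"
          by (rule contour_integrable_continuous_linepath, rule continuous_on_subset[OF contf seg])
        show "norm (f x) \<le> c * exp (- (Re \<nu> + Re \<mu> + 1) * real n)" if "x \<in> closed_segment ?c ?d" for x
          using b[of x] im[OF that] seg that R by (metis subsetD)
      qed (simp add: c_def)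
      also have "norm (?d - ?c) = 2 * \<zeta>" using \<zeta> by (simp add: cmod_def real_sqrt_mult)
      finally show "norm (top n) \<le> c * exp (- (Re \<nu> + Re \<mu> + 1) * real n) * (2 * \<zeta>)" .
    qed
    have "((\<lambda>n. exp (- (Re \<nu> + Re \<mu> + 1) * real n)) \<longlongrightarrow> 0) sequentially"
    proof -
      define a where "a = Re \<nu> + Re \<mu> + 1"
      have "a > 0" using \<nu> by (simp add: a_def)
      then have "((\<lambda>n. exp (- a * real n)) \<longlongrightarrow> 0) sequentially" by real_asymp
      then show ?thesis by (simp add: a_def)
    qed
    from tendsto_mult[OF tendsto_mult[OF tendsto_const[of c] this] tendsto_const[of "2 * \<zeta>"]]
    show "(\<lambda>n. c * exp (- (Re \<nu> + Re \<mu> + 1) * real n) * (2 * \<zeta>)) \<longlonglongrightarrow> 0"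
      by simp
  qed auto
  moreover have "(\<lambda>n. integral {0..real n} (\<lambda>y. f (Complex \<zeta> y))) \<longlonglongrightarrow> integral {0<..} (\<lambda>y. f (Complex \<zeta> y))"
    using vertical_integral(1)[OF \<zeta>, of 1 \<mu> \<nu>] \<mu> \<nu> by (intro integral_tendsto_Ioi) (simp add: f_def)
  moreover have "(\<lambda>n. integral {0..real n} (\<lambda>y. f (Complex (- \<zeta>) y))) \<longlonglongrightarrow> integral {0<..} (\<lambda>y. f (Complex (- \<zeta>) y))"
    using vertical_integral(1)[OF \<zeta>, of "- 1" \<mu> \<nu>] \<mu> \<nu> by (intro integral_tendsto_Ioi) (simp add: f_def)
  ultimately have "(\<lambda>n. integral {-\<zeta>..\<zeta>} (\<lambda>t. f (of_real t)) + \<i> * integral {0..real n} (\<lambda>y. f (Complex \<zeta> y)) + top n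
      - \<i> * integral {0..real n} (\<lambda>y. f (Complex (- \<zeta>) y))) \<longlonglongrightarrow>
     integral {-\<zeta>..\<zeta>} (\<lambda>t. f (of_real t)) + \<i> * integral {0<..} (\<lambda>y. f (Complex \<zeta> y)) + 0
      - \<i> * integral {0<..} (\<lambda>y. f (Complex (- \<zeta>) y))"
    by (intro tendsto_intros)
  moreover have "(\<lambda>n. integral {-\<zeta>..\<zeta>} (\<lambda>t. f (of_real t)) + \<i> * integral {0..real n} (\<lambda>y. f (Complex \<zeta> y)) + top n
      - \<i> * integral {0..real n} (\<lambda>y. f (Complex (- \<zeta>) y))) \<longlonglongrightarrow> 0"
    by (rule tendsto_eventually, rule eventually_mono[OF eventually_gt_at_top[of 0]]) (use rect in auto)
  ultimately have "integral {-\<zeta>..\<zeta>} (\<lambda>t. f (of_real t)) + \<i> * integral {0<..} (\<lambda>y. f (Complex \<zeta> y)) + 0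
      - \<i> * integral {0<..} (\<lambda>y. f (Complex (- \<zeta>) y)) = 0"
    by (rule LIMSEQ_unique)
  then show ?thesis by (simp add: algebra_simps)
qed

section \<open>P as a sum of two waves, and its analytic continuation\<close>

text \<open>The contribution of the half-line above \<open>\<sigma> * \<zeta>\<close> to the shifted
  contour, up to a factor common to both signs.\<close>

definition ferrers_wave :: "real \<Rightarrow> real \<Rightarrow> complex \<Rightarrow> complex \<Rightarrow> complex" where
  "ferrers_wave \<sigma> \<zeta> \<mu> \<nu> = exp (\<i> * of_real \<sigma> * ferrers_beta \<zeta> \<mu> \<nu> 0) *
     euler_integral (- 1/2 - \<mu>) (\<nu> + \<mu>) (- 1/2 - \<mu>) (ferrers_w \<sigma> \<zeta>)"

lemma ferrers_P_eq_waves_left: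
  assumes \<zeta>: "0 < \<zeta>" "\<zeta> < pi" and \<mu>: "Re \<mu> < - 1/2" and \<nu>: "Re \<nu> + Re \<mu> > -1"
  shows "ferrers_P \<nu> \<mu> (cos \<zeta>) = of_real (sqrt (2 / (pi * sin \<zeta>))) * rGamma (1/2 - \<mu>) / 2 *
    (ferrers_wave 1 \<zeta> \<mu> \<nu> + ferrers_wave (-1) \<zeta> \<mu> \<nu>)"
proof -
  define f where "f = (\<lambda>t. exp (\<i> * (\<nu> + 1/2) * t) * (cos t - of_real (cos \<zeta>)) powr (- \<mu> - 1/2))"
  let ?E = "\<lambda>\<sigma>. euler_integral (- 1/2 - \<mu>) (\<nu> + \<mu>) (- 1/2 - \<mu>) (ferrers_w \<sigma> \<zeta>)"
  let ?s = "complex_of_real (sin \<zeta>)"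
  let ?a = "(\<nu> + 1/2) * of_real \<zeta> + (\<mu> + 1/2) * of_real (pi/2)"
  have sinpos: "sin \<zeta> > 0" using \<zeta> by (simp add: sin_gt_zero)
  have Wp: "integral {0<..} (\<lambda>y. f (Complex \<zeta> y)) = exp (\<i> * ?a) * ?s powr (- \<mu> - 1/2) * ?E 1"
    using vertical_integral(2)[OF \<zeta>, of 1 \<mu> \<nu>] \<mu> \<nu> by (simp add: f_def)
  have Wm: "integral {0<..} (\<lambda>y. f (Complex (- \<zeta>) y)) = exp (- (\<i> * ?a)) * ?s powr (- \<mu> - 1/2) * ?E (-1)"
    using vertical_integral(2)[OF \<zeta>, of "-1" \<mu> \<nu>] \<mu> \<nu> by (simp add: f_def)
  have I: "integral {-\<zeta>..\<zeta>} (\<lambda>t. exp (\<i> * (\<nu> + 1/2) * of_real t) * of_real (cos t - cos \<zeta>) powr (- \<mu> - 1/2)) =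
     \<i> * (integral {0<..} (\<lambda>y. f (Complex (- \<zeta>) y)) - integral {0<..} (\<lambda>y. f (Complex \<zeta> y)))"
    using contour_shift[OF \<zeta> \<mu> \<nu>] by (simp add: f_def cos_of_real)
  \<comment> \<open>The shift by pi/2 absorbs the factor \<open>\<i>\<close> of
    \<open>contour_shift\<close> with its opposite signs on the two half-lines. This is why
    \<open>ferrers_beta\<close> has \<open>\<mu> - 1/2\<close> where the half-line integrals have
    \<open>\<mu> + 1/2\<close>.\<close>
  have "ferrers_beta \<zeta> \<mu> \<nu> 0 = ?a - of_real (pi / 2)"
    by (simp add: ferrers_beta_def algebra_simps add_divide_distrib diff_divide_distrib)
  moreover have "exp (\<i> * of_real (pi / 2)) = \<i>"
    using cis_conv_exp[of "pi / 2"] by (simp add: complex_eq_iff)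
  moreover have "exp (\<i> * (a - p)) = - \<i> * exp (\<i> * a)" "exp (- (\<i> * (a - p))) = \<i> * exp (- (\<i> * a))"
    if "exp (\<i> * p) = \<i>" for a p :: complex
    using that by (simp_all add: right_diff_distrib exp_diff exp_minus divide_inverse)
  ultimately have e: "exp (\<i> * ferrers_beta \<zeta> \<mu> \<nu> 0) = - \<i> * exp (\<i> * ?a)" 
     "exp (- (\<i> * ferrers_beta \<zeta> \<mu> \<nu> 0)) = \<i> * exp (- (\<i> * ?a))"
    by (simp_all only:)
  have s: "of_real (sqrt (2 / pi)) * ?s powr \<mu> * ?s powr (- \<mu> - 1/2) = of_real (sqrt (2 / (pi * sin \<zeta>)))"
  proof -
    have "?s powr \<mu> * ?s powr (- \<mu> - 1/2) = ?s powr (of_real (- (1/2)))"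
      by (simp flip: powr_add)
    also have "\<dots> = of_real (sin \<zeta> powr (- (1/2)))" using sinpos by (intro powr_of_real) auto
    also have "sin \<zeta> powr (- (1/2)) = 1 / sqrt (sin \<zeta>)"
      unfolding powr_minus_divide using sinpos by (simp add: powr_half_sqrt)
    finally have "of_real (sqrt (2 / pi)) * ?s powr \<mu> * ?s powr (- \<mu> - 1/2) = of_real (sqrt (2 / pi) * (1 / sqrt (sin \<zeta>)))"
      by (simp only: of_real_mult mult.assoc)
    also have "sqrt (2 / pi) * (1 / sqrt (sin \<zeta>)) = sqrt (2 / (pi * sin \<zeta>))"
      by (simp add: real_sqrt_divide real_sqrt_mult)
    finally show ?thesis .
  qed
  have "ferrers_P \<nu> \<mu> (cos \<zeta>) = of_real (sqrt (2 / pi)) * ?s powr \<mu> * rGamma (1/2 - \<mu>) / 2 *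
     (\<i> * (exp (- (\<i> * ?a)) * ?s powr (- \<mu> - 1/2) * ?E (-1) - exp (\<i> * ?a) * ?s powr (- \<mu> - 1/2) * ?E 1))"
    using mehler_dirichlet[OF \<zeta>, of \<mu> \<nu>] \<mu> unfolding I Wp Wm by simp
  also have "\<dots> = (of_real (sqrt (2 / pi)) * ?s powr \<mu> * ?s powr (- \<mu> - 1/2)) * rGamma (1/2 - \<mu>) / 2 *
     (- \<i> * exp (\<i> * ?a) * ?E 1 + \<i> * exp (- (\<i> * ?a)) * ?E (-1))"
    by (simp add: algebra_simps)
  finally show ?thesis unfolding s e[symmetric] by (simp add: ferrers_wave_def)
qed

lemma ferrers_argument_bounds:
  assumes "0 < \<zeta>" "\<zeta> < pi"
  shows "norm (complex_of_real ((1 - cos \<zeta>) / 2)) < 1"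
  unfolding ferrers_P_argument(1)[OF assms] norm_of_real using ferrers_P_argument(3)[OF assms] by simp

lemma ferrers_wave_holomorphic:
  assumes "open S" "m holomorphic_on S" "n holomorphic_on S"
    "\<And>z. z \<in> S \<Longrightarrow> Re (m z) < 1/2" "\<And>z. z \<in> S \<Longrightarrow> Re (n z) + Re (m z) > -1"
  shows "(\<lambda>z. ferrers_wave \<sigma> \<zeta> (m z) (n z)) holomorphic_on S"
  unfolding ferrers_wave_def ferrers_beta_def using assms
  by (intro holomorphic_intros euler_integral_holomorphic) force+

lemma ferrers_P_holomorphic:
  assumes "0 < \<zeta>" "\<zeta> < pi" "open S" "m holomorphic_on S" "n holomorphic_on S"
  shows "(\<lambda>z. ferrers_P (n z) (m z) (cos \<zeta>)) holomorphic_on S"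
  unfolding ferrers_P_def using assms
  by (intro holomorphic_intros hyp2F1_reg_holomorphic ferrers_argument_bounds) auto

lemma open_connected_strip: "open {z. a < Re z \<and> Re z < b}" "connected {z. a < Re z \<and> Re z < b}"
proof -
  have "{z. a < Re z \<and> Re z < b} = {z. a < Re z} \<inter> {z. Re z < b}" by auto
  moreover have "convex ({z. a < Re z} \<inter> {z. Re z < b})"
    by (intro convex_Int convex_halfspace_Re_gt convex_halfspace_Re_lt)
  ultimately show "open {z. a < Re z \<and> Re z < b}" "connected {z. a < Re z \<and> Re z < b}"
    by (simp_all add: open_Int open_halfspace_Re_gt open_halfspace_Re_lt convex_connected)
qed

lemma open_connected_halfplane: "open {z. a < Re z}" "connected {z. a < Re z}"
  by (simp_all add: open_halfspace_Re_gt convex_halfspace_Re_gt convex_connected)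

text \<open>\<open>ferrers_P_eq_waves_left\<close> covers -Re \<nu> - 1 < Re \<mu> < -1/2, a
  nonempty strip only when Re \<nu> > -1/2. For such \<nu> the identity is continued in \<mu> up to
  Re \<mu> = 1/2; the other \<nu> are then reached with \<mu> held fixed.\<close>

lemma ferrers_P_eq_waves:
  assumes \<zeta>: "0 < \<zeta>" "\<zeta> < pi" and \<mu>: "Re \<mu> < 1/2" and \<nu>: "Re \<nu> + Re \<mu> > -1"
  shows "ferrers_P \<nu> \<mu> (cos \<zeta>) = of_real (sqrt (2 / (pi * sin \<zeta>))) * rGamma (1/2 - \<mu>) / 2 *
    (ferrers_wave 1 \<zeta> \<mu> \<nu> + ferrers_wave (-1) \<zeta> \<mu> \<nu>)"
proof -
  let ?R = "\<lambda>\<mu> \<nu>. of_real (sqrt (2 / (pi * sin \<zeta>))) * rGamma (1/2 - \<mu>) / 2 *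
    (ferrers_wave 1 \<zeta> \<mu> \<nu> + ferrers_wave (-1) \<zeta> \<mu> \<nu>)"
  have *: "ferrers_P \<nu> \<mu> (cos \<zeta>) = ?R \<mu> \<nu>" if \<mu>: "Re \<mu> < 1/2" and \<nu>: "Re \<nu> + Re \<mu> > -1" "Re \<nu> > - 1/2" for \<mu> \<nu>
  proof (rule analytic_continuation_open[where f="\<lambda>\<mu>. ferrers_P \<nu> \<mu> (cos \<zeta>)" and g="\<lambda>\<mu>. ?R \<mu> \<nu>"
        and s="{\<mu>. - Re \<nu> - 1 < Re \<mu> \<and> Re \<mu> < - 1/2}" and s'="{\<mu>. - Re \<nu> - 1 < Re \<mu> \<and> Re \<mu> < 1/2}"])
    have "of_real ((- Re \<nu> - 3/2) / 2) \<in> {\<mu>. - Re \<nu> - 1 < Re \<mu> \<and> Re \<mu> < - 1/2}" using \<nu> by (simp add: field_simps)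
    then show "{\<mu>. - Re \<nu> - 1 < Re \<mu> \<and> Re \<mu> < - 1/2} \<noteq> {}" by blast
    show "(\<lambda>\<mu>. ferrers_P \<nu> \<mu> (cos \<zeta>)) holomorphic_on {\<mu>. - Re \<nu> - 1 < Re \<mu> \<and> Re \<mu> < 1/2}"
      by (intro ferrers_P_holomorphic \<zeta> open_connected_strip holomorphic_intros)
    show "(\<lambda>\<mu>. ?R \<mu> \<nu>) holomorphic_on {\<mu>. - Re \<nu> - 1 < Re \<mu> \<and> Re \<mu> < 1/2}"
      by (intro holomorphic_intros ferrers_wave_holomorphic open_connected_strip) auto
    show "ferrers_P \<nu> z (cos \<zeta>) = ?R z \<nu>" if "z \<in> {\<mu>. - Re \<nu> - 1 < Re \<mu> \<and> Re \<mu> < - 1/2}" for z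
      using that by (intro ferrers_P_eq_waves_left \<zeta>) auto
  qed (rule open_connected_strip | use \<mu> \<nu> in force)+
  show ?thesis
  proof (rule analytic_continuation_open[where f="\<lambda>\<nu>. ferrers_P \<nu> \<mu> (cos \<zeta>)" and g="\<lambda>\<nu>. ?R \<mu> \<nu>"
        and s="{\<nu>. max (- Re \<mu> - 1) (- 1/2) < Re \<nu>}" and s'="{\<nu>. - Re \<mu> - 1 < Re \<nu>}"])
    have "of_real (max (- Re \<mu> - 1) (- 1/2) + 1) \<in> {\<nu>. max (- Re \<mu> - 1) (- 1/2) < Re \<nu>}" by (simp add: max_def)
    then show "{\<nu>. max (- Re \<mu> - 1) (- 1/2) < Re \<nu>} \<noteq> {}" by blast
    show "(\<lambda>\<nu>. ferrers_P \<nu> \<mu> (cos \<zeta>)) holomorphic_on {\<nu>. - Re \<mu> - 1 < Re \<nu>}"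
      by (intro ferrers_P_holomorphic \<zeta> open_connected_halfplane holomorphic_intros)
    show "(\<lambda>\<nu>. ?R \<mu> \<nu>) holomorphic_on {\<nu>. - Re \<mu> - 1 < Re \<nu>}"
      using \<mu> by (intro holomorphic_intros ferrers_wave_holomorphic open_connected_halfplane) auto
    show "ferrers_P z \<mu> (cos \<zeta>) = ?R \<mu> z" if "z \<in> {\<nu>. max (- Re \<mu> - 1) (- 1/2) < Re \<nu>}" for z
      using that \<mu> by (intro *) auto
  qed (rule open_connected_halfplane | use \<mu> \<nu> in force)+
qed

section \<open>Q as a difference of the same waves\<close>

text \<open>The bracket of \<open>ferrers_Q_nonint\<close> without the prefactor
  \<open>pi / (2 * sin (pi * \<mu>))\<close>. Being free of that division, it is holomorphic across
  integer \<open>\<mu>\<close> and can be continued.\<close>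

definition ferrers_Q_num :: "real \<Rightarrow> complex \<Rightarrow> complex \<Rightarrow> complex" where
  "ferrers_Q_num x \<mu> \<nu> = cos (of_real pi * \<mu>) * ferrers_P \<nu> \<mu> x -
     Gamma (\<nu> + \<mu> + 1) * rGamma (\<nu> - \<mu> + 1) * ferrers_P \<nu> (- \<mu>) x"

text \<open>In this region \<open>ferrers_P_eq_waves\<close> applies to both \<open>\<mu>\<close>
  and \<open>- \<mu>\<close>. By \<open>euler_integral_symmetric\<close> the two share the quantity
  \<open>A\<close>, and only the phase changes, by -pi \<mu>. The differences cos (pi \<mu>) - exp
  (-i pi \<mu>) and cos (pi \<mu>) - exp (i pi \<mu>) equal i sin (pi \<mu>) and -i sin (pi \<mu>),
  which turns the sum of waves into a difference.\<close>

lemma ferrers_Q_num_strip: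
  assumes \<zeta>: "0 < \<zeta>" "\<zeta> < pi" and \<mu>: "\<bar>Re \<mu>\<bar> < 1/2" and \<nu>: "Re \<nu> > \<bar>Re \<mu>\<bar> - 1"
  shows "ferrers_Q_num (cos \<zeta>) \<mu> \<nu> = sin (of_real pi * \<mu>) * (\<i> * of_real (sqrt (2 / (pi * sin \<zeta>))) *
     rGamma (1/2 - \<mu>) / 2 * (ferrers_wave 1 \<zeta> \<mu> \<nu> - ferrers_wave (-1) \<zeta> \<mu> \<nu>))"
proof -
  define A where "A \<sigma> = rGamma (1/2 - \<mu>) * rGamma (\<nu> + \<mu> + 1) *
      euler_integral (- 1/2 - \<mu>) (\<nu> + \<mu>) (- 1/2 - \<mu>) (ferrers_w \<sigma> \<zeta>)" for \<sigma>
  let ?c = "complex_of_real (sqrt (2 / (pi * sin \<zeta>)))"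
  let ?b = "ferrers_beta \<zeta> \<mu> \<nu> 0"
  have G: "Gamma (\<nu> + \<mu> + 1) * rGamma (\<nu> + \<mu> + 1) = 1" "Gamma (\<nu> - \<mu> + 1) * rGamma (\<nu> - \<mu> + 1) = 1"
    using \<mu> \<nu> by (auto intro!: Gamma_times_rGamma)
  have w1: "rGamma (1/2 - \<mu>) * ferrers_wave \<sigma> \<zeta> \<mu> \<nu> = Gamma (\<nu> + \<mu> + 1) * (exp (\<i> * of_real \<sigma> * ?b) * A \<sigma>)" for \<sigma>
  proof -
    have "Gamma (\<nu> + \<mu> + 1) * (exp (\<i> * of_real \<sigma> * ?b) * A \<sigma>) =
       (Gamma (\<nu> + \<mu> + 1) * rGamma (\<nu> + \<mu> + 1)) * (rGamma (1/2 - \<mu>) * ferrers_wave \<sigma> \<zeta> \<mu> \<nu>)"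
      by (simp only: A_def ferrers_wave_def mult_ac)
    then show ?thesis by (simp only: G mult_1_left)
  qed
  have beta: "ferrers_beta \<zeta> (- \<mu>) \<nu> 0 = ?b - of_real pi * \<mu>"
    by (simp add: ferrers_beta_def algebra_simps)
  have w2: "rGamma (\<nu> - \<mu> + 1) * (rGamma (1/2 - (- \<mu>)) * ferrers_wave \<sigma> \<zeta> (- \<mu>) \<nu>) =
      exp (\<i> * of_real \<sigma> * (?b - of_real pi * \<mu>)) * A \<sigma>" for \<sigma>
  proof -
    have "A \<sigma> = rGamma (1/2 + \<mu>) * rGamma (\<nu> - \<mu> + 1) *
        euler_integral (- 1/2 + \<mu>) (\<nu> - \<mu>) (- 1/2 + \<mu>) (ferrers_w \<sigma> \<zeta>)"
      unfolding A_def by (rule euler_integral_symmetric[OF \<mu> \<nu>]) simp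
    moreover have "- 1/2 - (- \<mu>) = - 1/2 + \<mu>" "\<nu> + - \<mu> = \<nu> - \<mu>" "1/2 - (- \<mu>) = 1/2 + \<mu>" by simp_all
    ultimately show ?thesis unfolding ferrers_wave_def beta by (simp only: mult_ac)
  qed
  have "ferrers_Q_num (cos \<zeta>) \<mu> \<nu> = ?c / 2 *
     (cos (of_real pi * \<mu>) * (rGamma (1/2 - \<mu>) * ferrers_wave 1 \<zeta> \<mu> \<nu> + rGamma (1/2 - \<mu>) * ferrers_wave (-1) \<zeta> \<mu> \<nu>) -
      Gamma (\<nu> + \<mu> + 1) * (rGamma (\<nu> - \<mu> + 1) * (rGamma (1/2 - (- \<mu>)) * ferrers_wave 1 \<zeta> (- \<mu>) \<nu>) +
        rGamma (\<nu> - \<mu> + 1) * (rGamma (1/2 - (- \<mu>)) * ferrers_wave (-1) \<zeta> (- \<mu>) \<nu>)))"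
  proof -
    have "ferrers_P \<nu> \<mu> (cos \<zeta>) = ?c * rGamma (1/2 - \<mu>) / 2 * (ferrers_wave 1 \<zeta> \<mu> \<nu> + ferrers_wave (-1) \<zeta> \<mu> \<nu>)"
      using \<mu> \<nu> by (intro ferrers_P_eq_waves \<zeta>) auto
    moreover have "ferrers_P \<nu> (- \<mu>) (cos \<zeta>) =
        ?c * rGamma (1/2 - (- \<mu>)) / 2 * (ferrers_wave 1 \<zeta> (- \<mu>) \<nu> + ferrers_wave (-1) \<zeta> (- \<mu>) \<nu>)"
      using \<mu> \<nu> by (intro ferrers_P_eq_waves \<zeta>) auto
    ultimately show ?thesis
      unfolding ferrers_Q_num_def by (simp add: algebra_simps add_divide_distrib)
  qed
  also have "\<dots> = ?c / 2 * Gamma (\<nu> + \<mu> + 1) *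
     (exp (\<i> * ?b) * A 1 * (cos (of_real pi * \<mu>) - exp (- (\<i> * (of_real pi * \<mu>)))) +
      exp (- (\<i> * ?b)) * A (-1) * (cos (of_real pi * \<mu>) - exp (\<i> * (of_real pi * \<mu>))))"
  proof -
    have "exp (\<i> * of_real 1 * (?b - of_real pi * \<mu>)) = exp (\<i> * ?b) * exp (- (\<i> * (of_real pi * \<mu>)))"
      "exp (\<i> * of_real (-1) * (?b - of_real pi * \<mu>)) = exp (- (\<i> * ?b)) * exp (\<i> * (of_real pi * \<mu>))"
      by (simp_all add: right_diff_distrib flip: exp_add)
    moreover have "exp (\<i> * of_real 1 * ?b) = exp (\<i> * ?b)" "exp (\<i> * of_real (-1) * ?b) = exp (- (\<i> * ?b))"
      by simp_all
    moreover have "c * (C * (G * (e1 * a1) + G * (e2 * a2)) - G * (e1 * m * a1 + e2 * p * a2)) =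
       c * G * (e1 * a1 * (C - m) + e2 * a2 * (C - p))" for c C G e1 e2 a1 a2 m p :: complex
      by (simp add: algebra_simps)
    ultimately show ?thesis unfolding w1 w2 by (simp only:)
  qed
  also have "cos (of_real pi * \<mu>) - exp (- (\<i> * (of_real pi * \<mu>))) = \<i> * sin (of_real pi * \<mu>)"
    unfolding cos_exp_eq sin_exp_eq by (simp add: field_simps)
  also have "cos (of_real pi * \<mu>) - exp (\<i> * (of_real pi * \<mu>)) = - \<i> * sin (of_real pi * \<mu>)"
    unfolding cos_exp_eq sin_exp_eq by (simp add: field_simps)
  also have "?c / 2 * Gamma (\<nu> + \<mu> + 1) * (exp (\<i> * ?b) * A 1 * (\<i> * sin (of_real pi * \<mu>)) +
      exp (- (\<i> * ?b)) * A (-1) * (- \<i> * sin (of_real pi * \<mu>))) = 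
      sin (of_real pi * \<mu>) * (\<i> * ?c / 2 * (Gamma (\<nu> + \<mu> + 1) * (exp (\<i> * of_real 1 * ?b) * A 1) -
       Gamma (\<nu> + \<mu> + 1) * (exp (\<i> * of_real (-1) * ?b) * A (-1))))"
    by (simp add: algebra_simps)
  finally show ?thesis unfolding w1[symmetric] by (simp add: algebra_simps)
qed

text \<open>For |Re \<mu>| < 1/2 a continuation in \<nu> relaxes Re \<nu> > |Re \<mu>| - 1 to Re
  \<nu> > -Re \<mu> - 1. If Re \<mu> \<le> -1/2, then Re \<nu> > -1/2, so for this fixed \<nu> the
  whole strip |Re \<mu>| < 1/2 is available as the start of a continuation in \<mu>.\<close>

lemma ferrers_Q_num_eq_waves:
  assumes \<zeta>: "0 < \<zeta>" "\<zeta> < pi" and \<mu>: "Re \<mu> < 1/2" and \<nu>: "Re \<nu> + Re \<mu> > -1"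
  shows "ferrers_Q_num (cos \<zeta>) \<mu> \<nu> = sin (of_real pi * \<mu>) * (\<i> * of_real (sqrt (2 / (pi * sin \<zeta>))) *
     rGamma (1/2 - \<mu>) / 2 * (ferrers_wave 1 \<zeta> \<mu> \<nu> - ferrers_wave (-1) \<zeta> \<mu> \<nu>))"
proof -
  let ?R = "\<lambda>\<mu> \<nu>. sin (of_real pi * \<mu>) * (\<i> * of_real (sqrt (2 / (pi * sin \<zeta>))) *
     rGamma (1/2 - \<mu>) / 2 * (ferrers_wave 1 \<zeta> \<mu> \<nu> - ferrers_wave (-1) \<zeta> \<mu> \<nu>))"
  have hol: "(\<lambda>z. ferrers_Q_num (cos \<zeta>) (m z) (n z)) holomorphic_on S" "(\<lambda>z. ?R (m z) (n z)) holomorphic_on S"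
    if "open S" "m holomorphic_on S" "n holomorphic_on S"
      "\<And>z. z \<in> S \<Longrightarrow> Re (m z) < 1/2" "\<And>z. z \<in> S \<Longrightarrow> Re (n z) + Re (m z) > -1" for m n S
  proof -
    have "n z + m z + 1 \<notin> \<int>\<^sub>\<le>\<^sub>0" if "z \<in> S" for z
      using that \<open>\<And>z. z \<in> S \<Longrightarrow> Re (n z) + Re (m z) > -1\<close>[of z] by (intro not_nonpos_Ints_if_Re_pos) auto
    then show "(\<lambda>z. ferrers_Q_num (cos \<zeta>) (m z) (n z)) holomorphic_on S"
      unfolding ferrers_Q_num_def using that
      by (intro holomorphic_intros ferrers_P_holomorphic \<zeta>) auto
    show "(\<lambda>z. ?R (m z) (n z)) holomorphic_on S"
      using that by (intro holomorphic_intros ferrers_wave_holomorphic) auto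
  qed
  have *: "ferrers_Q_num (cos \<zeta>) \<mu> \<nu> = ?R \<mu> \<nu>" if \<mu>: "\<bar>Re \<mu>\<bar> < 1/2" and \<nu>: "Re \<nu> + Re \<mu> > -1" for \<mu> \<nu>
  proof (rule analytic_continuation_open[where f="\<lambda>\<nu>. ferrers_Q_num (cos \<zeta>) \<mu> \<nu>" and g="\<lambda>\<nu>. ?R \<mu> \<nu>"
        and s="{\<nu>. \<bar>Re \<mu>\<bar> - 1 < Re \<nu>}" and s'="{\<nu>. - Re \<mu> - 1 < Re \<nu>}"])
    have "of_real (\<bar>Re \<mu>\<bar>) \<in> {\<nu>. \<bar>Re \<mu>\<bar> - 1 < Re \<nu>}" by simp
    then show "{\<nu>. \<bar>Re \<mu>\<bar> - 1 < Re \<nu>} \<noteq> {}" by blast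
    show "ferrers_Q_num (cos \<zeta>) \<mu> z = ?R \<mu> z" if "z \<in> {\<nu>. \<bar>Re \<mu>\<bar> - 1 < Re \<nu>}" for z
      using that \<mu> by (intro ferrers_Q_num_strip \<zeta>) auto
    show "(\<lambda>\<nu>. ferrers_Q_num (cos \<zeta>) \<mu> \<nu>) holomorphic_on {\<nu>. - Re \<mu> - 1 < Re \<nu>}"
      using \<mu> by (intro hol(1) open_connected_halfplane holomorphic_intros) auto
    show "(\<lambda>\<nu>. ?R \<mu> \<nu>) holomorphic_on {\<nu>. - Re \<mu> - 1 < Re \<nu>}"
      using \<mu> by (intro hol(2) open_connected_halfplane holomorphic_intros) auto
  qed (rule open_connected_halfplane | use \<mu> \<nu> in force)+
  show ?thesis
  proof (cases "Re \<mu> > - 1/2")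
    case True
    then show ?thesis using \<mu> \<nu> by (intro *) auto
  next
    case False
    show ?thesis
    proof (rule analytic_continuation_open[where f="\<lambda>\<mu>. ferrers_Q_num (cos \<zeta>) \<mu> \<nu>" and g="\<lambda>\<mu>. ?R \<mu> \<nu>"
          and s="{\<mu>. - 1/2 < Re \<mu> \<and> Re \<mu> < 1/2}" and s'="{\<mu>. - Re \<nu> - 1 < Re \<mu> \<and> Re \<mu> < 1/2}"])
      have "0 \<in> {\<mu>. - 1/2 < Re \<mu> \<and> Re \<mu> < 1/2}" by simp
      then show "{\<mu>. - 1/2 < Re \<mu> \<and> Re \<mu> < 1/2} \<noteq> {}" by blast
      show "ferrers_Q_num (cos \<zeta>) z \<nu> = ?R z \<nu>" if "z \<in> {\<mu>. - 1/2 < Re \<mu> \<and> Re \<mu> < 1/2}" for z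
        using that False \<nu> by (intro *) auto
      show "(\<lambda>\<mu>. ferrers_Q_num (cos \<zeta>) \<mu> \<nu>) holomorphic_on {\<mu>. - Re \<nu> - 1 < Re \<mu> \<and> Re \<mu> < 1/2}"
        by (intro hol(1) open_connected_strip holomorphic_intros) auto
      show "(\<lambda>\<mu>. ?R \<mu> \<nu>) holomorphic_on {\<mu>. - Re \<nu> - 1 < Re \<mu> \<and> Re \<mu> < 1/2}"
        by (intro hol(2) open_connected_strip holomorphic_intros) auto
    qed (rule open_connected_strip | use \<mu> \<nu> False in force)+
  qed
qed

lemma sin_pi_mult_eq_0_iff: "sin (complex_of_real pi * z) = 0 \<longleftrightarrow> z \<in> \<int>"
proof
  assume "sin (complex_of_real pi * z) = 0"
  then obtain n :: int where "complex_of_real pi * z = of_real (of_int n * pi)"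
    unfolding sin_eq_0 by blast
  then show "z \<in> \<int>" by (simp add: mult.commute)
next
  assume "z \<in> \<int>"
  then show "sin (complex_of_real pi * z) = 0" by (auto elim!: Ints_cases simp: sin_eq_0)
qed

text \<open>Off the integers sin (pi \<mu>) can be divided out. At an integer the right-hand side is
  continuous and agrees with \<open>ferrers_Q_nonint\<close> on a punctured neighbourhood, so it is
  the limit in the definition of \<open>ferrers_Q\<close>.\<close>

lemma ferrers_Q_eq_waves:
  assumes \<zeta>: "0 < \<zeta>" "\<zeta> < pi" and \<mu>: "Re \<mu> < 1/2" and \<nu>: "Re \<nu> + Re \<mu> > -1"
  shows "ferrers_Q \<nu> \<mu> (cos \<zeta>) = \<i> * of_real (sqrt (pi / (2 * sin \<zeta>))) * rGamma (1/2 - \<mu>) / 2 *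
    (ferrers_wave 1 \<zeta> \<mu> \<nu> - ferrers_wave (-1) \<zeta> \<mu> \<nu>)"
proof -
  let ?R = "\<lambda>\<mu>. \<i> * of_real (sqrt (pi / (2 * sin \<zeta>))) * rGamma (1/2 - \<mu>) / 2 *
    (ferrers_wave 1 \<zeta> \<mu> \<nu> - ferrers_wave (-1) \<zeta> \<mu> \<nu>)"
  let ?S = "{\<mu>. - Re \<nu> - 1 < Re \<mu> \<and> Re \<mu> < 1/2}"
  have sinpos: "sin \<zeta> > 0" using \<zeta> by (simp add: sin_gt_zero)
  have cos1: "cos \<zeta> < 1" "- 1 < cos \<zeta>"
    using \<zeta> cos_monotone_0_pi[of 0 \<zeta>] cos_monotone_0_pi[of \<zeta> pi] by simp_all
  have nonint: "ferrers_Q_nonint \<nu> m (cos \<zeta>) = ?R m" if m: "m \<in> ?S" "m \<notin> \<int>" for m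
  proof -
    have s0: "sin (of_real pi * m) \<noteq> 0" using m sin_pi_mult_eq_0_iff by blast
    have "complex_of_real ((1 - cos \<zeta>) / (1 + cos \<zeta>)) powr (m / 2) =
        complex_of_real ((1 + cos \<zeta>) / (1 - cos \<zeta>)) powr (- m / 2)"
      using cos1 by (subst (1 2) powr_pos_real) (auto simp: ln_div algebra_simps)
    then have "ferrers_Q_nonint \<nu> m (cos \<zeta>) = of_real pi / (2 * sin (of_real pi * m)) * ferrers_Q_num (cos \<zeta>) m \<nu>"
      unfolding ferrers_Q_nonint_def ferrers_Q_num_def ferrers_P_def by (simp add: mult_ac)
    also have "\<dots> = of_real pi / 2 * (\<i> * of_real (sqrt (2 / (pi * sin \<zeta>))) *
     rGamma (1/2 - m) / 2 * (ferrers_wave 1 \<zeta> m \<nu> - ferrers_wave (-1) \<zeta> m \<nu>))"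
      using s0 m by (subst ferrers_Q_num_eq_waves[OF \<zeta>]) auto
    also have "\<dots> = \<i> * of_real (pi / 2 * sqrt (2 / (pi * sin \<zeta>))) * rGamma (1/2 - m) / 2 * (ferrers_wave 1 \<zeta> m \<nu> - ferrers_wave (-1) \<zeta> m \<nu>)"
      by simp
    also have "pi / 2 * sqrt (2 / (pi * sin \<zeta>)) = sqrt (pi / (2 * sin \<zeta>))"
    proof -
      have "pi / 2 * sqrt (2 / (pi * sin \<zeta>)) = sqrt ((pi / 2)\<^sup>2 * (2 / (pi * sin \<zeta>)))"
        by (simp only: real_sqrt_mult) simp
      also have "(pi / 2)\<^sup>2 * (2 / (pi * sin \<zeta>)) = pi / (2 * sin \<zeta>)"
        using sinpos by (simp add: power2_eq_square field_simps)
      finally show ?thesis .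
    qed
    finally show ?thesis .
  qed
  show ?thesis
  proof (cases "\<mu> \<in> \<int>")
    case False
    then show ?thesis using nonint \<mu> \<nu> by (simp add: ferrers_Q_def)
  next
    case True
    have hol: "?R holomorphic_on ?S"
      by (intro holomorphic_intros ferrers_wave_holomorphic open_connected_strip) auto
    have "\<mu> \<in> ?S" using \<mu> \<nu> by auto
    then have "isCont ?R \<mu>"
      using holomorphic_on_imp_continuous_on[OF hol] continuous_on_eq_continuous_at[OF open_connected_strip(1)] by blast
    then have "(?R \<longlongrightarrow> ?R \<mu>) (at \<mu>)" unfolding isCont_def .
    moreover have "\<forall>\<^sub>F m in at \<mu>. ?R m = ferrers_Q_nonint \<nu> m (cos \<zeta>)"
    proof -
      have "\<forall>\<^sub>F m in at \<mu>. m \<in> ?S"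
        using \<mu> \<nu> by (intro eventually_at_in_open' open_connected_strip) auto
      moreover have "\<forall>\<^sub>F m in at \<mu>. m \<in> ball \<mu> 1 - {\<mu>}" by (intro eventually_at_in_open) auto
      ultimately show ?thesis
      proof eventually_elim
        case (elim m)
        have "m \<notin> \<int>"
        proof
          assume "m \<in> \<int>"
          then obtain i j :: int where "m = of_int i" "\<mu> = of_int j" using True by (auto elim!: Ints_cases)
          then have "norm (complex_of_int (j - i)) < 1" "i \<noteq> j" using elim by (auto simp: dist_norm)
          then have "\<bar>j - i\<bar> < 1" unfolding norm_of_int by linarith
          with \<open>i \<noteq> j\<close> show False by simp
        qed
        then show ?case using nonint[of m] elim by simp
      qed
    qed
    ultimately have "((\<lambda>m. ferrers_Q_nonint \<nu> m (cos \<zeta>)) \<longlongrightarrow> ?R \<mu>) (at \<mu>)"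
      by (rule Lim_transform_eventually)
    then have "Lim (at \<mu>) (\<lambda>m. ferrers_Q_nonint \<nu> m (cos \<zeta>)) = ?R \<mu>" by (intro tendsto_Lim) auto
    then show ?thesis using True by (simp add: ferrers_Q_def)
  qed
qed

section \<open>The remainders and their bounds\<close>

lemma a_coeff_pochhammer:
  "a_coeff n \<mu> = pochhammer (1/2 + \<mu>) n * pochhammer (1/2 - \<mu>) n / ((- 2) ^ n * fact n)"
proof -
  have "(\<Prod>k=1..n. 4 * \<mu>\<^sup>2 - (2 * of_nat k - 1)\<^sup>2) = (- 4) ^ n * (pochhammer (1/2 + \<mu>) n * pochhammer (1/2 - \<mu>) n)"
  proof (induction n)
    case (Suc n)
    have "4 * \<mu>\<^sup>2 - (2 * of_nat (Suc n) - 1)\<^sup>2 = (- 4) * ((1/2 + \<mu> + of_nat n) * (1/2 - \<mu> + of_nat n))"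
      by (simp add: field_simps power2_eq_square)
    then show ?case using Suc by (simp add: pochhammer_Suc mult_ac)
  qed simp
  moreover have "(8::'a) ^ n = (- 4) ^ n * (- 2) ^ n" by (simp flip: power_mult_distrib)
  ultimately show ?thesis by (simp add: a_coeff_def)
qed

text \<open>Each Pochhammer symbol is a Gamma value times a reciprocal Gamma value, and the two
  reciprocals multiply to cos (pi t) / pi by reflection. In the given range the other Gamma values
  are positive, so \<open>a_coeff k\<close> and the cosine have the same zeros and their quotient
  extends continuously.\<close>

lemma abs_a_coeff:
  fixes t :: real
  assumes "\<bar>t\<bar> < real k + 1/2"
  shows "\<bar>a_coeff k t\<bar> = Gamma (real k + 1/2 - t) * Gamma (real k + 1/2 + t) / (2 ^ k * fact k * pi) * \<bar>cos (pi * t)\<bar>"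
proof -
  \<comment> \<open>\<open>z\<close> itself may be a pole of Gamma, hence \<open>rGamma z\<close>
    instead of a division by \<open>Gamma z\<close>; only \<open>z + real k\<close> has to be
    positive.\<close>
  have poch: "\<bar>pochhammer z k\<bar> = Gamma (z + real k) * \<bar>rGamma z\<bar>" if "z + real k > 0" for z :: real
  proof -
    have "Gamma (z + real k) > 0" using that by (rule Gamma_real_pos)
    moreover from this have "pochhammer z k = Gamma (z + real k) * rGamma z"
      using pochhammer_rGamma[of z k] by (simp add: rGamma_inverse_Gamma[of "z + real k"] field_simps)
    ultimately show ?thesis by (simp add: abs_mult)
  qed
  have "complex_of_real (rGamma (1/2 + t) * rGamma (1/2 - t)) = of_real (cos (pi * t) / pi)"
  proof -
    have "complex_of_real (rGamma (1/2 + t) * rGamma (1/2 - t)) = rGamma (of_real (1/2 + t)) * rGamma (1 - of_real (1/2 + t))"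
      by (simp flip: rGamma_complex_of_real)
    also have "\<dots> = of_real (sin (pi * (1/2 + t)) / pi)"
      unfolding rGamma_reflection_complex by (simp flip: sin_of_real)
    also have "sin (pi * (1/2 + t)) = cos (pi * t)"
      by (simp add: distrib_left sin_add)
    finally show ?thesis .
  qed
  then have "rGamma (1/2 + t) * rGamma (1/2 - t) = cos (pi * t) / pi" using of_real_eq_iff by blast
  then have refl: "\<bar>rGamma (1/2 + t)\<bar> * \<bar>rGamma (1/2 - t)\<bar> = \<bar>cos (pi * t)\<bar> / pi"
    by (simp flip: abs_mult)
  have "\<bar>a_coeff k t\<bar> = \<bar>pochhammer (1/2 + t) k\<bar> * \<bar>pochhammer (1/2 - t) k\<bar> / (2 ^ k * fact k)"
    unfolding a_coeff_pochhammer by (simp add: abs_mult power_abs)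
  also have "\<dots> = Gamma (1/2 + t + real k) * Gamma (1/2 - t + real k) * (\<bar>rGamma (1/2 + t)\<bar> * \<bar>rGamma (1/2 - t)\<bar>) / (2 ^ k * fact k)"
    using assms by (subst (1 2) poch) auto
  finally show ?thesis unfolding refl by (simp add: algebra_simps)
qed

text \<open>The Gamma product from \<open>abs_a_coeff\<close> is continuous at \<open>x\<close>, so
  the quotient and its limiting value are given by one formula. Zeros of cos (pi t) are 1 apart, so
  a punctured ball of radius 1/2 about a zero contains no other.\<close>

lemma abs_a_over_cos_eq:
  fixes x :: real
  assumes x: "\<bar>x\<bar> < real k + 1/2"
  shows "abs_a_over_cos k x = Gamma (real k + 1/2 - x) * Gamma (real k + 1/2 + x) / (2 ^ k * fact k * pi)"
proof -
  let ?g = "\<lambda>t. Gamma (real k + 1/2 - t) * Gamma (real k + 1/2 + t) / (2 ^ k * fact k * pi)"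
  have cos0: "cos (pi * t) = 0 \<longleftrightarrow> (\<exists>m::int. odd m \<and> 2 * t = of_int m)" for t :: real
    unfolding cos_zero_iff_int by (auto simp: field_simps)
  have eq: "\<bar>a_coeff k t\<bar> / \<bar>cos (pi * t)\<bar> = ?g t" if "\<bar>t\<bar> < real k + 1/2" "cos (pi * t) \<noteq> 0" for t
    using abs_a_coeff[OF that(1)] that(2) by simp
  show ?thesis
  proof (cases "\<exists>m::int. odd m \<and> 2 * x = of_int m")
    case False
    then show ?thesis using eq[OF x] cos0[of x] unfolding abs_a_over_cos_def by (simp only: if_False simp_thms)
  next
    case True
    then obtain m :: int where m: "odd m" "2 * x = of_int m" by blast
    have "isCont ?g x"
    proof (intro continuous_intros)
      show "real k + 1/2 - x \<notin> \<int>\<^sub>\<le>\<^sub>0" "real k + 1/2 + x \<notin> \<int>\<^sub>\<le>\<^sub>0"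
        using x by (auto elim!: nonpos_Ints_cases)
    qed auto
    then have "(?g \<longlongrightarrow> ?g x) (at x)" by (simp add: isCont_def)
    moreover have "\<forall>\<^sub>F t in at x. ?g t = \<bar>a_coeff k t\<bar> / \<bar>cos (pi * t)\<bar>"
    proof -
      have "\<forall>\<^sub>F t in at x. t \<in> {- (real k + 1/2)<..<real k + 1/2}"
        using x by (intro eventually_at_in_open') auto
      moreover have "\<forall>\<^sub>F t in at x. t \<in> ball x (1/2) - {x}" by (intro eventually_at_in_open) auto
      ultimately show ?thesis
      proof eventually_elim
        case (elim t)
        have "cos (pi * t) \<noteq> 0"
        proof
          assume "cos (pi * t) = 0"
          then obtain j :: int where j: "2 * t = of_int j" using cos0 by blast
          have "\<bar>x - t\<bar> < 1/2" using elim by (simp add: dist_real_def)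
          then have "\<bar>2 * t - 2 * x\<bar> < 1" by linarith
          moreover have "2 * t \<noteq> 2 * x" using elim by simp
          ultimately have "\<bar>j - m\<bar> < 1" "j \<noteq> m" unfolding j m by linarith+
          then show False by simp
        qed
        then show ?case using eq[of t] elim by auto
      qed
    qed
    ultimately have "((\<lambda>t. \<bar>a_coeff k t\<bar> / \<bar>cos (pi * t)\<bar>) \<longlongrightarrow> ?g x) (at x)"
      by (rule Lim_transform_eventually)
    then have "Lim (at x) (\<lambda>t. \<bar>a_coeff k t\<bar> / \<bar>cos (pi * t)\<bar>) = ?g x" by (intro tendsto_Lim) auto
    then show ?thesis using True by (simp add: abs_a_over_cos_def)
  qed
qed

section \<open>The expansion with integral remainder\<close>

text \<open>The Euler integral in \<open>binomial_remainder\<close> for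
  \<open>a = 1/2 + \<mu>\<close>, without its power and sine factors.\<close>

definition remainder_inner :: "nat \<Rightarrow> complex \<Rightarrow> complex \<Rightarrow> complex" where
  "remainder_inner N \<mu> z = euler_integral (of_nat N + \<mu> - 1/2) (- 1/2 - \<mu>) (- 1) z"

text \<open>The arguments \<open>0 0\<close> reduce the kernel to a Beta weight. Its first exponent
  is raised by \<open>N\<close> because the binomial remainder carries \<open>(w * t) ^ N\<close>;
  the part \<open>w ^ N\<close> stays outside.\<close>

definition remainder_integral :: "nat \<Rightarrow> complex \<Rightarrow> complex \<Rightarrow> complex \<Rightarrow> complex" where
  "remainder_integral N \<mu> \<nu> w =
     integral {0<..<1} (\<lambda>t. euler_kernel (of_nat N - 1/2 - \<mu>) (\<nu> + \<mu>) 0 0 t * remainder_inner N \<mu> (w * of_real t))"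

lemma remainder_integrand_integrable:
  assumes \<mu>: "- real N - 1/2 < Re \<mu>" "Re \<mu> < 1/2" and \<nu>: "Re \<nu> + Re \<mu> > -1" and w: "Re w < 1"
  shows "(\<lambda>t. euler_kernel (of_nat N - 1/2 - \<mu>) (\<nu> + \<mu>) 0 0 t * remainder_inner N \<mu> (w * of_real t)) integrable_on {0<..<1}"
proof -
  have wt: "Re (w * of_real t) < 1" if "0 \<le> t" "t \<le> 1" for t
    using one_minus_mult_not_nonpos(1)[OF w that] by simp
  have "remainder_inner N \<mu> holomorphic_on {z. Re z < 1}"
    unfolding remainder_inner_def using \<mu>
    by (intro euler_integral_holomorphic holomorphic_intros halfplane_Re_lt_1) auto
  then have cont: "continuous_on {0..1} (\<lambda>t::real. remainder_inner N \<mu> (w * of_real t))"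
    by (rule continuous_on_compose2[OF holomorphic_on_imp_continuous_on])
       (use wt in \<open>auto intro!: continuous_intros\<close>)
  then have "bounded ((\<lambda>t::real. remainder_inner N \<mu> (w * of_real t)) ` {0..1})"
    by (intro compact_imp_bounded compact_continuous_image) auto
  then obtain M where M: "\<And>t. t \<in> {0..1} \<Longrightarrow> norm (remainder_inner N \<mu> (w * of_real t)) \<le> M"
    unfolding bounded_iff by blast
  have "(\<lambda>t. euler_kernel (of_nat N - 1/2 - \<mu>) (\<nu> + \<mu>) 0 0 t * remainder_inner N \<mu> (w * of_real t)) absolutely_integrable_on {0<..<1}"
  proof (rule absolutely_integrable_dominated_by_beta[where a="real N - 1/2 - Re \<mu>" and b="Re \<nu> + Re \<mu>" and M=M])
    show "continuous_on {0<..<1} (\<lambda>t. euler_kernel (of_nat N - 1/2 - \<mu>) (\<nu> + \<mu>) 0 0 t * remainder_inner N \<mu> (w * of_real t))"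
      by (intro continuous_on_mult continuous_on_euler_kernel continuous_on_subset[OF cont]) auto
    fix t :: real assume t: "0 < t" "t < 1"
    have "norm (euler_kernel (of_nat N - 1/2 - \<mu>) (\<nu> + \<mu>) 0 0 t) = t powr (real N - 1/2 - Re \<mu>) * (1 - t) powr (Re \<nu> + Re \<mu>)"
      using t by (simp add: norm_euler_kernel)
    then show "norm (euler_kernel (of_nat N - 1/2 - \<mu>) (\<nu> + \<mu>) 0 0 t * remainder_inner N \<mu> (w * of_real t))
        \<le> M * (t powr (real N - 1/2 - Re \<mu>) * (1 - t) powr (Re \<nu> + Re \<mu>))"
      unfolding norm_mult using M[of t] t by (simp add: mult.commute mult_right_mono)
  qed (use \<mu> \<nu> in auto)
  then show ?thesis by (rule set_lebesgue_integral_eq_integral(1))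
qed

text \<open>\<open>binomial_remainder\<close> is inserted for the factor with \<open>w\<close>; for
  \<open>a = 1/2 + \<mu>\<close> its hypotheses are exactly the range of \<open>Re \<mu>\<close>.
  The Beta values of the finite sum supply the second Pochhammer symbol of \<open>a_coeff\<close>,
  and writing the powers in terms of \<open>- 2 * w\<close> matches its denominator.\<close>

lemma euler_integral_expansion:
  assumes \<mu>: "- real N - 1/2 < Re \<mu>" "Re \<mu> < 1/2" and \<nu>: "Re \<nu> + Re \<mu> > -1" and w: "Re w < 1"
  shows "rGamma (1/2 - \<mu>) * rGamma (\<nu> + \<mu> + 1) * euler_integral (- 1/2 - \<mu>) (\<nu> + \<mu>) (- 1/2 - \<mu>) w =
    (\<Sum>n<N. a_coeff n \<mu> * rGamma (\<nu> + 3/2 + of_nat n) * (- 2 * w) ^ n) +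
    cos (of_real pi * \<mu>) / of_real pi * rGamma (1/2 - \<mu>) * rGamma (\<nu> + \<mu> + 1) * w ^ N * remainder_integral N \<mu> \<nu> w"
proof -
  let ?a = "1/2 + \<mu>" and ?q = "\<nu> + \<mu>"
  let ?c = "\<lambda>n. pochhammer ?a n / fact n * w ^ n"
  let ?k = "\<lambda>n. euler_kernel (- 1/2 - \<mu> + of_nat n) ?q 0 0"
  let ?T = "\<lambda>t. euler_kernel (of_nat N - 1/2 - \<mu>) (\<nu> + \<mu>) 0 0 t * remainder_inner N \<mu> (w * of_real t)"
  let ?s = "w ^ N * (cos (of_real pi * \<mu>) / of_real pi)"
  have kn: "?k n t = of_real t powr (- 1/2 - \<mu>) * of_real (1 - t) powr ?q * of_real t ^ n" if "t \<in> {0<..<1}" for n t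
    using that by (simp add: euler_kernel_def powr_add powr_nat')
  have pt: "euler_kernel (- 1/2 - \<mu>) ?q (- 1/2 - \<mu>) w t = (\<Sum>n<N. ?c n * ?k n t) + ?s * ?T t" if t: "t \<in> {0<..<1}" for t
  proof -
    have wt: "Re (w * of_real t) < 1" using one_minus_mult_not_nonpos(1)[OF w, of t] t by simp
    have "(1 - w * of_real t) powr (- ?a) = (\<Sum>n<N. pochhammer ?a n / fact n * (w * of_real t) ^ n) +
        (w * of_real t) ^ N * (sin (of_real pi * ?a) / of_real pi) * euler_integral (of_nat N + ?a - 1) (- ?a) (- 1) (w * of_real t)"
      using \<mu> wt by (intro binomial_remainder) auto
    also have "sin (of_real pi * ?a) = cos (of_real pi * \<mu>)"
      using sin_add[of "of_real pi / 2" "of_real pi * \<mu>"] by (simp add: distrib_left)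
    also have "euler_integral (of_nat N + ?a - 1) (- ?a) (- 1) (w * of_real t) = remainder_inner N \<mu> (w * of_real t)"
    proof -
      have "of_nat N + ?a - 1 = of_nat N + \<mu> - 1/2" "- ?a = - 1/2 - \<mu>" by simp_all
      then show ?thesis by (simp only: remainder_inner_def)
    qed
    finally have b: "(1 - w * of_real t) powr (- 1/2 - \<mu>) = (\<Sum>n<N. ?c n * of_real t ^ n) + ?s * (of_real t ^ N * remainder_inner N \<mu> (w * of_real t))"
      by (simp add: power_mult_distrib mult_ac)
    have "euler_kernel (of_nat N - 1/2 - \<mu>) (\<nu> + \<mu>) 0 0 t = ?k N t" by (simp add: algebra_simps)
    then have T: "?T t = of_real t powr (- 1/2 - \<mu>) * of_real (1 - t) powr ?q * (of_real t ^ N * remainder_inner N \<mu> (w * of_real t))"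
      unfolding kn[OF t] by simp
    have "X * ((\<Sum>n<N. ?c n * y n) + s * z) = (\<Sum>n<N. ?c n * (X * y n)) + s * (X * z)" for X s z and y :: "nat \<Rightarrow> complex"
      by (simp add: distrib_left sum_distrib_left mult_ac)
    then show ?thesis unfolding T kn[OF t] unfolding euler_kernel_def b .
  qed
  have ik: "?k n integrable_on {0<..<1}" for n using \<mu> \<nu> by (intro euler_kernel_integrable) auto
  have iT: "?T integrable_on {0<..<1}" by (rule remainder_integrand_integrable[OF \<mu> \<nu> w])
  have "euler_integral (- 1/2 - \<mu>) ?q (- 1/2 - \<mu>) w = integral {0<..<1} (\<lambda>t. (\<Sum>n<N. ?c n * ?k n t) + ?s * ?T t)"
    unfolding euler_integral_def by (intro integral_cong pt)
  also have "\<dots> = integral {0<..<1} (\<lambda>t. \<Sum>n<N. ?c n * ?k n t) + integral {0<..<1} (\<lambda>t. ?s * ?T t)"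
    by (intro integral_add integrable_sum integrable_on_mult_right ik iT) auto
  also have "integral {0<..<1} (\<lambda>t. \<Sum>n<N. ?c n * ?k n t) = (\<Sum>n<N. ?c n * euler_integral (- 1/2 - \<mu> + of_nat n) ?q 0 0)"
    unfolding euler_integral_def
    by (simp only: integral_sum[OF finite_lessThan integrable_on_mult_right[OF ik]] integral_mult_right)
  also have "integral {0<..<1} (\<lambda>t. ?s * ?T t) = ?s * remainder_integral N \<mu> \<nu> w"
    by (simp add: remainder_integral_def)
  finally have "rGamma (1/2 - \<mu>) * rGamma (\<nu> + \<mu> + 1) * euler_integral (- 1/2 - \<mu>) ?q (- 1/2 - \<mu>) w =
     (\<Sum>n<N. rGamma (1/2 - \<mu>) * rGamma (\<nu> + \<mu> + 1) * (?c n * euler_integral (- 1/2 - \<mu> + of_nat n) ?q 0 0)) +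
     rGamma (1/2 - \<mu>) * rGamma (\<nu> + \<mu> + 1) * (?s * remainder_integral N \<mu> \<nu> w)"
    by (simp only: distrib_left sum_distrib_left)
  also have "(\<Sum>n<N. rGamma (1/2 - \<mu>) * rGamma (\<nu> + \<mu> + 1) * (?c n * euler_integral (- 1/2 - \<mu> + of_nat n) ?q 0 0)) =
     (\<Sum>n<N. a_coeff n \<mu> * rGamma (\<nu> + 3/2 + of_nat n) * (- 2 * w) ^ n)"
  proof (intro sum.cong refl)
    fix n
    have E: "euler_integral (- 1/2 - \<mu> + of_nat n) ?q 0 0 = Gamma (1/2 - \<mu> + of_nat n) * Gamma (\<nu> + \<mu> + 1) * rGamma (\<nu> + 3/2 + of_nat n)"
    proof -
      have "- 1/2 - \<mu> + of_nat n + 1 = 1/2 - \<mu> + of_nat n" "- 1/2 - \<mu> + of_nat n + ?q + 2 = \<nu> + 3/2 + of_nat n"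
        by (simp_all add: field_simps)
      moreover have "euler_integral (- 1/2 - \<mu> + of_nat n) ?q 0 0 =
          Gamma (- 1/2 - \<mu> + of_nat n + 1) * Gamma (?q + 1) * rGamma (- 1/2 - \<mu> + of_nat n + ?q + 2)"
        using \<mu> \<nu> by (intro euler_integral_beta) auto
      ultimately show ?thesis by (simp only:)
    qed
    have "rGamma (1/2 - \<mu>) * Gamma (1/2 - \<mu> + of_nat n) = pochhammer (1/2 - \<mu>) n"
      using \<mu> by (intro Gamma_shift_times_rGamma) auto
    moreover have "Gamma (\<nu> + \<mu> + 1) * rGamma (\<nu> + \<mu> + 1) = 1" using \<nu> by (intro Gamma_times_rGamma) auto
    moreover have "r * s * (P / f * W * (g * h * R)) = (P * (r * g) / f) * R * W * (h * s)" for r s P f W g h R :: complex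
      by simp
    moreover have "a_coeff n \<mu> * rGamma (\<nu> + 3/2 + of_nat n) * (- 2 * w) ^ n =
        (pochhammer ?a n * pochhammer (1/2 - \<mu>) n / fact n) * rGamma (\<nu> + 3/2 + of_nat n) * w ^ n"
      unfolding a_coeff_pochhammer power_mult_distrib by simp
    ultimately show "rGamma (1/2 - \<mu>) * rGamma (\<nu> + \<mu> + 1) * (?c n * euler_integral (- 1/2 - \<mu> + of_nat n) ?q 0 0) =
       a_coeff n \<mu> * rGamma (\<nu> + 3/2 + of_nat n) * (- 2 * w) ^ n"
      unfolding E by (simp only: mult_1_right)
  qed
  finally show ?thesis by (simp add: mult_ac)
qed

text \<open>So -2 w has modulus 1 / sin \<zeta> and phase \<sigma> (\<zeta> + pi/2). Its n-th power
  advances \<open>ferrers_beta\<close> from index 0 to index n and produces the denominator sin^n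
  \<zeta>.\<close>

lemma ferrers_w_polar:
  assumes "sin \<zeta> \<noteq> 0" and \<sigma>: "\<sigma> = 1 \<or> \<sigma> = (-1::real)"
  shows "- 2 * ferrers_w \<sigma> \<zeta> * of_real (sin \<zeta>) = exp (\<i> * of_real (\<sigma> * (\<zeta> + pi/2)))"
proof -
  have "exp (\<i> * of_real (\<sigma> * (\<zeta> + pi/2))) = cis (\<sigma> * (\<zeta> + pi/2))" by (simp add: cis_conv_exp)
  also have "\<dots> = - 2 * ferrers_w \<sigma> \<zeta> * of_real (sin \<zeta>)"
    using assms by (auto simp: complex_eq_iff ferrers_w_def sin_add cos_add sin_diff cos_diff)
  finally show ?thesis ..
qed

lemma ferrers_beta_shift:
  assumes "sin \<zeta> \<noteq> 0" and \<sigma>: "\<sigma> = 1 \<or> \<sigma> = (-1::real)"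
  shows "exp (\<i> * of_real \<sigma> * ferrers_beta \<zeta> \<mu> \<nu> 0) * (- 2 * ferrers_w \<sigma> \<zeta>) ^ n =
    exp (\<i> * of_real \<sigma> * ferrers_beta \<zeta> \<mu> \<nu> n) / of_real (sin \<zeta> ^ n)"
proof -
  have "(- 2 * ferrers_w \<sigma> \<zeta>) ^ n * of_real (sin \<zeta> ^ n) = exp (of_nat n * (\<i> * of_real (\<sigma> * (\<zeta> + pi/2))))"
    unfolding of_real_power power_mult_distrib[symmetric] ferrers_w_polar[OF assms] exp_of_nat_mult ..
  moreover have "ferrers_beta \<zeta> \<mu> \<nu> n = ferrers_beta \<zeta> \<mu> \<nu> 0 + of_nat n * of_real (\<zeta> + pi/2)"
    by (simp add: ferrers_beta_def algebra_simps)
  ultimately have "exp (\<i> * of_real \<sigma> * ferrers_beta \<zeta> \<mu> \<nu> n) =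
      exp (\<i> * of_real \<sigma> * ferrers_beta \<zeta> \<mu> \<nu> 0) * ((- 2 * ferrers_w \<sigma> \<zeta>) ^ n * of_real (sin \<zeta> ^ n))"
    by (simp add: distrib_left exp_add mult_ac)
  then show ?thesis using assms by simp
qed

lemma ferrers_wave_expansion:
  assumes \<zeta>: "0 < \<zeta>" "\<zeta> < pi" and \<sigma>: "\<sigma> = 1 \<or> \<sigma> = (-1::real)"
    and \<mu>: "- real N - 1/2 < Re \<mu>" "Re \<mu> < 1/2" and \<nu>: "Re \<nu> + Re \<mu> > -1"
  shows "rGamma (1/2 - \<mu>) * rGamma (\<nu> + \<mu> + 1) * ferrers_wave \<sigma> \<zeta> \<mu> \<nu> =
    (\<Sum>n<N. a_coeff n \<mu> * exp (\<i> * of_real \<sigma> * ferrers_beta \<zeta> \<mu> \<nu> n) / (Gamma (\<nu> + 3/2 + of_nat n) * of_real (sin \<zeta> ^ n))) +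
    cos (of_real pi * \<mu>) / of_real pi * rGamma (1/2 - \<mu>) * rGamma (\<nu> + \<mu> + 1) / of_real ((- 2 * sin \<zeta>) ^ N) *
     (exp (\<i> * of_real \<sigma> * ferrers_beta \<zeta> \<mu> \<nu> N) * remainder_integral N \<mu> \<nu> (ferrers_w \<sigma> \<zeta>))"
proof -
  have sin0: "sin \<zeta> \<noteq> 0" using sin_gt_zero[OF \<zeta>] by simp
  let ?w = "ferrers_w \<sigma> \<zeta>" and ?e = "\<lambda>n. exp (\<i> * of_real \<sigma> * ferrers_beta \<zeta> \<mu> \<nu> n)"
  have w: "Re ?w < 1" by simp
  have "rGamma (1/2 - \<mu>) * rGamma (\<nu> + \<mu> + 1) * ferrers_wave \<sigma> \<zeta> \<mu> \<nu> = ?e 0 *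
     (rGamma (1/2 - \<mu>) * rGamma (\<nu> + \<mu> + 1) * euler_integral (- 1/2 - \<mu>) (\<nu> + \<mu>) (- 1/2 - \<mu>) ?w)"
    unfolding ferrers_wave_def by (simp only: mult_ac)
  also have "\<dots> = (\<Sum>n<N. a_coeff n \<mu> * rGamma (\<nu> + 3/2 + of_nat n) * (?e 0 * (- 2 * ?w) ^ n)) +
     cos (of_real pi * \<mu>) / of_real pi * rGamma (1/2 - \<mu>) * rGamma (\<nu> + \<mu> + 1) * (?e 0 * ?w ^ N) * remainder_integral N \<mu> \<nu> ?w"
    unfolding euler_integral_expansion[OF \<mu> \<nu> w] by (simp add: distrib_left sum_distrib_left mult_ac)
  also have "?e 0 * ?w ^ N = ?e N / of_real ((- 2 * sin \<zeta>) ^ N)"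
  proof -
    have "?e 0 * ?w ^ N = ?e 0 * (- 2 * ?w) ^ N / (- 2) ^ N" unfolding power_mult_distrib by simp
    also have "\<dots> = ?e N / of_real (sin \<zeta> ^ N) / (- 2) ^ N" unfolding ferrers_beta_shift[OF sin0 \<sigma>] ..
    also have "\<dots> = ?e N / of_real ((- 2 * sin \<zeta>) ^ N)" unfolding power_mult_distrib by (simp add: mult_ac)
    finally show ?thesis .
  qed
  finally have 1: "rGamma (1/2 - \<mu>) * rGamma (\<nu> + \<mu> + 1) * ferrers_wave \<sigma> \<zeta> \<mu> \<nu> =
    (\<Sum>n<N. a_coeff n \<mu> * rGamma (\<nu> + 3/2 + of_nat n) * (?e n / of_real (sin \<zeta> ^ n))) +
    cos (of_real pi * \<mu>) / of_real pi * rGamma (1/2 - \<mu>) * rGamma (\<nu> + \<mu> + 1) *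
     (?e N / of_real ((- 2 * sin \<zeta>) ^ N)) * remainder_integral N \<mu> \<nu> ?w"
    unfolding ferrers_beta_shift[OF sin0 \<sigma>] .
  have t1: "a * rGamma z * (e / s) = a * e / (Gamma z * s)" for a z e s :: complex
    by (simp add: rGamma_inverse_Gamma divide_inverse)
  have t2: "c * (e / s) * T = c / s * (e * T)" for c e s T :: complex by simp
  show ?thesis unfolding 1 by (intro arg_cong2[where f="(+)"] sum.cong refl t1 t2)
qed

section \<open>Estimates of the kernel\<close>

lemma one_minus_ferrers_w:
  "1 - ferrers_w \<sigma> \<zeta> * of_real \<tau> = Complex (1 - \<tau>/2) (\<sigma> * (\<tau> * cos \<zeta> / (2 * sin \<zeta>)))"
  by (simp add: complex_eq_iff ferrers_w_def)

text \<open>\<open>d\<close> is the modulus of 1 - w \<tau>, and d^2 = 1 - \<tau> + \<tau>^2 / (4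
  S^2) with S = sin \<zeta>. Its minimum over all real \<tau>, at \<tau> = 2 S^2, is cos^2 \<zeta>,
  whence |sec \<zeta>|. If 2 S^2 \<ge> 1, it decreases on (0, 1) towards 1 / (4 S^2), whence 2 sin
  \<zeta>. The last two bounds save one factor 1/d through |1 - \<tau>/2| \<le> d and |cos \<zeta>|
  \<le> d.\<close>

lemma kernel_denominator_bounds:
  fixes \<tau> \<zeta> :: real
  assumes \<zeta>: "0 < \<zeta>" "\<zeta> < pi" and \<tau>: "0 < \<tau>" "\<tau> < 1"
  defines "d \<equiv> sqrt ((1 - \<tau>/2)\<^sup>2 + (\<tau> * cos \<zeta> / (2 * sin \<zeta>))\<^sup>2)"
  shows "0 < d" "1 / d \<le> s_factor \<zeta>" "\<bar>1 - \<tau>/2\<bar> / d\<^sup>2 \<le> s_factor \<zeta>"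
    "\<bar>\<tau> * cos \<zeta> / (2 * sin \<zeta>)\<bar> / d\<^sup>2 \<le> \<tau> / (2 * sin \<zeta>) * s_factor \<zeta>"
proof -
  define S where "S = sin \<zeta>"
  have S: "S > 0" using sin_gt_zero[OF \<zeta>] by (simp add: S_def)
  have C2: "(cos \<zeta>)\<^sup>2 = 1 - S\<^sup>2" by (simp add: S_def cos_squared_eq)
  have "(1 - \<tau>/2)\<^sup>2 > 0" using \<tau> by (intro zero_less_power) auto
  then show d0: "d > 0" unfolding d_def by (intro real_sqrt_gt_zero add_pos_nonneg) auto
  have d2: "d\<^sup>2 = 1 - \<tau> + \<tau>\<^sup>2 / (4 * S\<^sup>2)"
  proof -
    have "d\<^sup>2 = (1 - \<tau>/2)\<^sup>2 + (\<tau> * cos \<zeta> / (2 * S))\<^sup>2" unfolding d_def S_def by (rule real_sqrt_pow2) simp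
    also have "(\<tau> * cos \<zeta> / (2 * S))\<^sup>2 = \<tau>\<^sup>2 * (1 - S\<^sup>2) / (4 * S\<^sup>2)"
      unfolding C2[symmetric] by (simp add: power_divide power_mult_distrib)
    finally show ?thesis using S by (simp add: field_simps power2_eq_square)
  qed
  have "d\<^sup>2 - (cos \<zeta>)\<^sup>2 = (S - \<tau> / (2 * S))\<^sup>2"
    unfolding d2 C2 using S by (simp add: field_simps power2_eq_square)
  then have "(cos \<zeta>)\<^sup>2 \<le> d\<^sup>2" using zero_le_power2[of "S - \<tau> / (2 * S)"] by linarith
  then have cd: "\<bar>cos \<zeta>\<bar> \<le> d" using d0 by (simp add: abs_le_square_iff[symmetric])
  have ud: "\<bar>1 - \<tau>/2\<bar> \<le> d" unfolding d_def by (rule real_le_rsqrt) simp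
  show s: "1 / d \<le> s_factor \<zeta>"
  proof (cases "\<zeta> \<le> pi / 4 \<or> 3 * pi / 4 \<le> \<zeta>")
    case True
    have "cos \<zeta> \<noteq> 0"
    proof (cases "\<zeta> \<le> pi / 4")
      case True
      then have "cos \<zeta> > 0" using \<zeta> by (intro cos_gt_zero) auto
      then show ?thesis by simp
    next
      case False
      then have "pi - \<zeta> \<le> pi / 4" using True by auto
      then have "cos (pi - \<zeta>) > 0" using \<zeta> by (intro cos_gt_zero) auto
      then show ?thesis by simp
    qed
    then have "1 / d \<le> 1 / \<bar>cos \<zeta>\<bar>" using cd d0 by (intro divide_left_mono) auto
    then show ?thesis using True by (simp add: s_factor_def abs_divide)
  next
    case False
    have "sin (pi / 4) \<le> S"
    proof (cases "\<zeta> \<le> pi / 2")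
      case True
      then show ?thesis unfolding S_def using False by (intro sin_monotone_2pi_le) auto
    next
      case gt: False
      have "sin (pi / 4) \<le> sin (pi - \<zeta>)" using False gt by (intro sin_monotone_2pi_le) auto
      then show ?thesis by (simp add: S_def)
    qed
    then have "(sqrt 2 / 2)\<^sup>2 \<le> S\<^sup>2" by (intro power_mono) (auto simp: sin_45)
    then have "1 + \<tau> \<le> 4 * S\<^sup>2" using \<tau> by (simp add: power_divide)
    then have "(1 - \<tau>) * (1 - (1 + \<tau>) / (4 * S\<^sup>2)) \<ge> 0" using \<tau> S by (intro mult_nonneg_nonneg) auto
    moreover have "d\<^sup>2 - (1 / (2 * S))\<^sup>2 = (1 - \<tau>) * (1 - (1 + \<tau>) / (4 * S\<^sup>2))"
      unfolding d2 using S by (simp add: field_simps power2_eq_square)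
    ultimately have "(1 / (2 * S))\<^sup>2 \<le> d\<^sup>2" by linarith
    then have "1 / (2 * S) \<le> d" using d0 by (rule power2_le_imp_le[OF _ less_imp_le])
    then have "1 / d \<le> 2 * S" using d0 S by (simp add: field_simps)
    then show ?thesis using False by (simp add: s_factor_def S_def)
  qed
  have d2': "a / d\<^sup>2 = (a / d) * (1 / d)" for a by (simp add: power2_eq_square)
  have sf0: "s_factor \<zeta> \<ge> 0" using s d0 by (meson order_trans zero_le_divide_1_iff less_imp_le)
  show "\<bar>1 - \<tau>/2\<bar> / d\<^sup>2 \<le> s_factor \<zeta>"
  proof -
    have "(\<bar>1 - \<tau>/2\<bar> / d) * (1 / d) \<le> 1 * s_factor \<zeta>" using ud d0 s by (intro mult_mono) auto
    then show ?thesis unfolding d2' by simp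
  qed
  show "\<bar>\<tau> * cos \<zeta> / (2 * sin \<zeta>)\<bar> / d\<^sup>2 \<le> \<tau> / (2 * sin \<zeta>) * s_factor \<zeta>"
  proof -
    have "\<bar>\<tau> * cos \<zeta> / (2 * sin \<zeta>)\<bar> / d\<^sup>2 = \<tau> / (2 * S) * ((\<bar>cos \<zeta>\<bar> / d) * (1 / d))"
      using S \<tau> by (simp add: abs_mult S_def power2_eq_square)
    also have "\<dots> \<le> \<tau> / (2 * S) * (1 * s_factor \<zeta>)"
      using S \<tau> cd d0 s by (intro mult_left_mono mult_mono) auto
    finally show ?thesis by (simp add: S_def)
  qed
qed

text \<open>The first two bounds are the triangle inequality. For the last two, write
  \<open>zp\<close> = u + i v and \<open>zm\<close> = u - i v over the common denominator
  \<open>d\<^sup>2\<close>: the numerators are u cos b + v sin b and u sin b - v cos b, and v is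
  proportional to \<open>\<tau>\<close>.\<close>

lemma kernel_bounds:
  fixes \<tau> \<zeta> :: real and b :: complex
  assumes \<zeta>: "0 < \<zeta>" "\<zeta> < pi" and \<tau>: "0 < \<tau>" "\<tau> < 1"
  defines "zp \<equiv> 1 - ferrers_w 1 \<zeta> * of_real \<tau>" and "zm \<equiv> 1 - ferrers_w (-1) \<zeta> * of_real \<tau>"
  shows "norm (exp (\<i> * b) / 2 / zp + exp (- (\<i> * b)) / 2 / zm) \<le> cosh (Im b) * s_factor \<zeta>" (is ?P1)
    and "norm (exp (\<i> * b) / (2 * \<i>) / zp + - exp (- (\<i> * b)) / (2 * \<i>) / zm) \<le> cosh (Im b) * s_factor \<zeta>" (is ?P2)
    and "norm (exp (\<i> * b) / 2 / zp + exp (- (\<i> * b)) / 2 / zm) \<le>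
       norm (cos b) * s_factor \<zeta> + norm (sin b) * s_factor \<zeta> / (2 * sin \<zeta>) * \<tau>" (is ?P3)
    and "norm (exp (\<i> * b) / (2 * \<i>) / zp + - exp (- (\<i> * b)) / (2 * \<i>) / zm) \<le>
       norm (sin b) * s_factor \<zeta> + norm (cos b) * s_factor \<zeta> / (2 * sin \<zeta>) * \<tau>" (is ?P4)
proof -
  define u where "u = 1 - \<tau>/2"
  define v where "v = \<tau> * cos \<zeta> / (2 * sin \<zeta>)"
  define d where "d = sqrt (u\<^sup>2 + v\<^sup>2)"
  note D = kernel_denominator_bounds[OF \<zeta> \<tau>, folded u_def v_def, folded d_def]
  have zp: "zp = of_real u + \<i> * of_real v" and zm: "zm = of_real u - \<i> * of_real v"
    by (simp_all add: zp_def zm_def one_minus_ferrers_w u_def v_def Complex_eq)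
  have n: "norm zp = d" "norm zm = d" by (simp_all add: zp zm cmod_def d_def)
  have z0: "zp \<noteq> 0" "zm \<noteq> 0" using n D(1) by auto
  have dd: "zp * zm = of_real (d\<^sup>2)"
    unfolding zp zm d_def by (simp add: algebra_simps power2_eq_square flip: of_real_mult of_real_add)
  have tri: "norm (e1 / zp + e2 / zm) \<le> cosh (Im b) * s_factor \<zeta>"
    if "norm e1 = exp (- Im b) / 2" "norm e2 = exp (Im b) / 2" for e1 e2
  proof -
    have "norm (e1 / zp + e2 / zm) \<le> norm (e1 / zp) + norm (e2 / zm)" by (rule norm_triangle_ineq)
    also have "\<dots> = cosh (Im b) * (1 / d)"
      unfolding norm_divide n that by (simp add: cosh_def add_divide_distrib)
    also have "\<dots> \<le> cosh (Im b) * s_factor \<zeta>" using D(2) by (intro mult_left_mono) auto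
    finally show ?thesis .
  qed
  show ?P1 by (rule tri) (simp_all add: norm_divide)
  show ?P2 by (rule tri) (simp_all add: norm_divide norm_mult)
  have comb: "norm (x * of_real u + y * of_real v) / d\<^sup>2 \<le>
      norm x * s_factor \<zeta> + norm y * s_factor \<zeta> / (2 * sin \<zeta>) * \<tau>" for x y :: complex
  proof -
    have "norm (x * of_real u + y * of_real v) / d\<^sup>2 \<le> (norm x * \<bar>u\<bar> + norm y * \<bar>v\<bar>) / d\<^sup>2"
      using norm_triangle_ineq[of "x * of_real u" "y * of_real v"]
      by (intro divide_right_mono) (simp_all add: norm_mult)
    also have "\<dots> = norm x * (\<bar>u\<bar> / d\<^sup>2) + norm y * (\<bar>v\<bar> / d\<^sup>2)" by (simp add: add_divide_distrib)
    also have "\<dots> \<le> norm x * s_factor \<zeta> + norm y * (\<tau> / (2 * sin \<zeta>) * s_factor \<zeta>)"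
      using D(3,4) by (intro add_mono mult_left_mono) auto
    finally show ?thesis by (simp add: mult_ac)
  qed
  have sum: "e1 / zp + e2 / zm = (e1 * zm + e2 * zp) / of_real (d\<^sup>2)" for e1 e2
    unfolding dd[symmetric] using z0 by (simp add: field_simps)
  have nd: "norm (of_real (d\<^sup>2) :: complex) = d\<^sup>2" unfolding norm_of_real by simp
  have "exp (\<i> * b) / 2 * zm + exp (- (\<i> * b)) / 2 * zp = cos b * of_real u + sin b * of_real v"
    unfolding zp zm cos_exp_eq sin_exp_eq by (simp add: field_simps)
  then show ?P3 unfolding sum norm_divide nd using comb by presburger
  have "exp (\<i> * b) / (2 * \<i>) * zm + - exp (- (\<i> * b)) / (2 * \<i>) * zp = sin b * of_real u + (- cos b) * of_real v"
    unfolding zp zm cos_exp_eq sin_exp_eq by (simp add: field_simps)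
  then show ?P4 unfolding sum norm_divide[of _ "of_real (d\<^sup>2)"] nd using comb[of "sin b" "- cos b"] by simp
qed

section \<open>From kernel estimates to the bounds\<close>

lemma integral_norm_bound_beta:
  fixes f :: "real \<Rightarrow> complex"
  assumes "f integrable_on {0<..<1}" "p > -1" "q > -1" 
    and "\<And>t. 0 < t \<Longrightarrow> t < 1 \<Longrightarrow> norm (f t) \<le> t powr p * (1 - t) powr q * (A + B * t)"
  shows "norm (integral {0<..<1} f) \<le> A * Beta (p + 1) (q + 1) + B * Beta (p + 2) (q + 1)"
proof -
  have "((\<lambda>t. A * (t powr p * (1 - t) powr q) + B * (t powr (p + 1) * (1 - t) powr q)) has_integral
     A * Beta (p + 1) (q + 1) + B * Beta (p + 1 + 1) (q + 1)) {0<..<1}"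
    using assms(2,3) by (intro has_integral_add has_integral_mult_right beta_has_integral) auto
  moreover have "A * (t powr p * (1 - t) powr q) + B * (t powr (p + 1) * (1 - t) powr q) =
      t powr p * (1 - t) powr q * (A + B * t)" if "0 < t" for t
    using that by (simp add: powr_add algebra_simps)
  ultimately have *: "((\<lambda>t. t powr p * (1 - t) powr q * (A + B * t)) has_integral
     A * Beta (p + 1) (q + 1) + B * Beta (p + 2) (q + 1)) {0<..<1}"
    by (subst has_integral_cong[where g="\<lambda>t. A * (t powr p * (1 - t) powr q) + B * (t powr (p + 1) * (1 - t) powr q)"]) (auto simp: add.assoc)
  have "norm (integral {0<..<1} f) \<le> integral {0<..<1} (\<lambda>t. t powr p * (1 - t) powr q * (A + B * t))"
    using assms(1,4) * by (intro integral_norm_bound_integral) auto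
  then show ?thesis using integral_unique[OF *] by simp
qed

text \<open>The two kernels are combined before absolute values are taken, and evaluated at \<tau> =
  t s with t from the outer and s from the inner integral. The constant \<open>A\<close> leaves both
  Beta weights alone; the factor t s next to \<open>B\<close> raises one exponent in each, which is
  \<open>M\<close> at \<open>N + 1\<close>.\<close>

lemma remainder_combination_bound:
  fixes \<mu> \<nu> c1 c2 w1 w2 :: complex and A B :: real
  assumes \<mu>: "- real N - 1/2 < Re \<mu>" "Re \<mu> < 1/2" and \<nu>: "Re \<nu> + Re \<mu> > -1"
    and w: "Re w1 < 1" "Re w2 < 1" and AB: "A \<ge> 0" "B \<ge> 0"
    and K: "\<And>\<tau>. 0 < \<tau> \<Longrightarrow> \<tau> < 1 \<Longrightarrow>
       norm (c1 / (1 - w1 * of_real \<tau>) + c2 / (1 - w2 * of_real \<tau>)) \<le> A + B * \<tau>"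
  defines "M \<equiv> \<lambda>n. Beta (real n + 1/2 - Re \<mu>) (Re \<nu> + Re \<mu> + 1) * Beta (real n + 1/2 + Re \<mu>) (1/2 - Re \<mu>)"
  shows "norm (c1 * remainder_integral N \<mu> \<nu> w1 + c2 * remainder_integral N \<mu> \<nu> w2) \<le> A * M N + B * M (N + 1)"
proof -
  define x where "x = Re \<mu>"
  let ?B1 = "Beta (real N + 1/2 + x) (1/2 - x)" and ?B2 = "Beta (real N + 3/2 + x) (1/2 - x)"
  have inner: "norm (c1 * remainder_inner N \<mu> (w1 * of_real t) + c2 * remainder_inner N \<mu> (w2 * of_real t))
      \<le> A * ?B1 + B * ?B2 * t" if t: "0 < t" "t < 1" for t
  proof -
    let ?p = "of_nat N + \<mu> - 1/2" and ?q = "- 1/2 - \<mu>"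
    have wt: "Re (w1 * of_real t) < 1" "Re (w2 * of_real t) < 1"
      using one_minus_mult_not_nonpos(1)[OF w(1), of t] one_minus_mult_not_nonpos(1)[OF w(2), of t] t by auto
    have ik: "euler_kernel ?p ?q (- 1) z integrable_on {0<..<1}" if "Re z < 1" for z
      using \<mu> that by (intro euler_kernel_integrable) auto
    let ?f = "\<lambda>s. c1 * euler_kernel ?p ?q (- 1) (w1 * of_real t) s + c2 * euler_kernel ?p ?q (- 1) (w2 * of_real t) s"
    have "c1 * remainder_inner N \<mu> (w1 * of_real t) + c2 * remainder_inner N \<mu> (w2 * of_real t) = integral {0<..<1} ?f"
      unfolding remainder_inner_def euler_integral_def
      by (simp only: integral_add[OF integrable_on_mult_right[OF ik[OF wt(1)]] integrable_on_mult_right[OF ik[OF wt(2)]]]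
          integral_mult_right)
    also have "norm \<dots> \<le> A * Beta (real N + x - 1/2 + 1) (- 1/2 - x + 1) + B * t * Beta (real N + x - 1/2 + 2) (- 1/2 - x + 1)"
    proof (rule integral_norm_bound_beta)
      show "?f integrable_on {0<..<1}"
        by (intro integrable_add integrable_on_mult_right ik wt)
      fix s :: real assume s: "0 < s" "s < 1"
      have ts: "0 < t * s" "t * s < 1" using s t mult_strict_mono[of t 1 s 1] by auto
      have "?f s = of_real s powr ?p * of_real (1 - s) powr ?q * (c1 / (1 - w1 * of_real (t * s)) + c2 / (1 - w2 * of_real (t * s)))"
      proof -
        have "z powr (- 1) = 1 / z" for z :: complex by (cases "z = 0") (simp_all add: powr_minus_divide)
        moreover have "w * of_real t * of_real s = w * of_real (t * s)" for w :: complex by simp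
        moreover have "c1 * (a * b * (1 / z1)) + c2 * (a * b * (1 / z2)) = a * b * (c1 / z1 + c2 / z2)" for a b z1 z2 :: complex
          by (simp add: distrib_left mult_ac)
        ultimately show ?thesis unfolding euler_kernel_def by (simp only:)
      qed
      then have "norm (?f s) = s powr (real N + x - 1/2) * (1 - s) powr (- 1/2 - x) *
          norm (c1 / (1 - w1 * of_real (t * s)) + c2 / (1 - w2 * of_real (t * s)))"
        using s by (simp only: norm_mult) (simp add: norm_powr_real_powr x_def)
      also have "\<dots> \<le> s powr (real N + x - 1/2) * (1 - s) powr (- 1/2 - x) * (A + B * (t * s))"
        using K[OF ts] by (intro mult_left_mono) auto
      finally show "norm (?f s) \<le> s powr (real N + x - 1/2) * (1 - s) powr (- 1/2 - x) * (A + B * t * s)"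
        by (simp add: mult.assoc)
    qed (use \<mu> in \<open>auto simp: x_def\<close>)
    also have "real N + x - 1/2 + 1 = real N + 1/2 + x" by simp
    also have "real N + x - 1/2 + 2 = real N + 3/2 + x" by simp
    also have "- 1/2 - x + 1 = 1/2 - x" by simp
    finally show ?thesis by (simp add: mult_ac)
  qed
  let ?g = "\<lambda>w t. euler_kernel (of_nat N - 1/2 - \<mu>) (\<nu> + \<mu>) 0 0 t * remainder_inner N \<mu> (w * of_real t)"
  have ig: "?g w integrable_on {0<..<1}" if "Re w < 1" for w
    by (rule remainder_integrand_integrable[OF \<mu> \<nu> that])
  have "c1 * remainder_integral N \<mu> \<nu> w1 + c2 * remainder_integral N \<mu> \<nu> w2 =
      integral {0<..<1} (\<lambda>t. c1 * ?g w1 t + c2 * ?g w2 t)"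
    unfolding remainder_integral_def
    by (subst integral_add) (auto intro!: integrable_on_mult_right ig w)
  also have "norm \<dots> \<le> A * ?B1 * Beta (real N - 1/2 - x + 1) (Re \<nu> + x + 1) + B * ?B2 * Beta (real N - 1/2 - x + 2) (Re \<nu> + x + 1)"
  proof (rule integral_norm_bound_beta)
    show "(\<lambda>t. c1 * ?g w1 t + c2 * ?g w2 t) integrable_on {0<..<1}"
      by (intro integrable_add integrable_on_mult_right ig w)
    fix t :: real assume t: "0 < t" "t < 1"
    have "c1 * ?g w1 t + c2 * ?g w2 t = euler_kernel (of_nat N - 1/2 - \<mu>) (\<nu> + \<mu>) 0 0 t *
       (c1 * remainder_inner N \<mu> (w1 * of_real t) + c2 * remainder_inner N \<mu> (w2 * of_real t))"
      by (simp add: algebra_simps)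
    then have "norm (c1 * ?g w1 t + c2 * ?g w2 t) = t powr (real N - 1/2 - x) * (1 - t) powr (Re \<nu> + x) *
       norm (c1 * remainder_inner N \<mu> (w1 * of_real t) + c2 * remainder_inner N \<mu> (w2 * of_real t))"
      using t by (simp only: norm_mult norm_euler_kernel) (simp add: x_def)
    also have "\<dots> \<le> t powr (real N - 1/2 - x) * (1 - t) powr (Re \<nu> + x) * (A * ?B1 + B * ?B2 * t)"
      using inner[OF t] by (intro mult_left_mono) auto
    finally show "norm (c1 * ?g w1 t + c2 * ?g w2 t) \<le> t powr (real N - 1/2 - x) * (1 - t) powr (Re \<nu> + x) * (A * ?B1 + B * ?B2 * t)" .
  qed (use \<mu> \<nu> in \<open>auto simp: x_def\<close>)
  also have "\<dots> = A * M N + B * M (N + 1)"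
  proof -
    have "real N - 1/2 - x + 1 = real N + 1/2 - x" "real N - 1/2 - x + 2 = real (N + 1) + 1/2 - x"
      "real N + 3/2 + x = real (N + 1) + 1/2 + x" by simp_all
    then show ?thesis unfolding M_def x_def[symmetric] by (simp only: mult_ac)
  qed
  finally show ?thesis .
qed

definition remainder_factor :: "nat \<Rightarrow> real \<Rightarrow> complex \<Rightarrow> complex \<Rightarrow> complex" where
  "remainder_factor N \<zeta> \<mu> \<nu> = cos (of_real pi * \<mu>) / of_real pi * rGamma (1/2 - \<mu>) * rGamma (\<nu> + \<mu> + 1)
     / of_real ((- 2 * sin \<zeta>) ^ N)"

text \<open>Two of the Gamma values in the Beta functions, with n! and pi, form
  \<open>abs_a_over_cos n\<close> by \<open>abs_a_over_cos_eq\<close>; two others complete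
  \<open>bound_factor\<close>, and the last is the Gamma denominator of the bound. \<open>n\<close>
  and \<open>N\<close> are separate because both \<open>n = N\<close> and \<open>n = N + 1\<close>
  occur with the same prefactor.\<close>

lemma norm_remainder_factor_beta:
  assumes \<mu>: "\<bar>Re \<mu>\<bar> < real n + 1/2" "Re \<mu> < 1/2" and \<nu>: "Re \<nu> + Re \<mu> > -1" and s: "sin \<zeta> > 0"
  shows "norm (remainder_factor N \<zeta> \<mu> \<nu>) *
      (Beta (real n + 1/2 - Re \<mu>) (Re \<nu> + Re \<mu> + 1) * Beta (real n + 1/2 + Re \<mu>) (1/2 - Re \<mu>)) =
    bound_factor \<mu> \<nu> * abs_a_over_cos n (Re \<mu>) / Gamma (Re \<nu> + 3/2 + real n) * (2 ^ n / (2 * sin \<zeta>) ^ N)"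
proof -
  define x where "x = Re \<mu>"
  define y where "y = Re \<nu>"
  have pos: "Gamma (1/2 - x) > 0" "Gamma (y + x + 1) > 0" using \<mu> \<nu> by (auto simp: x_def y_def intro!: Gamma_real_pos)
  have bf: "bound_factor \<mu> \<nu> = norm (cos (of_real pi * \<mu>)) *
      (Gamma (1/2 - x) * Gamma (y + x + 1) * (norm (rGamma (1/2 - \<mu>)) * norm (rGamma (\<nu> + \<mu> + 1))))"
    unfolding bound_factor_def x_def[symmetric] y_def[symmetric] using pos
    by (simp add: norm_divide norm_mult rGamma_inverse_Gamma norm_inverse field_simps)
  have rf: "norm (remainder_factor N \<zeta> \<mu> \<nu>) =
      norm (cos (of_real pi * \<mu>)) / pi * (norm (rGamma (1/2 - \<mu>)) * norm (rGamma (\<nu> + \<mu> + 1))) / (2 * sin \<zeta>) ^ N"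
    unfolding remainder_factor_def norm_divide norm_mult norm_of_real using s by (simp add: power_abs abs_mult)
  have be: "real n + 1/2 - x + (y + x + 1) = y + 3/2 + real n" "real n + 1/2 + x + (1/2 - x) = 1 + real n" by simp_all
  have a: "abs_a_over_cos n x = Gamma (real n + 1/2 - x) * Gamma (real n + 1/2 + x) / (2 ^ n * fact n * pi)"
    using \<mu> by (intro abs_a_over_cos_eq) (simp add: x_def)
  have fin: "C / pi * R / D * (g1 * G2 / G3 * (g4 * G5 / F)) = C * (G5 * G2 * R) * (g1 * g4 / (E * F * pi)) / G3 * (E / D)"
    if "E \<noteq> 0" for C R D g1 G2 G3 g4 G5 F E :: real using that by (simp add: mult_ac)
  have "(2::real) ^ n \<noteq> 0" by simp
  note fin = fin[OF this]
  show ?thesis unfolding x_def[symmetric] y_def[symmetric] bf rf a Beta_def be Gamma_fact fin ..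
qed

text \<open>The prefactor is nonzero, so the hypothesis determines \<open>RP\<close>. The half-sum
  of the two wave expansions turns their finite sums into the cosine sum and leaves the remainder
  integrals.\<close>

lemma ferrers_remainder_P:
  assumes \<zeta>: "0 < \<zeta>" "\<zeta> < pi" and \<mu>: "- real N - 1/2 < Re \<mu>" "Re \<mu> < 1/2" and \<nu>: "Re \<nu> + Re \<mu> > -1"
    and RP: "ferrers_P \<nu> \<mu> (cos \<zeta>) =
      of_real (sqrt (2 / (pi * sin \<zeta>))) * Gamma (\<nu> + \<mu> + 1) *
        ((\<Sum>n<N. a_coeff n \<mu> * cos (ferrers_beta \<zeta> \<mu> \<nu> n)
            / (Gamma (\<nu> + 3 / 2 + of_nat n) * of_real (sin \<zeta> ^ n))) + RP)"
  shows "RP = remainder_factor N \<zeta> \<mu> \<nu> *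
    (exp (\<i> * ferrers_beta \<zeta> \<mu> \<nu> N) / 2 * remainder_integral N \<mu> \<nu> (ferrers_w 1 \<zeta>) +
     exp (- (\<i> * ferrers_beta \<zeta> \<mu> \<nu> N)) / 2 * remainder_integral N \<mu> \<nu> (ferrers_w (-1) \<zeta>))" (is "_ = ?X")
proof -
  let ?b = "ferrers_beta \<zeta> \<mu> \<nu>" and ?r = "rGamma (1/2 - \<mu>)" and ?g = "rGamma (\<nu> + \<mu> + 1)" and ?G = "Gamma (\<nu> + \<mu> + 1)"
  let ?d = "\<lambda>n. Gamma (\<nu> + 3/2 + of_nat n) * of_real (sin \<zeta> ^ n)"
  let ?c = "complex_of_real (sqrt (2 / (pi * sin \<zeta>)))"
  have G: "?G * ?g = 1" using \<nu> by (intro Gamma_times_rGamma) auto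
  have c0: "?c * ?G \<noteq> 0" using sin_gt_zero[OF \<zeta>] G by auto
  have wp: "?r * ?g * ferrers_wave 1 \<zeta> \<mu> \<nu> = (\<Sum>n<N. a_coeff n \<mu> * exp (\<i> * ?b n) / ?d n) +
      remainder_factor N \<zeta> \<mu> \<nu> * (exp (\<i> * ?b N) * remainder_integral N \<mu> \<nu> (ferrers_w 1 \<zeta>))"
    using ferrers_wave_expansion[OF \<zeta> _ \<mu> \<nu>, of 1] by (simp add: remainder_factor_def)
  have wm: "?r * ?g * ferrers_wave (-1) \<zeta> \<mu> \<nu> = (\<Sum>n<N. a_coeff n \<mu> * exp (- (\<i> * ?b n)) / ?d n) +
      remainder_factor N \<zeta> \<mu> \<nu> * (exp (- (\<i> * ?b N)) * remainder_integral N \<mu> \<nu> (ferrers_w (-1) \<zeta>))"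
    using ferrers_wave_expansion[OF \<zeta> _ \<mu> \<nu>, of "-1"] by (simp add: remainder_factor_def)
  have "ferrers_P \<nu> \<mu> (cos \<zeta>) = ?c * ?r / 2 * (ferrers_wave 1 \<zeta> \<mu> \<nu> + ferrers_wave (-1) \<zeta> \<mu> \<nu>) * (?G * ?g)"
    unfolding G using ferrers_P_eq_waves[OF \<zeta> \<mu>(2) \<nu>] by simp
  also have "\<dots> = ?c * ?G * ((?r * ?g * ferrers_wave 1 \<zeta> \<mu> \<nu> + ?r * ?g * ferrers_wave (-1) \<zeta> \<mu> \<nu>) / 2)"
    by (simp add: algebra_simps)
  finally have "(\<Sum>n<N. a_coeff n \<mu> * cos (?b n) / ?d n) + RP =
      (?r * ?g * ferrers_wave 1 \<zeta> \<mu> \<nu> + ?r * ?g * ferrers_wave (-1) \<zeta> \<mu> \<nu>) / 2"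
    unfolding RP mult_left_cancel[OF c0] .
  also have "\<dots> = (\<Sum>n<N. a_coeff n \<mu> * cos (?b n) / ?d n) + ?X"
  proof -
    have "(\<Sum>n<N. a_coeff n \<mu> * cos (?b n) / ?d n) = (\<Sum>n<N. (a_coeff n \<mu> * exp (\<i> * ?b n) / ?d n + a_coeff n \<mu> * exp (- (\<i> * ?b n)) / ?d n) / 2)"
      by (intro sum.cong refl) (simp add: cos_exp_eq add_divide_distrib distrib_left mult_ac)
    also have "\<dots> = ((\<Sum>n<N. a_coeff n \<mu> * exp (\<i> * ?b n) / ?d n) + (\<Sum>n<N. a_coeff n \<mu> * exp (- (\<i> * ?b n)) / ?d n)) / 2"
      by (simp only: sum_divide_distrib[symmetric] sum.distrib)
    finally have S: "(\<Sum>n<N. a_coeff n \<mu> * cos (?b n) / ?d n) = \<dots>" .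
    have "(s + R * (e * T) + (s' + R * (e' * T'))) / 2 = (s + s') / 2 + R * (e / 2 * T + e' / 2 * T')"
      for s s' R e e' T T' :: complex by (simp add: field_simps)
    then show ?thesis unfolding wp wm S .
  qed
  finally show ?thesis by simp
qed

text \<open>The counterpart with the difference over \<open>2 * \<i>\<close>. Since i/2 = -1/(2 i),
  the factor \<open>\<i>\<close> in \<open>ferrers_Q_eq_waves\<close> becomes the leading minus sign
  of the expansion of Q.\<close>

lemma ferrers_remainder_Q:
  assumes \<zeta>: "0 < \<zeta>" "\<zeta> < pi" and \<mu>: "- real N - 1/2 < Re \<mu>" "Re \<mu> < 1/2" and \<nu>: "Re \<nu> + Re \<mu> > -1"
    and RQ: "ferrers_Q \<nu> \<mu> (cos \<zeta>) =
      - of_real (sqrt (pi / (2 * sin \<zeta>))) * Gamma (\<nu> + \<mu> + 1) *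
        ((\<Sum>n<N. a_coeff n \<mu> * sin (ferrers_beta \<zeta> \<mu> \<nu> n)
            / (Gamma (\<nu> + 3 / 2 + of_nat n) * of_real (sin \<zeta> ^ n))) + RQ)"
  shows "RQ = remainder_factor N \<zeta> \<mu> \<nu> *
    (exp (\<i> * ferrers_beta \<zeta> \<mu> \<nu> N) / (2 * \<i>) * remainder_integral N \<mu> \<nu> (ferrers_w 1 \<zeta>) +
     - exp (- (\<i> * ferrers_beta \<zeta> \<mu> \<nu> N)) / (2 * \<i>) * remainder_integral N \<mu> \<nu> (ferrers_w (-1) \<zeta>))" (is "_ = ?X")
proof -
  let ?b = "ferrers_beta \<zeta> \<mu> \<nu>" and ?r = "rGamma (1/2 - \<mu>)" and ?g = "rGamma (\<nu> + \<mu> + 1)" and ?G = "Gamma (\<nu> + \<mu> + 1)"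
  let ?d = "\<lambda>n. Gamma (\<nu> + 3/2 + of_nat n) * of_real (sin \<zeta> ^ n)"
  let ?c = "complex_of_real (sqrt (pi / (2 * sin \<zeta>)))"
  have G: "?G * ?g = 1" using \<nu> by (intro Gamma_times_rGamma) auto
  have c0: "- ?c * ?G \<noteq> 0" using sin_gt_zero[OF \<zeta>] G by auto
  have wp: "?r * ?g * ferrers_wave 1 \<zeta> \<mu> \<nu> = (\<Sum>n<N. a_coeff n \<mu> * exp (\<i> * ?b n) / ?d n) +
      remainder_factor N \<zeta> \<mu> \<nu> * (exp (\<i> * ?b N) * remainder_integral N \<mu> \<nu> (ferrers_w 1 \<zeta>))"
    using ferrers_wave_expansion[OF \<zeta> _ \<mu> \<nu>, of 1] by (simp add: remainder_factor_def)
  have wm: "?r * ?g * ferrers_wave (-1) \<zeta> \<mu> \<nu> = (\<Sum>n<N. a_coeff n \<mu> * exp (- (\<i> * ?b n)) / ?d n) +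
      remainder_factor N \<zeta> \<mu> \<nu> * (exp (- (\<i> * ?b N)) * remainder_integral N \<mu> \<nu> (ferrers_w (-1) \<zeta>))"
    using ferrers_wave_expansion[OF \<zeta> _ \<mu> \<nu>, of "-1"] by (simp add: remainder_factor_def)
  have "ferrers_Q \<nu> \<mu> (cos \<zeta>) = \<i> * ?c * ?r / 2 * (ferrers_wave 1 \<zeta> \<mu> \<nu> - ferrers_wave (-1) \<zeta> \<mu> \<nu>) * (?G * ?g)"
    unfolding G using ferrers_Q_eq_waves[OF \<zeta> \<mu>(2) \<nu>] by simp
  also have "\<dots> = - ?c * ?G * ((?r * ?g * ferrers_wave 1 \<zeta> \<mu> \<nu> - ?r * ?g * ferrers_wave (-1) \<zeta> \<mu> \<nu>) / (2 * \<i>))"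
    by (simp add: field_simps)
  finally have "(\<Sum>n<N. a_coeff n \<mu> * sin (?b n) / ?d n) + RQ =
      (?r * ?g * ferrers_wave 1 \<zeta> \<mu> \<nu> - ?r * ?g * ferrers_wave (-1) \<zeta> \<mu> \<nu>) / (2 * \<i>)"
    unfolding RQ mult_left_cancel[OF c0] .
  also have "\<dots> = (\<Sum>n<N. a_coeff n \<mu> * sin (?b n) / ?d n) + ?X"
  proof -
    have "(\<Sum>n<N. a_coeff n \<mu> * sin (?b n) / ?d n) = (\<Sum>n<N. (a_coeff n \<mu> * exp (\<i> * ?b n) / ?d n - a_coeff n \<mu> * exp (- (\<i> * ?b n)) / ?d n) / (2 * \<i>))"
      by (intro sum.cong refl) (simp add: sin_exp_eq diff_divide_distrib right_diff_distrib mult_ac)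
    also have "\<dots> = ((\<Sum>n<N. a_coeff n \<mu> * exp (\<i> * ?b n) / ?d n) - (\<Sum>n<N. a_coeff n \<mu> * exp (- (\<i> * ?b n)) / ?d n)) / (2 * \<i>)"
      by (simp only: sum_divide_distrib[symmetric] sum_subtractf)
    finally have S: "(\<Sum>n<N. a_coeff n \<mu> * sin (?b n) / ?d n) = \<dots>" .
    have "(s + R * (e * T) - (s' + R * (e' * T'))) / (2 * \<i>) = (s - s') / (2 * \<i>) + R * (e / (2 * \<i>) * T + - e' / (2 * \<i>) * T')"
      for s s' R e e' T T' :: complex by (simp add: field_simps)
    then show ?thesis unfolding wp wm S .
  qed
  finally show ?thesis by simp
qed

text \<open>One statement for all four bounds, which differ only in \<open>c1\<close>,
  \<open>c2\<close> and the kernel constants. The divisor \<open>2 * sin \<zeta>\<close> next to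
  \<open>B\<close> absorbs the extra 2 left over at \<open>n = N + 1\<close> and completes the power
  sin^(N + 1) \<zeta>.\<close>

lemma ferrers_remainder_bound:
  fixes c1 c2 R :: complex
  assumes \<zeta>: "0 < \<zeta>" "\<zeta> < pi" and \<mu>: "- real N - 1/2 < Re \<mu>" "Re \<mu> < 1/2" and \<nu>: "Re \<nu> + Re \<mu> > -1"
    and R: "R = remainder_factor N \<zeta> \<mu> \<nu> *
      (c1 * remainder_integral N \<mu> \<nu> (ferrers_w 1 \<zeta>) + c2 * remainder_integral N \<mu> \<nu> (ferrers_w (-1) \<zeta>))"
    and AB: "A \<ge> 0" "B \<ge> 0"
    and K: "\<And>\<tau>. 0 < \<tau> \<Longrightarrow> \<tau> < 1 \<Longrightarrow>
       norm (c1 / (1 - ferrers_w 1 \<zeta> * of_real \<tau>) + c2 / (1 - ferrers_w (-1) \<zeta> * of_real \<tau>)) \<le>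
        A * s_factor \<zeta> + B * s_factor \<zeta> / (2 * sin \<zeta>) * \<tau>"
  shows "norm R \<le> bound_factor \<mu> \<nu> *
      (abs_a_over_cos N (Re \<mu>) * A / (Gamma (Re \<nu> + 3/2 + real N) * sin \<zeta> ^ N) +
       abs_a_over_cos (N + 1) (Re \<mu>) * B / (Gamma (Re \<nu> + 5/2 + real N) * sin \<zeta> ^ (N + 1))) * s_factor \<zeta>"
proof -
  let ?M = "\<lambda>n. Beta (real n + 1/2 - Re \<mu>) (Re \<nu> + Re \<mu> + 1) * Beta (real n + 1/2 + Re \<mu>) (1/2 - Re \<mu>)"
  let ?F = "norm (remainder_factor N \<zeta> \<mu> \<nu>)"
  define S where "S = sin \<zeta>"
  have S: "S > 0" using sin_gt_zero[OF \<zeta>] by (simp add: S_def)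
  have s0: "s_factor \<zeta> \<ge> 0"
    using S unfolding s_factor_def S_def by simp
  have M: "?F * ?M n = bound_factor \<mu> \<nu> * abs_a_over_cos n (Re \<mu>) / Gamma (Re \<nu> + 3/2 + real n) * (2 ^ n / (2 * S) ^ N)"
    if "n = N \<or> n = N + 1" for n
    unfolding S_def using that \<mu> \<nu> S by (intro norm_remainder_factor_beta) (auto simp: S_def)
  have "norm R \<le> ?F * (A * s_factor \<zeta> * ?M N + B * s_factor \<zeta> / (2 * sin \<zeta>) * ?M (N + 1))"
    unfolding R norm_mult
    using AB s0 S K by (intro mult_left_mono remainder_combination_bound[OF \<mu> \<nu>]) (auto simp: S_def)
  also have "\<dots> = A * s_factor \<zeta> * (?F * ?M N) + B * s_factor \<zeta> / (2 * S) * (?F * ?M (N + 1))"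
    by (simp add: S_def algebra_simps)
  also have "\<dots> = A * s_factor \<zeta> * (bound_factor \<mu> \<nu> * abs_a_over_cos N (Re \<mu>) / Gamma (Re \<nu> + 3/2 + real N) * (2 ^ N / (2 * S) ^ N)) +
     B * s_factor \<zeta> / (2 * S) * (bound_factor \<mu> \<nu> * abs_a_over_cos (N + 1) (Re \<mu>) / Gamma (Re \<nu> + 3/2 + real (N + 1)) * (2 ^ (N + 1) / (2 * S) ^ N))"
    by (simp only: M simp_thms)
  also have "Re \<nu> + 3/2 + real (N + 1) = Re \<nu> + 5/2 + real N" by simp
  also have "A * s_factor \<zeta> * (bound_factor \<mu> \<nu> * abs_a_over_cos N (Re \<mu>) / Gamma (Re \<nu> + 3/2 + real N) * (2 ^ N / (2 * S) ^ N)) +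
     B * s_factor \<zeta> / (2 * S) * (bound_factor \<mu> \<nu> * abs_a_over_cos (N + 1) (Re \<mu>) / Gamma (Re \<nu> + 5/2 + real N) * (2 ^ (N + 1) / (2 * S) ^ N)) =
    bound_factor \<mu> \<nu> *
      (abs_a_over_cos N (Re \<mu>) * A / (Gamma (Re \<nu> + 3/2 + real N) * S ^ N) +
       abs_a_over_cos (N + 1) (Re \<mu>) * B / (Gamma (Re \<nu> + 5/2 + real N) * S ^ (N + 1))) * s_factor \<zeta>"
  proof -
    have p: "(2::real) ^ N / (2 * S) ^ N = 1 / S ^ N" "1 / (2 * S) * (2 ^ (N + 1) / (2 * S) ^ N) = 1 / S ^ (N + 1)"
      using S by (simp_all add: power_mult_distrib)
    have e: "x * (y * (2 ^ N / (2 * S) ^ N)) = x * (y / S ^ N)"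
      "x / (2 * S) * (y * (2 ^ (N + 1) / (2 * S) ^ N)) = x * (y / S ^ (N + 1))" for x y :: real
    proof -
      show "x * (y * (2 ^ N / (2 * S) ^ N)) = x * (y / S ^ N)" unfolding p by simp
      have "x / (2 * S) * (y * z) = x * y * (1 / (2 * S) * z)" for z by simp
      then show "x / (2 * S) * (y * (2 ^ (N + 1) / (2 * S) ^ N)) = x * (y / S ^ (N + 1))" unfolding p by simp
    qed
    show ?thesis unfolding e by (simp add: distrib_left distrib_right mult_ac)
  qed
  finally show ?thesis unfolding S_def .
qed

theorem theorem4p2:
  fixes \<zeta> :: real and N :: nat and \<mu> \<nu> RP RQ :: complex
  assumes "0 < \<zeta>" and "\<zeta> < pi"
    and "- real N - 1 / 2 < Re \<mu>" and "Re \<mu> < 1 / 2"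
    and "Re \<nu> > - Re \<mu> - 1"
    and RP: "ferrers_P \<nu> \<mu> (cos \<zeta>) =
      of_real (sqrt (2 / (pi * sin \<zeta>))) * Gamma (\<nu> + \<mu> + 1) *
        ((\<Sum>n<N. a_coeff n \<mu> * cos (ferrers_beta \<zeta> \<mu> \<nu> n)
            / (Gamma (\<nu> + 3 / 2 + of_nat n) * of_real (sin \<zeta> ^ n))) + RP)"
    and RQ: "ferrers_Q \<nu> \<mu> (cos \<zeta>) =
      - of_real (sqrt (pi / (2 * sin \<zeta>))) * Gamma (\<nu> + \<mu> + 1) *
        ((\<Sum>n<N. a_coeff n \<mu> * sin (ferrers_beta \<zeta> \<mu> \<nu> n)
            / (Gamma (\<nu> + 3 / 2 + of_nat n) * of_real (sin \<zeta> ^ n))) + RQ)"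
  shows "cmod RP \<le> bound_factor \<mu> \<nu> *
           (abs_a_over_cos N (Re \<mu>) * cosh (Im (ferrers_beta \<zeta> \<mu> \<nu> N))
             / (Gamma (Re \<nu> + 3 / 2 + real N) * sin \<zeta> ^ N)) * s_factor \<zeta>
       \<and> cmod RQ \<le> bound_factor \<mu> \<nu> *
           (abs_a_over_cos N (Re \<mu>) * cosh (Im (ferrers_beta \<zeta> \<mu> \<nu> N))
             / (Gamma (Re \<nu> + 3 / 2 + real N) * sin \<zeta> ^ N)) * s_factor \<zeta>
       \<and> cmod RP \<le> bound_factor \<mu> \<nu> *
           (abs_a_over_cos N (Re \<mu>) * cmod (cos (ferrers_beta \<zeta> \<mu> \<nu> N))
             / (Gamma (Re \<nu> + 3 / 2 + real N) * sin \<zeta> ^ N)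
          + abs_a_over_cos (N + 1) (Re \<mu>) * cmod (sin (ferrers_beta \<zeta> \<mu> \<nu> N))
             / (Gamma (Re \<nu> + 5 / 2 + real N) * sin \<zeta> ^ (N + 1))) * s_factor \<zeta>
       \<and> cmod RQ \<le> bound_factor \<mu> \<nu> *
           (abs_a_over_cos N (Re \<mu>) * cmod (sin (ferrers_beta \<zeta> \<mu> \<nu> N))
             / (Gamma (Re \<nu> + 3 / 2 + real N) * sin \<zeta> ^ N)
          + abs_a_over_cos (N + 1) (Re \<mu>) * cmod (cos (ferrers_beta \<zeta> \<mu> \<nu> N))
             / (Gamma (Re \<nu> + 5 / 2 + real N) * sin \<zeta> ^ (N + 1))) * s_factor \<zeta>"
proof -
  note \<zeta> = \<open>0 < \<zeta>\<close> \<open>\<zeta> < pi\<close> and \<mu> = \<open>- real N - 1 / 2 < Re \<mu>\<close> \<open>Re \<mu> < 1 / 2\<close>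
  have \<nu>: "Re \<nu> + Re \<mu> > -1" using \<open>Re \<nu> > - Re \<mu> - 1\<close> by simp
  let ?b = "ferrers_beta \<zeta> \<mu> \<nu> N"
  note P = ferrers_remainder_bound[OF \<zeta> \<mu> \<nu> ferrers_remainder_P[OF \<zeta> \<mu> \<nu> RP]]
  note Q = ferrers_remainder_bound[OF \<zeta> \<mu> \<nu> ferrers_remainder_Q[OF \<zeta> \<mu> \<nu> RQ]]
  note K = kernel_bounds[OF \<zeta>, of _ ?b]
  \<comment> \<open>The choice \<open>B = 0\<close> removes the term of index \<open>N + 1\<close>
    and gives the two cosh bounds; taking the moduli of cos and sin of \<open>?b\<close> for
    \<open>A\<close> and \<open>B\<close> gives the two-term bounds, with the roles exchanged for
    Q.\<close>
  show ?thesis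
    using P[of "cosh (Im ?b)" 0] Q[of "cosh (Im ?b)" 0]
      P[of "norm (cos ?b)" "norm (sin ?b)"] Q[of "norm (sin ?b)" "norm (cos ?b)"] K by simp
qed

end
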